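(* Let $\mathbb F$ be a finite field with $q$ elements, $A=\mathbb F[t]$, $R=\mathbb F[\theta]$, $K=\mathbb F(\theta)$ viewed as an $A$-field via $\gamma:t\mapsto\theta$. Let $\phi:A\to R\{\tau\}$ be a Drinfeld model and let $\mathbb M^\vee(\phi)$ be its associated Anderson model. Then: (1) $L(\phi;T)=L\big(\mathbb M^\vee(\phi);T\big)$; (2) $L_{\mathfrak p}(\phi;T)=L_{\mathfrak p}\big(\mathbb M^\vee(\phi);T\big)$ for every place $\mathfrak p$ of $R$.
   Context: Places of $R$ are monic irreducible polynomials in $\theta$, identified with places of $A$ via $\theta\mapsto t$; for a place $\mathfrak q$, $\mathbb F_{\mathfrak q}:=R/\mathfrak q$ is an $A$-field via $t\mapsto\theta$. A Drinfeld model is an $\mathbb F$-algebra homomorphism $\phi:A\to R\{\tau\}$ ($\tau c=c^q\tau$) with $\phi_t=\theta+g_1\tau+\cdots+g_r\tau^r$, $g_i\in R$, $g_r\ne0$. $L$-series of $\phi$: $\phi^\sim_t:=\theta+g_1T\tau+\cdots+g_rT^r\tau^r$; for a place $\mathfrak q$, $|\phi^\sim(\mathbb F_{\mathfrak q})|:=\det_{A[T]}(t-\phi^\sim_t\mid A\otimes_{\mathbb F}\mathbb F_{\mathfrak q}[T])$ ($t$ acting on $A$, $\phi^\sim_t$ on $\mathbb F_{\mathfrak q}[T]$ with $\tau(\sum c_jT^j)=\sum c_j^qT^j$), $P_{\mathfrak q}(\phi;T):=\mathfrak q^{-1}|\phi^\sim(\mathbb F_{\mathfrak q})|$ ($\mathfrak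 q$ read in $A$), $L(\phi;T):=\prod_{\mathfrak q}P_{\mathfrak q}(\phi;T)^{-1}$, $L_{\mathfrak p}(\phi;T):=P_{\mathfrak p}(\phi;T)L(\phi;T)$. Anderson motives over an $A$-field $F$: $A_F:=A\otimes F$, $\theta=1\otimes\gamma(t)$, $\tau(a\otimes x)=a\otimes x^q$, $\tau^*M:=A_F\otimes_{\tau,A_F}M$; an Anderson motive is a finite free $A_F$-module $M$ with an $A_F$-linear isomorphism $\tau_M:\tau^*M[\frac1{t-\theta}]\to M[\frac1{t-\theta}]$. $\mathbb M(\phi)$ is $K\{\tau\}$ with $(a\otimes x)\bullet f=xf\phi_a$ and $\tau_{\mathbb M(\phi)}(\tau^*f)=f\tau$; it has $A_K$-basis $u_i=\tau^i$, $0\le i<r$. Its dual $\mathbb M(\phi)^\vee=\mathrm{Hom}_{A_K}(\mathbb M(\phi),A_K)$ has $\tau_{M^\vee}$ characterized by $\tau_{M^\vee}(f)\circ\tau_M=\tau\circ f$; explicitly $\tau_{M^\vee}(\tau^*u_i^\vee)=u_{i+1}^\vee+\frac{g_{i+1}}{t-\theta}u_0^\vee$ ($u_r^\vee:=0$), where $(u_i^\vee)$ is the dual basis. With $A_R:=A\otimes R=\mathbb F[t,\theta]$, $\mathbb M^\vee(\phi)$ is the $A_R$-submodule $M_R$ of $\mathbb M(\phi)^\vee$ generated by $u_0^\vee,\dots,u_{r-1}^\vee$; it satisfies $\tau_M(\tau^*M_R)\subset M_R[\frac1{t-\theta}]$. $L$-series of an Anderson model $M_R$: for a place $\mathfrak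 q$ of degree $d$, $M_{\mathfrak q}:=M_R/\mathfrak qM_R$ (a module over $A\otimes\mathbb F_{\mathfrak q}$, with $\tau_M$ inducing a semilinear map); $P_{\mathfrak q}(M_R;T):=\det_{A[\frac1{\mathfrak q},T]\otimes\mathbb F_{\mathfrak q}}\big(1-T^d\tau_M^d\mid A[\frac1{\mathfrak q},T]\otimes_AM_{\mathfrak q}\big)$, where $\mathfrak q$ is viewed in $A$ via $\theta\mapsto t$ and $\tau_M^d$ is the induced linear endomorphism; $L(M_R;T):=\prod_{\mathfrak q}P_{\mathfrak q}(M_R;T)^{-1}$ and $L_{\mathfrak p}(M_R;T):=\prod_{\mathfrak q\ne\mathfrak p}P_{\mathfrak q}(M_R;T)^{-1}$. *)

theory Defs
  imports
    "HOL-Computational_Algebra.Computational_Algebra"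
    "HOL-Library.Cardinality"
    "HOL-Library.Function_Algebras"
    "Jordan_Normal_Form.Determinant"
begin

text \<open>
  The finite field \<open>F\<close> is a type \<open>'f\<close>, with \<open>CARD('f)\<close> elements; this cardinality is written \<open>q\<close> in
  \<open>skew_mult\<close> and in the exponents of comments, everywhere else \<open>q\<close> is
  a place. Both \<open>A = F[t]\<close> and \<open>R = F[\<theta>]\<close> are \<open>'f poly\<close>, which makes the identification
  \<open>\<theta> \<mapsto> t\<close> of their places the identity. In the other rings the variables are nested as follows, innermost first:

  \<^item> \<open>K = F(\<theta>)\<close>: \<open>'f poly fract\<close>;
  \<^item> \<open>A \<otimes> R = F[\<theta>][t]\<close>: \<open>'f poly poly\<close>, and \<open>A \<otimes> K = K[t]\<close>: \<open>'f poly fract poly\<close>;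
  \<^item> \<open>K(t)\<close>, the fraction field of \<open>A \<otimes> K\<close>: \<open>'f poly fract poly fract\<close>;
  \<^item> \<open>A[T] = F[t][T]\<close>: \<open>'f poly poly\<close>, and \<open>A \<otimes> R[T] = F[\<theta>][t][T]\<close>: \<open>'f poly poly poly\<close>.
\<close>

type_synonym 'f Kt = "'f poly fract poly fract"

definition places :: "'f::field poly set" where
  "places = {p. irreducible p \<and> lead_coeff p = 1}"


section \<open>Determinants of endomorphisms of quotient modules\<close>

text \<open>
  \<open>S\<close> is a subring of the ring \<open>'s\<close> with an ideal \<open>J\<close>, and \<open>N \<subseteq> M\<close> are subgroups of \<open>'v\<close> such that
  \<open>M / N\<close> is a module over \<open>S / J\<close> through \<open>smul\<close>. The list \<open>bs\<close> represents a basis of \<open>M / N\<close>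
  over \<open>S / J\<close>.
\<close>

definition quot_basis ::
  "'s::comm_ring_1 set \<Rightarrow> 's set \<Rightarrow> ('s \<Rightarrow> 'v::ab_group_add \<Rightarrow> 'v) \<Rightarrow> 'v set \<Rightarrow> 'v set
    \<Rightarrow> 'v list \<Rightarrow> bool" where
  "quot_basis S J smul M N bs \<longleftrightarrow>
     set bs \<subseteq> M \<and>
     (\<forall>m\<in>M. \<exists>c. (\<forall>i<length bs. c i \<in> S) \<and> m - (\<Sum>i<length bs. smul (c i) (bs ! i)) \<in> N) \<and>
     (\<forall>c. (\<forall>i<length bs. c i \<in> S) \<and> (\<Sum>i<length bs. smul (c i) (bs ! i)) \<in> N \<longrightarrow>
          (\<forall>i<length bs. c i \<in> J))"

text \<open>\<open>\<delta> \<in> S\<close> represents the determinant, an element of \<open>S / J\<close>, of the \<open>S / J\<close>-linear endomorphism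
  of the finite free module \<open>M / N\<close> induced by \<open>f\<close>.\<close>

definition is_quot_det ::
  "'s::comm_ring_1 set \<Rightarrow> 's set \<Rightarrow> ('s \<Rightarrow> 'v::ab_group_add \<Rightarrow> 'v) \<Rightarrow> 'v set \<Rightarrow> 'v set
    \<Rightarrow> ('v \<Rightarrow> 'v) \<Rightarrow> 's \<Rightarrow> bool" where
  "is_quot_det S J smul M N f \<delta> \<longleftrightarrow> \<delta> \<in> S \<and>
     (\<exists>bs X. quot_basis S J smul M N bs \<and>
        X \<in> carrier_mat (length bs) (length bs) \<and> elements_mat X \<subseteq> S \<and>
        (\<forall>j<length bs. f (bs ! j) - (\<Sum>i<length bs. smul (X $$ (i, j)) (bs ! i)) \<in> N) \<and>
        \<delta> - det X \<in> J)"


section \<open>Euler products\<close>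

text \<open>The limit is taken in the \<open>T\<close>-adic topology, along the finite sets of places.\<close>

definition euler_convergent :: "'p set \<Rightarrow> ('p \<Rightarrow> 'a::field fps) \<Rightarrow> bool" where
  "euler_convergent S P \<longleftrightarrow>
     (\<exists>L. ((\<lambda>X. \<Prod>p\<in>X. inverse (P p)) \<longlongrightarrow> L) (finite_subsets_at_top S))"

definition euler_product :: "'p set \<Rightarrow> ('p \<Rightarrow> 'a::field fps) \<Rightarrow> 'a fps" where
  "euler_product S P = Lim (finite_subsets_at_top S) (\<lambda>X. \<Prod>p\<in>X. inverse (P p))"


section \<open>Drinfeld models and their L-series\<close>

text \<open>The skew polynomial \<open>\<Sum>c\<^sub>i \<tau>\<^sup>i\<close> is stored as \<open>\<Sum>c\<^sub>i X\<^sup>i\<close>; addition and left scalar multiplication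
  are those of polynomials, but the product is determined by \<open>\<tau> c = c\<^sup>q \<tau>\<close>.\<close>

definition skew_mult :: "nat \<Rightarrow> 'c::comm_ring_1 poly \<Rightarrow> 'c poly \<Rightarrow> 'c poly" where
  "skew_mult q f g =
     (\<Sum>i\<le>degree f. \<Sum>j\<le>degree g. monom (coeff f i * coeff g j ^ (q ^ i)) (i + j))"

definition var :: "'a::comm_ring_1 poly" where
  "var = [:0, 1:]"

text \<open>\<open>\<phi> : A \<rightarrow> R{\<tau>}\<close> is a homomorphism of \<open>F\<close>-algebras, \<open>\<phi>\<^sub>t\<close> has constant term \<open>\<theta>\<close>, and its rank
  (its degree in \<open>\<tau>\<close>) is positive.\<close>

definition drinfeld_model :: "('f::{field,finite} poly \<Rightarrow> 'f poly poly) \<Rightarrow> bool" where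
  "drinfeld_model \<phi> \<longleftrightarrow>
     (\<forall>a b. \<phi> (a + b) = \<phi> a + \<phi> b) \<and>
     (\<forall>a b. \<phi> (a * b) = skew_mult CARD('f) (\<phi> a) (\<phi> b)) \<and>
     (\<forall>c. \<phi> [:c:] = [:[:c:]:]) \<and>
     coeff (\<phi> var) 0 = var \<and>
     degree (\<phi> var) > 0"

definition drinfeld_rank :: "('f::field poly \<Rightarrow> 'f poly poly) \<Rightarrow> nat" where
  "drinfeld_rank \<phi> = degree (\<phi> var)"

definition drinfeld_coeff :: "('f::field poly \<Rightarrow> 'f poly poly) \<Rightarrow> nat \<Rightarrow> 'f poly" where
  "drinfeld_coeff \<phi> i = coeff (\<phi> var) i"

definition frob_RtT :: "'f::{field,finite} poly poly poly \<Rightarrow> 'f poly poly poly" where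
  "frob_RtT = map_poly (map_poly (\<lambda>c. c ^ CARD('f)))"

text \<open>\<open>t - \<phi>\<^sup>~\<^sub>t\<close> on \<open>A \<otimes> R[T]\<close>; the coefficient \<open>g\<^sub>0\<close> is \<open>\<theta>\<close>.\<close>

definition t_minus_phi ::
  "('f::{field,finite} poly \<Rightarrow> 'f poly poly) \<Rightarrow> 'f poly poly poly \<Rightarrow> 'f poly poly poly" where
  "t_minus_phi \<phi> m =
     [:var:] * m - (\<Sum>i\<le>drinfeld_rank \<phi>. monom [:drinfeld_coeff \<phi> i:] i * (frob_RtT ^^ i) m)"

text \<open>The \<open>A[T]\<close>-module \<open>A \<otimes> F\<^sub>q[T]\<close> is the quotient of \<open>A \<otimes> R[T]\<close> by the multiples of \<open>q(\<theta>)\<close>.\<close>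

definition drinfeld_order ::
  "('f::{field,finite} poly \<Rightarrow> 'f poly poly) \<Rightarrow> 'f poly \<Rightarrow> 'f poly poly" where
  "drinfeld_order \<phi> q =
     (THE \<delta>. is_quot_det UNIV {0} (\<lambda>c m. map_poly (map_poly (\<lambda>a. [:a:])) c * m)
        UNIV {m. [:[:q:]:] dvd m} (t_minus_phi \<phi>) \<delta>)"

definition drinfeld_P ::
  "('f::{field,finite} poly \<Rightarrow> 'f poly poly) \<Rightarrow> 'f poly \<Rightarrow> 'f poly fract poly" where
  "drinfeld_P \<phi> q =
     Polynomial.smult (inverse (to_fract q)) (map_poly to_fract (drinfeld_order \<phi> q))"

definition drinfeld_L ::
  "('f::{field,finite} poly \<Rightarrow> 'f poly poly) \<Rightarrow> 'f poly fract fps" where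
  "drinfeld_L \<phi> = euler_product places (\<lambda>q. fps_of_poly (drinfeld_P \<phi> q))"

definition drinfeld_L_without ::
  "('f::{field,finite} poly \<Rightarrow> 'f poly poly) \<Rightarrow> 'f poly \<Rightarrow> 'f poly fract fps" where
  "drinfeld_L_without \<phi> p = fps_of_poly (drinfeld_P \<phi> p) * drinfeld_L \<phi>"


section \<open>L-series of Anderson models\<close>

text \<open>The map induced on fraction fields by an injective ring homomorphism.\<close>

definition fract_map :: "('a::idom \<Rightarrow> 'b::idom) \<Rightarrow> 'a fract \<Rightarrow> 'b fract" where
  "fract_map h x = (THE y. \<exists>a b. b \<noteq> 0 \<and> x = Fract a b \<and> y = Fract (h a) (h b))"

definition emb_AR :: "'f::field poly poly \<Rightarrow> 'f Kt" where
  "emb_AR s = to_fract (map_poly to_fract s)"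

definition A_in_AR :: "'f::field poly \<Rightarrow> 'f poly poly" where
  "A_in_AR a = map_poly (\<lambda>c. [:c:]) a"

definition emb_Ft :: "'f::field poly fract \<Rightarrow> 'f Kt" where
  "emb_Ft = fract_map (map_poly (\<lambda>c. to_fract [:c:]))"

text \<open>
  The elements of \<open>A \<otimes> R\<close> whose image in \<open>A[1/q] \<otimes> F\<^sub>q\<close> is a unit. Inverting them and reducing
  modulo \<open>q(\<theta>)\<close> gives \<open>A[1/q] \<otimes> F\<^sub>q\<close>, and \<open>A[1/q] \<otimes>\<^sub>A M\<^sub>q\<close> when applied to a model. Inverting only
  \<open>q(t)\<close> would give the same quotients, but this set also contains \<open>t - \<theta>\<close>, because \<open>t - \<theta>\<close> divides
  \<open>q(t) - q(\<theta>)\<close>, and it is stable under \<open>\<tau>\<close>; so \<open>\<tau>\<^sub>M\<close> maps the localized model to itself.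
\<close>

definition units_at :: "'f::field poly \<Rightarrow> 'f poly poly set" where
  "units_at q = {s. \<exists>s' n. [:q:] dvd s * s' - A_in_AR q ^ n}"

definition loc_ring :: "'f::field poly \<Rightarrow> 'f Kt set" where
  "loc_ring q = {x. \<exists>s\<in>units_at q. emb_AR s * x \<in> range emb_AR}"

definition loc_model :: "('f::field Kt \<Rightarrow> 'v \<Rightarrow> 'v) \<Rightarrow> 'v set \<Rightarrow> 'f poly \<Rightarrow> 'v set" where
  "loc_model smul MR q = {v. \<exists>s\<in>units_at q. smul (emb_AR s) v \<in> MR}"

text \<open>Extension of scalars from a ring to its polynomial ring in \<open>T\<close>.\<close>

definition polys_over :: "'a::zero set \<Rightarrow> 'a poly set" where
  "polys_over X = {p. \<forall>i. coeff p i \<in> X}"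

definition poly_smul ::
  "('s::comm_ring_1 \<Rightarrow> 'v::ab_group_add \<Rightarrow> 'v) \<Rightarrow> 's poly \<Rightarrow> 'v poly \<Rightarrow> 'v poly" where
  "poly_smul smul p v =
     (\<Sum>i\<le>degree p. \<Sum>j\<le>degree v. monom (smul (coeff p i) (coeff v j)) (i + j))"

text \<open>
  The model is a finite free \<open>A \<otimes> R\<close>-submodule \<open>MR\<close> of a \<open>K(t)\<close>-vector space \<open>'v\<close>, on which \<open>tau\<close>
  is semilinear. In \<open>is_model_det\<close> the ring \<open>S / J\<close> is \<open>A[1/q, T] \<otimes> F\<^sub>q\<close> and the module
  \<open>M / N\<close> is \<open>A[1/q, T] \<otimes>\<^sub>A M\<^sub>q\<close>. The determinant lies in the subring
  \<open>A[1/q, T]\<close> of \<open>A[1/q, T] \<otimes> F\<^sub>q\<close>, and \<open>model_P\<close> is that element, with coefficients in \<open>F(t)\<close>.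
\<close>

definition is_model_det ::
  "('f::field Kt \<Rightarrow> 'v::ab_group_add \<Rightarrow> 'v) \<Rightarrow> ('v \<Rightarrow> 'v) \<Rightarrow> 'v set \<Rightarrow> 'f poly
    \<Rightarrow> 'f Kt poly \<Rightarrow> bool" where
  "is_model_det smul tau MR q \<delta> \<longleftrightarrow>
     is_quot_det
       (polys_over (loc_ring q)) (polys_over ((*) (emb_AR [:q:]) ` loc_ring q))
       (poly_smul smul)
       (polys_over (loc_model smul MR q))
       (polys_over (smul (emb_AR [:q:]) ` loc_model smul MR q))
       (\<lambda>v. v - poly_smul smul (monom 1 (degree q)) (map_poly (tau ^^ degree q) v))
       \<delta>"

definition model_P ::
  "('f::field Kt \<Rightarrow> 'v::ab_group_add \<Rightarrow> 'v) \<Rightarrow> ('v \<Rightarrow> 'v) \<Rightarrow> 'v set \<Rightarrow> 'f poly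
    \<Rightarrow> 'f poly fract poly" where
  "model_P smul tau MR q =
     (THE P. P \<in> polys_over {x. \<exists>n. to_fract (q ^ n) * x \<in> range to_fract} \<and>
             is_model_det smul tau MR q (map_poly emb_Ft P))"

definition model_L ::
  "('f::field Kt \<Rightarrow> 'v::ab_group_add \<Rightarrow> 'v) \<Rightarrow> ('v \<Rightarrow> 'v) \<Rightarrow> 'v set
    \<Rightarrow> 'f poly fract fps" where
  "model_L smul tau MR = euler_product places (\<lambda>q. fps_of_poly (model_P smul tau MR q))"

definition model_L_without ::
  "('f::field Kt \<Rightarrow> 'v::ab_group_add \<Rightarrow> 'v) \<Rightarrow> ('v \<Rightarrow> 'v) \<Rightarrow> 'v set \<Rightarrow> 'f poly
    \<Rightarrow> 'f poly fract fps" where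
  "model_L_without smul tau MR p =
     euler_product (places - {p}) (\<lambda>q. fps_of_poly (model_P smul tau MR q))"


section \<open>The Anderson model of a Drinfeld model\<close>

text \<open>The \<open>A \<otimes> K\<close>-module structure \<open>(a \<otimes> x) \<bullet> f = x f \<phi>\<^sub>a\<close> on \<open>K{\<tau>}\<close>.\<close>

definition motive_act ::
  "('f::{field,finite} poly \<Rightarrow> 'f poly poly) \<Rightarrow> 'f poly fract poly \<Rightarrow> 'f poly fract poly
    \<Rightarrow> 'f poly fract poly" where
  "motive_act \<phi> P f =
     (\<Sum>k\<le>degree P. Polynomial.smult (coeff P k)
        (skew_mult CARD('f) f (map_poly to_fract (\<phi> (var ^ k)))))"

text \<open>\<open>\<tau>\<^sub>M\<close>, as a semilinear map, is multiplication by \<open>\<tau>\<close> on the left: this is the side that commutes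
  with \<open>f \<mapsto> f \<phi>\<^sub>a\<close> and satisfies \<open>\<tau> (x f) = x\<^sup>q (\<tau> f)\<close>.\<close>

definition motive_tau :: "'f::{field,finite} poly fract poly \<Rightarrow> 'f poly fract poly" where
  "motive_tau f = skew_mult CARD('f) (monom 1 1) f"

text \<open>\<open>\<tau>\<close> on \<open>A \<otimes> K\<close>, extended to the fraction field.\<close>

definition frob_Kt :: "'f::{field,finite} Kt \<Rightarrow> 'f Kt" where
  "frob_Kt = fract_map (map_poly (\<lambda>x. x ^ CARD('f)))"

text \<open>The homomorphisms of \<open>A \<otimes> K\<close>-modules from the motive to \<open>K(t)\<close>. This is the extension of scalars
  of the dual motive to \<open>K(t)\<close>; it contains the dual motive, and the dual motive with \<open>t - \<theta>\<close>
  inverted.\<close>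

definition motive_dual ::
  "('f::{field,finite} poly \<Rightarrow> 'f poly poly) \<Rightarrow> ('f poly fract poly \<Rightarrow> 'f Kt) set" where
  "motive_dual \<phi> = {h. (\<forall>x y. h (x + y) = h x + h y) \<and>
                        (\<forall>P x. h (motive_act \<phi> P x) = to_fract P * h x)}"

definition fun_smul :: "'f::field Kt \<Rightarrow> ('m \<Rightarrow> 'f Kt) \<Rightarrow> ('m \<Rightarrow> 'f Kt)" where
  "fun_smul c h = (\<lambda>x. c * h x)"

definition dual_tau ::
  "('f::{field,finite} poly \<Rightarrow> 'f poly poly) \<Rightarrow> ('f poly fract poly \<Rightarrow> 'f Kt)
    \<Rightarrow> ('f poly fract poly \<Rightarrow> 'f Kt)" where
  "dual_tau \<phi> h = (THE g. g \<in> motive_dual \<phi> \<and> (\<forall>x. g (motive_tau x) = frob_Kt (h x)))"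

definition dual_basis ::
  "('f::{field,finite} poly \<Rightarrow> 'f poly poly) \<Rightarrow> nat \<Rightarrow> ('f poly fract poly \<Rightarrow> 'f Kt)" where
  "dual_basis \<phi> i = (THE h. h \<in> motive_dual \<phi> \<and>
     (\<forall>j<drinfeld_rank \<phi>. h (monom 1 j) = (if i = j then 1 else 0)))"

definition anderson_model ::
  "('f::{field,finite} poly \<Rightarrow> 'f poly poly) \<Rightarrow> ('f poly fract poly \<Rightarrow> 'f Kt) set" where
  "anderson_model \<phi> =
     {\<Sum>i<drinfeld_rank \<phi>. fun_smul (emb_AR (c i)) (dual_basis \<phi> i) | c. True}"

end

theory Submission
  imports
    "HOL-Algebra.Algebraic_Closure_Type"
    "Jordan_Normal_Form.Char_Poly"
    "Subresultants.More_Homomorphisms"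
    Defs
begin

text \<open>
  The two \<open>L\<close>-series agree factor by factor. Let \<open>\<alpha>\<close> be a root of the place \<open>q\<close>, of degree \<open>d\<close>, in
  the algebraic closure of \<open>F\<close>, and \<open>\<alpha>\<^sub>k\<close> (\<open>k < d\<close>) its conjugates under the Frobenius. Evaluating \<open>\<theta>\<close>
  at all the \<open>\<alpha>\<^sub>k\<close>, that is, conjugating by a Vandermonde matrix, turns \<open>t - \<phi>\<^sup>~\<^sub>t\<close> into the cyclic banded
  matrix whose row \<open>k\<close> reads \<open>(t - \<alpha>\<^sub>k) x\<^sub>k - \<Sum>\<^sub>i g\<^sub>i(\<alpha>\<^sub>k) T\<^sup>i x\<^bsub>k+i\<^esub>\<close>, with indices modulo \<open>d\<close>. Dividing
  the rows by \<open>t - \<alpha>\<^sub>k\<close> extracts the factor \<open>q(t)\<close>, and what remains is a periodic linear recurrence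
  of order \<open>r\<close>: its determinant is \<open>det(1 - T\<^sup>d C\<^sub>0 \<cdots> C\<^bsub>d-1\<^esub>)\<close>, where the \<open>C\<^sub>k\<close> are its companion
  matrices. These are the conjugates of the matrix of \<open>\<tau>\<close> in the dual basis, so that
  \<open>C\<^sub>0 \<cdots> C\<^bsub>d-1\<^esub>\<close> is the matrix of \<open>\<tau>\<^sup>d\<close> on the reduction of the model.
\<close>

text \<open>The two determinants live over different rings: one over A[T], for a module of rank d,
  the other over A[1/q, T] tensor F_q, for a module of rank r. They meet in E[T] with E = Fbar(t),
  where sending \<theta> to \<alpha> embeds A[1/q] tensor F_q. Determinants on quotients are given
  only through some choice of basis, so they are first shown to be independent of it, inside a
  domain into which the scalars modulo their ideal embed. On the model side nothing guarantees
  beforehand that the determinant has coefficients in A[1/q]. No Galois descent is carried out: the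
  Drinfeld factor, which has such coefficients by construction, is shown to have the same image in
  E[T]. The coefficient g_i comes with T^i on the Drinfeld side, while \<tau>^d carries a single
  T^d; conjugation by a diagonal matrix of powers of T leaves exactly one T for each of the d
  companion matrices. The common factor is a polynomial in T^d with constant term 1, and only
  finitely many places have bounded degree; this makes the Euler products converge.\<close>

hide_const (open) up_ring.monom up_ring.coeff Polynomials.degree Polynomials.var
  Divisibility.irreducible Polynomials.lead_coeff
no_notation Polynomials.var ("X\<index>")

section \<open>The determinant of a periodic linear recurrence\<close>

text \<open>Moves a window of r unknowns one step back: if x_k is the sum over j of b_j x_(k+1+j),
  it sends (x_(k+1), ..., x_(k+r)) to (x_k, ..., x_(k+r-1)).\<close>

definition companion :: "nat \<Rightarrow> (nat \<Rightarrow> 'a::comm_ring_1) \<Rightarrow> 'a mat" where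
  "companion r b = mat r r (\<lambda>(i, j). if i = 0 then b j else if i = Suc j then 1 else 0)"

definition mat_prod :: "nat \<Rightarrow> (nat \<Rightarrow> 'a::semiring_1 mat) \<Rightarrow> nat list \<Rightarrow> 'a mat" where
  "mat_prod r M ks = foldr (\<lambda>k A. M k * A) ks (1\<^sub>m r)"

lemma mat_prod_simps [simp]:
  "mat_prod r M [] = 1\<^sub>m r"
  "mat_prod r M (k # ks) = M k * mat_prod r M ks"
  by (simp_all add: mat_prod_def)

lemma mat_prod_carrier:
  "(\<And>k. M k \<in> carrier_mat r r) \<Longrightarrow> mat_prod r M ks \<in> carrier_mat r r"
  by (induction ks) (auto intro: mult_carrier_mat)

lemma companion_carrier [simp]: "companion r b \<in> carrier_mat r r"
  by (simp add: companion_def)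

lemma companion_dim [simp]: "dim_row (companion r b) = r" "dim_col (companion r b) = r"
  by (simp_all add: companion_def)

lemma companion_mult_index:
  assumes "A \<in> carrier_mat r r" "i < r" "j < r"
  shows "(companion r b * A) $$ (i, j) =
    (if i = 0 then (\<Sum>k<r. b k * A $$ (k, j)) else A $$ (i - 1, j))"
proof -
  have "(companion r b * A) $$ (i, j) = (\<Sum>k<r. companion r b $$ (i, k) * A $$ (k, j))"
    using assms by (simp add: scalar_prod_def atLeast0LessThan)
  also have "\<dots> = (\<Sum>k<r. (if i = 0 then b k else if k = i - 1 then 1 else 0) * A $$ (k, j))"
    using assms by (intro sum.cong) (auto simp: companion_def)
  also have "\<dots> = (if i = 0 then (\<Sum>k<r. b k * A $$ (k, j)) else A $$ (i - 1, j))"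
  proof (cases "i = 0")
    case False
    then have "(\<Sum>k<r. (if i = 0 then b k else if k = i - 1 then 1 else 0) * A $$ (k, j))
      = (\<Sum>k<r. if k = i - 1 then A $$ (k, j) else 0)"
      by (intro sum.cong) auto
    with False assms show ?thesis by simp
  qed simp
  finally show ?thesis .
qed

lemma prod_list_diag_mat_eq_1:
  assumes "\<And>i. i < dim_row A \<Longrightarrow> A $$ (i, i) = 1"
  shows "prod_list (diag_mat A) = 1"
proof -
  have "map (\<lambda>i. A $$ (i, i)) [0..<dim_row A] = map (\<lambda>_. 1) [0..<dim_row A]"
    using assms by (intro map_cong) auto
  then show ?thesis by (simp add: diag_mat_def map_replicate_const)
qed

lemma det_upper_unitriangular:
  assumes "A \<in> carrier_mat n n" "\<And>i j. j < i \<Longrightarrow> i < n \<Longrightarrow> A $$ (i, j) = 0"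
    "\<And>i. i < n \<Longrightarrow> A $$ (i, i) = 1"
  shows "det A = 1"
proof -
  have "upper_triangular A" using assms by (intro upper_triangularI) auto
  from det_upper_triangular[OF this assms(1)] show ?thesis
    using assms prod_list_diag_mat_eq_1[of A] by auto
qed

lemma det_lower_unitriangular:
  assumes "A \<in> carrier_mat n n" "\<And>i j. i < j \<Longrightarrow> j < n \<Longrightarrow> A $$ (i, j) = 0"
    "\<And>i. i < n \<Longrightarrow> A $$ (i, i) = 1"
  shows "det A = 1"
  using det_lower_triangular[OF assms(2) assms(1)] assms prod_list_diag_mat_eq_1[of A] by auto

lemma det_cyclic_recurrence:
  fixes b :: "nat \<Rightarrow> nat \<Rightarrow> 'a::idom"
  assumes d: "d > 0" and r: "r > 0"
  shows "det (mat d d (\<lambda>(k, l). (if k = l then 1 else 0)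
             - (\<Sum>i<r. if (k + i + 1) mod d = l then b k i else 0)))
         = det (1\<^sub>m r - mat_prod r (\<lambda>k. companion r (b k)) [0..<d])"
proof -
  \<comment> \<open>\<open>Z\<close> is the recurrence on the unknowns \<open>x\<^sub>0, \<dots>, x\<^bsub>d+r-1\<^esub>\<close>, bordered by the equations \<open>x\<^bsub>d+j\<^esub> = x\<^sub>j\<close>.
    Folding the last unknowns back (\<open>Z * W\<close>) gives the cyclic matrix, solving the recurrence
    backwards from the last \<open>r\<close> unknowns (\<open>Z * G\<close>) gives the transfer matrix.\<close>
  let ?n = "d + r"
  define Y where "Y = mat d d (\<lambda>(k, l). (if k = l then 1 else 0)
             - (\<Sum>i<r. if (k + i + 1) mod d = l then b k i else 0))"
  \<comment> \<open>\<open>P k\<close> carries the last window, which starts at index d, back to the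
    window that starts at index k.\<close>
  define P where "P k = mat_prod r (\<lambda>k. companion r (b k)) [k..<d]" for k
  define Z where "Z = mat ?n ?n (\<lambda>(k, l). (if k = l then 1 else 0) -
     (if k < d then (\<Sum>i<r. if k + i + 1 = l then b k i else 0) else if l + d = k then 1 else 0))"
  \<comment> \<open>For fixed j this is the solution of the recurrence whose last window is the j-th
    unit vector.\<close>
  define x where "x l j = (if l < d then P l $$ (0, j) else if l - d = j then 1 else 0)" for l j
  have P[simp]: "P k \<in> carrier_mat r r" for k
    unfolding P_def by (intro mat_prod_carrier) simp
  have P_step: "P k = companion r (b k) * P (Suc k)" if "k < d" for k
    unfolding P_def by (simp add: that upt_conv_Cons)
  \<comment> \<open>For i > 0, row i of \<open>P l\<close> is row i - 1 of \<open>P (Suc l)\<close>;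
    so an entry depends on l + i only, and the rows of \<open>P l\<close> are consecutive values of
    the solutions \<open>x\<close>.\<close>
  have P_x: "P l $$ (i, j) = x (l + i) j" if "i < r" "j < r" "l \<le> d" for l i j
    using \<open>l \<le> d\<close> that
  proof (induction l arbitrary: i rule: inc_induct)
    case base
    then show ?case by (simp add: P_def x_def)
  next
    case (step l)
    show ?case
    proof (cases i)
      case 0
      with step show ?thesis by (simp add: x_def)
    next
      case (Suc i')
      have "P l $$ (i, j) = P (Suc l) $$ (i', j)"
        unfolding P_step[OF step.hyps(2)] using Suc step.prems
        by (subst companion_mult_index[OF P]) auto
      then show ?thesis using step Suc by simp
    qed
  qed
  have x_rec: "x k j = (\<Sum>i<r. b k i * x (k + i + 1) j)" if "k < d" "j < r" for k j
  proof -
    have "x k j = P k $$ (0, j)" using that by (simp add: x_def)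
    also have "\<dots> = (\<Sum>i<r. b k i * P (Suc k) $$ (i, j))"
      unfolding P_step[OF that(1)] using that r by (subst companion_mult_index[OF P]) auto
    also have "\<dots> = (\<Sum>i<r. b k i * x (k + i + 1) j)"
      using that by (intro sum.cong) (auto simp: P_x)
    finally show ?thesis .
  qed
  \<comment> \<open>The sum is evaluated once for an arbitrary vector g; below, g runs through the
    columns of \<open>G\<close> and of \<open>W\<close>.\<close>
  have row: "(\<Sum>l<?n. Z $$ (k, l) * g l) =
     (if k < d then g k - (\<Sum>i<r. b k i * g (k + i + 1)) else g k - g (k - d))" if k: "k < ?n" for k g
  proof -
    have "(\<Sum>l<?n. Z $$ (k, l) * g l) = (\<Sum>l<?n. (if l = k then g l else 0) - (if k < d then
       (\<Sum>i<r. if l = k + i + 1 then b k i * g l else 0) else if l = k - d then g l else 0))"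
      using k by (intro sum.cong refl) (auto simp: Z_def left_diff_distrib sum_distrib_right
          intro!: sum.cong)
    also have "\<dots> = g k - (\<Sum>l<?n. if k < d then
       (\<Sum>i<r. if l = k + i + 1 then b k i * g l else 0) else if l = k - d then g l else 0)"
      using k by (simp add: sum_subtractf)
    also have "\<dots> = (if k < d then g k - (\<Sum>i<r. b k i * g (k + i + 1)) else g k - g (k - d))"
    proof (cases "k < d")
      case True
      have "(\<Sum>l<?n. \<Sum>i<r. if l = k + i + 1 then b k i * g l else 0) =
            (\<Sum>i<r. \<Sum>l<?n. if l = k + i + 1 then b k i * g l else 0)"
        by (rule sum.swap)
      also have "\<dots> = (\<Sum>i<r. b k i * g (k + i + 1))"
        using True by (intro sum.cong) auto
      finally show ?thesis using True by simp
    next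
      case False
      then show ?thesis using k by simp
    qed
    finally show ?thesis .
  qed
  have ZC: "Z \<in> carrier_mat ?n ?n" by (simp add: Z_def)
  have mult: "(Z * mat ?n ?n f) $$ (k, m) = 
      (if k < d then f (k, m) - (\<Sum>i<r. b k i * f (k + i + 1, m)) else f (k, m) - f (k - d, m))" 
    if "k < ?n" "m < ?n" for k m f
    using row[OF that(1), of "\<lambda>l. f (l, m)"] that ZC
    by (simp add: scalar_prod_def atLeast0LessThan)
  \<comment> \<open>The first d columns are unit vectors, the last r are the solutions
    \<open>x\<close>. Their last windows are unit vectors too, so \<open>G\<close> is upper
    unitriangular.\<close>
  define gf where "gf = (\<lambda>(l, m). if m < d then if l = m then 1 else 0 else x l (m - d))"
  \<comment> \<open>Column m < d marks the indices congruent to m modulo d: m itself and otherwise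
    only border indices, so \<open>W\<close> is lower unitriangular.\<close>
  define wf where "wf = (\<lambda>(l, m). if m < d then if l mod d = m then 1 else (0::'a)
     else if l = m then 1 else 0)"
  define G where "G = mat ?n ?n gf"
  define W where "W = mat ?n ?n wf"
  have "det G = 1"
    by (rule det_upper_unitriangular[where n = ?n]) (auto simp: G_def gf_def x_def)
  have "det W = 1"
    by (rule det_lower_unitriangular[where n = ?n]) (auto simp: W_def wf_def)
  define A where "A = mat d d (\<lambda>(k, l). (if k = l then 1 else 0) -
     (\<Sum>i<r. if k + i + 1 = l then b k i else 0))"
  have "det A = 1"
    by (rule det_upper_unitriangular[where n = d]) (auto simp: A_def intro!: sum.neutral)
  have "Z * G = four_block_mat A (0\<^sub>m d r) (mat r d (\<lambda>(i, j). (Z * G) $$ (i + d, j))) (1\<^sub>m r - P 0)"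
    (is "_ = four_block_mat _ _ ?L _")
  proof (rule eq_matI)
    fix k m assume "k < dim_row (four_block_mat A (0\<^sub>m d r) ?L (1\<^sub>m r - P 0))"
      "m < dim_col (four_block_mat A (0\<^sub>m d r) ?L (1\<^sub>m r - P 0))"
    moreover have dP: "dim_row (P 0) = r" "dim_col (P 0) = r" by (rule carrier_matD[OF P])+
    ultimately have km: "k < ?n" "m < ?n" by (auto simp: A_def)
    show "(Z * G) $$ (k, m) = four_block_mat A (0\<^sub>m d r) ?L (1\<^sub>m r - P 0) $$ (k, m)"
    proof (cases "k < d")
      case kd: True
      show ?thesis
      proof (cases "m < d")
        case True
        have "(\<Sum>i<r. b k i * gf (k + i + 1, m)) = (\<Sum>i<r. if k + i + 1 = m then b k i else 0)"
          using True by (intro sum.cong) (auto simp: gf_def)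
        then have "(Z * G) $$ (k, m) = A $$ (k, m)"
          unfolding G_def mult[OF km] using True kd by (simp add: A_def gf_def)
        then show ?thesis using True kd km by (simp add: A_def dP)
      next
        case False
        then have "x k (m - d) = (\<Sum>i<r. b k i * x (k + i + 1) (m - d))"
          using kd km by (intro x_rec) auto
        then have "(Z * G) $$ (k, m) = 0"
          unfolding G_def mult[OF km] using False kd by (simp add: gf_def)
        then show ?thesis using False kd km by (simp add: A_def dP)
      qed
    next
      case kd: False
      show ?thesis
      proof (cases "m < d")
        case True
        then show ?thesis using kd km by (simp add: A_def dP)
      next
        case False
        have "P 0 $$ (k - d, m - d) = x (k - d) (m - d)"
          using kd km False P_x[of "k - d" "m - d" 0] by simp
        then have "(Z * G) $$ (k, m) = (1\<^sub>m r - P 0) $$ (k - d, m - d)"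
          unfolding G_def mult[OF km] using False kd km by (simp add: gf_def dP x_def)
        then show ?thesis using False kd km by (simp add: A_def dP)
      qed
    qed
  qed (simp_all add: Z_def G_def A_def carrier_matD[OF P])
  moreover have "A \<in> carrier_mat d d" "?L \<in> carrier_mat r d" "1\<^sub>m r - P 0 \<in> carrier_mat r r"
    by (simp_all add: A_def minus_carrier_mat[OF P])
  ultimately have "det (Z * G) = det A * det (1\<^sub>m r - P 0)"
    by (metis det_four_block_mat_upper_right_zero)
  then have 1: "det Z = det (1\<^sub>m r - P 0)"
    using \<open>det A = 1\<close> \<open>det G = 1\<close> det_mult[OF ZC, of G] by (simp add: G_def)
  \<comment> \<open>The border equations restricted to the border unknowns. If r > d, some of them
    relate two border unknowns, so this block need not be the identity.\<close>
  define B where "B = mat r r (\<lambda>(i, j). (if i = j then 1 else 0) - (if j + d = i then 1 else (0::'a)))"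
  have "det B = 1"
    using d by (intro det_lower_unitriangular[where n = r]) (auto simp: B_def)
  have "Z * W = four_block_mat Y (mat d r (\<lambda>(i, j). (Z * W) $$ (i, j + d))) (0\<^sub>m r d) B"
    (is "_ = four_block_mat _ ?L _ _")
  proof (rule eq_matI)
    fix k m assume "k < dim_row (four_block_mat Y ?L (0\<^sub>m r d) B)"
      "m < dim_col (four_block_mat Y ?L (0\<^sub>m r d) B)"
    then have km: "k < ?n" "m < ?n" by (auto simp: Y_def B_def)
    show "(Z * W) $$ (k, m) = four_block_mat Y ?L (0\<^sub>m r d) B $$ (k, m)"
    proof (cases "k < d")
      case kd: True
      show ?thesis
      proof (cases "m < d")
        case True
        have "(\<Sum>i<r. b k i * wf (k + i + 1, m)) = (\<Sum>i<r. if (k + i + 1) mod d = m then b k i else 0)"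
          using True by (intro sum.cong) (auto simp: wf_def)
        then have "(Z * W) $$ (k, m) = Y $$ (k, m)"
          unfolding W_def mult[OF km] using True kd by (simp add: Y_def wf_def)
        then show ?thesis using True kd km by (simp add: Y_def B_def)
      next
        case False
        then show ?thesis using kd km by (simp add: Y_def B_def)
      qed
    next
      case kd: False
      show ?thesis
      proof (cases "m < d")
        case True
        have "(k - d) mod d = k mod d" using kd by (metis le_mod_geq not_le)
        then have "(Z * W) $$ (k, m) = 0"
          unfolding W_def mult[OF km] using True kd by (simp add: wf_def)
        then show ?thesis using True kd km by (simp add: Y_def B_def)
      next
        case False
        have "(Z * W) $$ (k, m) = B $$ (k - d, m - d)"
          unfolding W_def mult[OF km] using False kd km by (auto simp: wf_def B_def)
        then show ?thesis using False kd km by (simp add: Y_def B_def)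
      qed
    qed
  qed (auto simp: Z_def W_def Y_def B_def)
  moreover have "Y \<in> carrier_mat d d" "?L \<in> carrier_mat d r" "B \<in> carrier_mat r r"
    by (simp_all add: Y_def B_def)
  ultimately have "det (Z * W) = det Y * det B"
    by (metis det_four_block_mat_lower_left_zero)
  then have "det Z = det Y"
    using \<open>det B = 1\<close> \<open>det W = 1\<close> det_mult[OF ZC, of W] by (simp add: W_def)
  with 1 show ?thesis by (simp add: Y_def P_def)
qed


section \<open>Uniqueness of determinants on quotient modules\<close>

text \<open>The laws are required on \<open>S\<close> only. Reduction modulo q(\<theta>) kills a
  nonzero element of the field K(t), so it has no homomorphic extension to the whole field.\<close>

locale subring_hom =
  fixes S :: "'s::comm_ring_1 set" and \<psi> :: "'s \<Rightarrow> 'k::idom"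
  assumes one_mem: "1 \<in> S"
    and add_mem: "\<And>a b. a \<in> S \<Longrightarrow> b \<in> S \<Longrightarrow> a + b \<in> S"
    and uminus_mem: "\<And>a. a \<in> S \<Longrightarrow> - a \<in> S"
    and mult_mem: "\<And>a b. a \<in> S \<Longrightarrow> b \<in> S \<Longrightarrow> a * b \<in> S"
    and hom_one: "\<psi> 1 = 1"
    and hom_add: "\<And>a b. a \<in> S \<Longrightarrow> b \<in> S \<Longrightarrow> \<psi> (a + b) = \<psi> a + \<psi> b"
    and hom_mult: "\<And>a b. a \<in> S \<Longrightarrow> b \<in> S \<Longrightarrow> \<psi> (a * b) = \<psi> a * \<psi> b"
begin

lemma zero_mem: "0 \<in> S"
  using add_mem[OF one_mem uminus_mem[OF one_mem]] by simp

lemma hom_zero: "\<psi> 0 = 0"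
  using hom_add[OF zero_mem zero_mem] by (metis add_cancel_left_left add_0)

lemma hom_uminus: "a \<in> S \<Longrightarrow> \<psi> (- a) = - \<psi> a"
  using hom_add[OF _ uminus_mem, of a a] by (simp add: hom_zero eq_neg_iff_add_eq_0 add.commute)

lemma diff_mem: "a \<in> S \<Longrightarrow> b \<in> S \<Longrightarrow> a - b \<in> S"
  using add_mem[OF _ uminus_mem] by fastforce

lemma hom_diff: "a \<in> S \<Longrightarrow> b \<in> S \<Longrightarrow> \<psi> (a - b) = \<psi> a - \<psi> b"
  using hom_add[OF _ uminus_mem, of a b] by (simp add: hom_uminus)

lemma sum_mem: "(\<And>x. x \<in> X \<Longrightarrow> g x \<in> S) \<Longrightarrow> sum g X \<in> S"
  by (induction X rule: infinite_finite_induct) (auto intro: add_mem zero_mem)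

lemma hom_sum: "(\<And>x. x \<in> X \<Longrightarrow> g x \<in> S) \<Longrightarrow> \<psi> (sum g X) = (\<Sum>x\<in>X. \<psi> (g x))"
  by (induction X rule: infinite_finite_induct) (auto simp: hom_zero hom_add sum_mem)

lemma prod_mem: "(\<And>x. x \<in> X \<Longrightarrow> g x \<in> S) \<Longrightarrow> prod g X \<in> S"
  by (induction X rule: infinite_finite_induct) (auto intro: mult_mem one_mem)

lemma hom_prod: "(\<And>x. x \<in> X \<Longrightarrow> g x \<in> S) \<Longrightarrow> \<psi> (prod g X) = (\<Prod>x\<in>X. \<psi> (g x))"
  by (induction X rule: infinite_finite_induct) (auto simp: hom_one hom_mult prod_mem)

lemma signof_mem: "signof p \<in> S"
  by (simp add: sign_def one_mem uminus_mem)

lemma hom_signof: "\<psi> (signof p) = signof p"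
  by (simp add: sign_def hom_one hom_uminus one_mem)

lemma det_summand_mem:
  assumes "X \<in> carrier_mat n n" "elements_mat X \<subseteq> S" "p permutes {0..<n}"
  shows "i \<in> {0..<n} \<Longrightarrow> X $$ (i, p i) \<in> S"
proof -
  assume "i \<in> {0..<n}"
  then have "i < n" "p i < n" using permutes_in_image[OF assms(3)] by auto
  then show ?thesis using assms(1,2) unfolding elements_mat_def by force
qed

lemma det_mem:
  assumes "X \<in> carrier_mat n n" "elements_mat X \<subseteq> S"
  shows "det X \<in> S"
  unfolding det_def'[OF assms(1)]
  using det_summand_mem[OF assms] by (intro sum_mem mult_mem signof_mem prod_mem) auto

lemma hom_det:
  assumes "X \<in> carrier_mat n n" "elements_mat X \<subseteq> S"
  shows "\<psi> (det X) = det (map_mat \<psi> X)"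
proof -
  note mem = det_summand_mem[OF assms]
  have m: "map_mat \<psi> X \<in> carrier_mat n n" using assms(1) by simp
  have "\<psi> (det X) = (\<Sum>p | p permutes {0..<n}. \<psi> (signof p * (\<Prod>i=0..<n. X $$ (i, p i))))"
    unfolding det_def'[OF assms(1)] using mem
    by (intro hom_sum mult_mem signof_mem prod_mem) auto
  also have "\<dots> = (\<Sum>p | p permutes {0..<n}. signof p * (\<Prod>i=0..<n. map_mat \<psi> X $$ (i, p i)))"
  proof (intro sum.cong refl)
    fix p assume "p \<in> {p. p permutes {0..<n}}"
    then have p: "p permutes {0..<n}" by simp
    have "\<psi> (signof p * (\<Prod>i=0..<n. X $$ (i, p i))) = signof p * (\<Prod>i=0..<n. \<psi> (X $$ (i, p i)))"
      using mem[OF p] hom_mult[OF signof_mem prod_mem, of "{0..<n}" "\<lambda>i. X $$ (i, p i)" p]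
        hom_prod[of "{0..<n}" "\<lambda>i. X $$ (i, p i)"]
      by (simp only: hom_signof)
    also have "(\<Prod>i=0..<n. \<psi> (X $$ (i, p i))) = (\<Prod>i=0..<n. map_mat \<psi> X $$ (i, p i))"
      using assms(1) permutes_in_image[OF p] by (intro prod.cong) auto
    finally show "\<psi> (signof p * (\<Prod>i=0..<n. X $$ (i, p i))) =
        signof p * (\<Prod>i=0..<n. map_mat \<psi> X $$ (i, p i))" .
  qed
  finally show ?thesis unfolding det_def'[OF m] .
qed

end

text \<open>If m < n, padding both factors with zeros to size n keeps the product but gives the
  first one a zero column, hence determinant 0. It serves to show that two bases of the same
  quotient have the same length.\<close>

lemma mult_eq_one_mat_imp_le:
  fixes A :: "'k::idom mat"
  assumes A: "A \<in> carrier_mat n m" and B: "B \<in> carrier_mat m n" and AB: "A * B = 1\<^sub>m n"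
  shows "n \<le> m"
proof (rule ccontr)
  assume "\<not> n \<le> m"
  then have lt: "m < n" by simp
  define A' where "A' = mat n n (\<lambda>(i, j). if j < m then A $$ (i, j) else 0)"
  define B' where "B' = mat n n (\<lambda>(i, j). if i < m then B $$ (i, j) else 0)"
  have "A' * B' = A * B"
  proof (rule eq_matI)
    fix i j assume "i < dim_row (A * B)" "j < dim_col (A * B)"
    then have ij: "i < n" "j < n" using A B by auto
    have "(A' * B') $$ (i, j) = (\<Sum>k\<in>{0..<n}. if k < m then A $$ (i, k) * B $$ (k, j) else 0)"
      using ij by (simp add: A'_def B'_def scalar_prod_def) (intro sum.cong; auto)
    also have "\<dots> = (\<Sum>k\<in>{0..<m}. A $$ (i, k) * B $$ (k, j))"
      using lt by (intro sum.mono_neutral_cong_right) auto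
    also have "\<dots> = (A * B) $$ (i, j)" using ij A B by (simp add: scalar_prod_def)
    finally show "(A' * B') $$ (i, j) = (A * B) $$ (i, j)" .
  qed (use A B in \<open>auto simp: A'_def B'_def\<close>)
  moreover have "det A' = 0"
  proof -
    have "(\<Prod>j<n. A' $$ (p j, j)) = 0" if "p permutes {0..<n}" for p
      using lt permutes_in_image[OF that] by (intro prod_zero bexI[of _ m]) (auto simp: A'_def)
    moreover have "A' \<in> carrier_mat n n" by (simp add: A'_def)
    ultimately show ?thesis by (subst det_col[of _ n]) (auto intro!: sum.neutral)
  qed
  ultimately have "det (1\<^sub>m n :: 'k mat) = 0"
    using det_mult[of A' n B'] AB by (simp add: A'_def B'_def)
  then show False by simp
qed

text \<open>Since \<open>J\<close> is the kernel of \<open>\<psi>\<close>, the ring S / J embeds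
  into a domain, where determinants can be compared. Compatibility of \<open>f\<close> with scalars
  is asked modulo \<open>N\<close> only, because \<tau>^d is merely semilinear before
  reduction.\<close>

locale quot_module = subring_hom S \<psi>
  for S :: "'s::comm_ring_1 set" and \<psi> :: "'s \<Rightarrow> 'k::idom" +
  fixes J :: "'s set" and smul :: "'s \<Rightarrow> 'v::ab_group_add \<Rightarrow> 'v" and M N :: "'v set"
    and f :: "'v \<Rightarrow> 'v"
  assumes J: "J = {a \<in> S. \<psi> a = 0}"
    and M_zero: "0 \<in> M" and M_add: "\<And>x y. x \<in> M \<Longrightarrow> y \<in> M \<Longrightarrow> x + y \<in> M"
    and M_smul: "\<And>c x. c \<in> S \<Longrightarrow> x \<in> M \<Longrightarrow> smul c x \<in> M"
    and N_zero: "0 \<in> N" and N_diff: "\<And>x y. x \<in> N \<Longrightarrow> y \<in> N \<Longrightarrow> x - y \<in> N"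
    and N_smul: "\<And>c x. c \<in> S \<Longrightarrow> x \<in> N \<Longrightarrow> smul c x \<in> N"
    and smul_add_left: "\<And>c e x. smul (c + e) x = smul c x + smul e x"
    and smul_add_right: "\<And>c x y. smul c (x + y) = smul c x + smul c y"
    and smul_mult: "\<And>c e x. smul (c * e) x = smul c (smul e x)"
    and smul_one: "\<And>x. smul 1 x = x"
    and f_add: "\<And>x y. x \<in> M \<Longrightarrow> y \<in> M \<Longrightarrow> f (x + y) = f x + f y"
    and f_smul: "\<And>c x. c \<in> S \<Longrightarrow> x \<in> M \<Longrightarrow> f (smul c x) - smul c (f x) \<in> N"
    and f_mem: "\<And>x. x \<in> M \<Longrightarrow> f x \<in> M"
    and f_N: "\<And>x. x \<in> N \<Longrightarrow> f x \<in> N"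
begin

lemma smul_zero_left: "smul 0 x = 0"
  using smul_add_left[of 0 0 x] by simp

lemma smul_zero_right: "smul c 0 = 0"
  using smul_add_right[of c 0 0] by simp

lemma smul_diff_right: "smul c (x - y) = smul c x - smul c y"
  using smul_add_right[of c "x - y" y] by simp

lemma smul_diff_left: "smul (c - e) x = smul c x - smul e x"
  using smul_add_left[of "c - e" e x] by simp

lemma smul_sum_left: "smul (sum g X) x = (\<Sum>i\<in>X. smul (g i) x)"
  by (induction X rule: infinite_finite_induct) (auto simp: smul_zero_left smul_add_left)

lemma smul_sum_right: "smul c (sum g X) = (\<Sum>i\<in>X. smul c (g i))"
  by (induction X rule: infinite_finite_induct) (auto simp: smul_zero_right smul_add_right)

lemma M_diff: "x \<in> M \<Longrightarrow> y \<in> M \<Longrightarrow> x - y \<in> M"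
proof -
  assume "x \<in> M" "y \<in> M"
  then have "x + smul (- 1) y \<in> M" by (intro M_add M_smul uminus_mem one_mem)
  moreover have "smul (- 1) y = - y"
    using smul_diff_left[of 0 1 y] by (simp add: smul_zero_left smul_one)
  ultimately show ?thesis by simp
qed

lemma M_sum: "(\<And>i. i \<in> X \<Longrightarrow> g i \<in> M) \<Longrightarrow> sum g X \<in> M"
  by (induction X rule: infinite_finite_induct) (auto intro: M_add M_zero)

lemma N_add: "x \<in> N \<Longrightarrow> y \<in> N \<Longrightarrow> x + y \<in> N"
  using N_diff[OF _ N_diff[OF N_zero], of x y] by simp

lemma N_sum: "(\<And>i. i \<in> X \<Longrightarrow> g i \<in> N) \<Longrightarrow> sum g X \<in> N"
  by (induction X rule: infinite_finite_induct) (auto intro: N_add N_zero)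

definition comb :: "'v list \<Rightarrow> (nat \<Rightarrow> 's) \<Rightarrow> 'v" where
  "comb bs c = (\<Sum>i<length bs. smul (c i) (bs ! i))"

definition eqv (infix "\<sim>" 50) where "x \<sim> y \<longleftrightarrow> x - y \<in> N"

lemma eqv_sym: "x \<sim> y \<Longrightarrow> y \<sim> x"
  using N_diff[OF N_zero] unfolding eqv_def by fastforce

lemma eqv_trans [trans]: "x \<sim> y \<Longrightarrow> y \<sim> z \<Longrightarrow> x \<sim> z"
  using N_add unfolding eqv_def by fastforce

lemma comb_mem: "set bs \<subseteq> M \<Longrightarrow> (\<And>i. i < length bs \<Longrightarrow> c i \<in> S) \<Longrightarrow> comb bs c \<in> M"
  unfolding comb_def by (intro M_sum M_smul) (auto dest: nth_mem)

lemma comb_diff: "comb bs (\<lambda>i. c i - e i) = comb bs c - comb bs e"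
  by (simp add: comb_def smul_diff_left sum_subtractf)

lemma comb_unit: "i < length bs \<Longrightarrow> comb bs (\<lambda>k. if k = i then 1 else 0) = bs ! i"
proof -
  assume "i < length bs"
  moreover have "comb bs (\<lambda>k. if k = i then 1 else 0) = (\<Sum>k<length bs. if k = i then bs ! k else 0)"
    unfolding comb_def by (intro sum.cong) (auto simp: smul_zero_left smul_one)
  ultimately show ?thesis by simp
qed

lemma quot_basis_unique:
  assumes "quot_basis S J smul M N bs" "comb bs c \<sim> comb bs e"
    "\<And>i. i < length bs \<Longrightarrow> c i \<in> S" "\<And>i. i < length bs \<Longrightarrow> e i \<in> S" "i < length bs"
  shows "\<psi> (c i) = \<psi> (e i)"
proof -
  have "comb bs (\<lambda>i. c i - e i) \<in> N" using assms(2) by (simp add: comb_diff eqv_def)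
  then have "c i - e i \<in> J"
    using assms(1,3-5) unfolding quot_basis_def comb_def by (meson diff_mem)
  then show ?thesis using assms(3-5) by (simp add: J hom_diff)
qed

lemma comb_subst:
  assumes "\<And>j. j < length bs' \<Longrightarrow> bs' ! j \<sim> comb bs (\<lambda>i. P i j)"
    "\<And>j. j < length bs' \<Longrightarrow> c j \<in> S"
  shows "comb bs' c \<sim> comb bs (\<lambda>i. \<Sum>j<length bs'. c j * P i j)"
proof -
  have "comb bs (\<lambda>i. \<Sum>j<length bs'. c j * P i j)
    = (\<Sum>i<length bs. \<Sum>j<length bs'. smul (c j) (smul (P i j) (bs ! i)))"
    by (simp add: comb_def smul_sum_left smul_mult)
  also have "\<dots> = (\<Sum>j<length bs'. \<Sum>i<length bs. smul (c j) (smul (P i j) (bs ! i)))"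
    by (rule sum.swap)
  also have "\<dots> = (\<Sum>j<length bs'. smul (c j) (comb bs (\<lambda>i. P i j)))"
    by (simp add: comb_def smul_sum_right)
  finally have "comb bs' c - comb bs (\<lambda>i. \<Sum>j<length bs'. c j * P i j)
    = (\<Sum>j<length bs'. smul (c j) (bs' ! j - comb bs (\<lambda>i. P i j)))"
    by (simp add: comb_def[of bs'] sum_subtractf smul_diff_right)
  also have "\<dots> \<in> N" using assms by (intro N_sum N_smul) (auto simp: eqv_def)
  finally show ?thesis by (simp add: eqv_def)
qed

lemma f_zero: "f 0 = 0"
  using f_add[OF M_zero M_zero] by simp

lemma f_sum: "(\<And>i. i \<in> X \<Longrightarrow> g i \<in> M) \<Longrightarrow> f (sum g X) = (\<Sum>i\<in>X. f (g i))"
  by (induction X rule: infinite_finite_induct) (auto simp: f_zero f_add M_sum)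

lemma f_eqv: "x \<in> M \<Longrightarrow> y \<in> M \<Longrightarrow> x \<sim> y \<Longrightarrow> f x \<sim> f y"
  using f_N[of "x - y"] f_add[OF M_diff, of x y y] by (simp add: eqv_def)

lemma f_comb:
  assumes "set bs \<subseteq> M" "\<And>j. j < length bs \<Longrightarrow> f (bs ! j) \<sim> comb bs (\<lambda>i. X i j)"
    "\<And>i. i < length bs \<Longrightarrow> c i \<in> S"
  shows "f (comb bs c) \<sim> comb bs (\<lambda>i. \<Sum>j<length bs. c j * X i j)"
proof -
  have mem: "bs ! i \<in> M" if "i < length bs" for i using assms(1) that by auto
  have "f (comb bs c) = (\<Sum>i<length bs. f (smul (c i) (bs ! i)))"
    unfolding comb_def using assms(3) mem by (intro f_sum M_smul) auto
  then have "f (comb bs c) - comb (map f bs) c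
      = (\<Sum>i<length bs. f (smul (c i) (bs ! i)) - smul (c i) (f (bs ! i)))"
    by (simp add: comb_def sum_subtractf)
  also have "\<dots> \<in> N" using assms(3) mem by (intro N_sum f_smul) auto
  finally have "f (comb bs c) \<sim> comb (map f bs) c" by (simp add: eqv_def)
  also have "comb (map f bs) c \<sim> comb bs (\<lambda>i. \<Sum>j<length (map f bs). c j * X i j)"
    using assms by (intro comb_subst) auto
  finally show ?thesis by simp
qed

lemma quot_basis_expand:
  assumes "quot_basis S J smul M N bs" "set bs' \<subseteq> M"
  obtains P where "\<And>i j. i < length bs \<Longrightarrow> j < length bs' \<Longrightarrow> P i j \<in> S"
    "\<And>j. j < length bs' \<Longrightarrow> bs' ! j \<sim> comb bs (\<lambda>i. P i j)"
proof -
  have "\<forall>j. \<exists>c. j < length bs' \<longrightarrow> (\<forall>i<length bs. c i \<in> S) \<and> bs' ! j \<sim> comb bs c"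
    using assms unfolding quot_basis_def comb_def eqv_def by (meson nth_mem subsetD)
  then obtain c where "\<And>j. j < length bs' \<Longrightarrow> (\<forall>i<length bs. c j i \<in> S) \<and> bs' ! j \<sim> comb bs (c j)"
    by metis
  then show ?thesis by (intro that[of "\<lambda>i j. c j i"]) auto
qed

text \<open>The coefficients are chosen, not canonical, so expanding in one basis and back gives the
  identity only after \<open>\<psi>\<close>.\<close>

lemma change_of_basis_inverse:
  assumes bs: "quot_basis S J smul M N bs"
    and P: "\<And>i j. i < length bs \<Longrightarrow> j < length bs' \<Longrightarrow> P i j \<in> S"
      "\<And>j. j < length bs' \<Longrightarrow> bs' ! j \<sim> comb bs (\<lambda>i. P i j)"
    and Q: "\<And>i j. i < length bs' \<Longrightarrow> j < length bs \<Longrightarrow> Q i j \<in> S"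
      "\<And>j. j < length bs \<Longrightarrow> bs ! j \<sim> comb bs' (\<lambda>i. Q i j)"
  shows "mat (length bs) (length bs') (\<lambda>(i, j). \<psi> (P i j)) *
    mat (length bs') (length bs) (\<lambda>(i, j). \<psi> (Q i j)) = 1\<^sub>m (length bs)"
proof (rule eq_matI)
  fix k i assume "k < dim_row (1\<^sub>m (length bs))" "i < dim_col (1\<^sub>m (length bs))"
  then have ki: "k < length bs" "i < length bs" by auto
  have "comb bs' (\<lambda>j. Q j i) \<sim> comb bs (\<lambda>k. \<Sum>j<length bs'. Q j i * P k j)"
    using ki P Q by (intro comb_subst) auto
  with Q(2)[OF ki(2)] have "bs ! i \<sim> comb bs (\<lambda>k. \<Sum>j<length bs'. Q j i * P k j)"
    by (rule eqv_trans)
  then have "comb bs (\<lambda>k. if k = i then 1 else 0) \<sim> comb bs (\<lambda>k. \<Sum>j<length bs'. Q j i * P k j)"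
    by (simp add: comb_unit ki)
  moreover have "(if k = i then 1 else 0) \<in> S" for k by (simp add: one_mem zero_mem)
  moreover have "(\<Sum>j<length bs'. Q j i * P k j) \<in> S" if "k < length bs" for k
    using P Q ki that by (intro sum_mem mult_mem) auto
  ultimately have "\<psi> (if k = i then 1 else 0) = \<psi> (\<Sum>j<length bs'. Q j i * P k j)"
    using quot_basis_unique[OF bs _ _ _ ki(1)] by blast
  also have "\<dots> = (\<Sum>j<length bs'. \<psi> (P k j) * \<psi> (Q j i))"
    using P Q ki by (subst hom_sum) (auto intro!: mult_mem sum.cong simp: hom_mult mult.commute)
  finally show "(mat (length bs) (length bs') (\<lambda>(i, j). \<psi> (P i j)) *
    mat (length bs') (length bs) (\<lambda>(i, j). \<psi> (Q i j))) $$ (k, i) = 1\<^sub>m (length bs) $$ (k, i)"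
    using ki by (simp add: scalar_prod_def atLeast0LessThan hom_one hom_zero split: if_splits)
qed auto

text \<open>Similar matrices have the same determinant. This is what allows the descriptions in
  \<open>drinfeld_order\<close> and \<open>model_P\<close> to be evaluated from one convenient
  basis.\<close>

lemma quot_det_unique:
  assumes "is_quot_det S J smul M N f \<delta>" "is_quot_det S J smul M N f \<delta>'"
  shows "\<psi> \<delta> = \<psi> \<delta>'"
proof -
  obtain bs X where bs: "quot_basis S J smul M N bs"
    and X: "X \<in> carrier_mat (length bs) (length bs)" "elements_mat X \<subseteq> S"
    and fX: "\<And>j. j < length bs \<Longrightarrow> f (bs ! j) \<sim> comb bs (\<lambda>i. X $$ (i, j))"
    and dX: "\<delta> \<in> S" "\<delta> - det X \<in> J"
    using assms(1) unfolding is_quot_det_def comb_def eqv_def by blast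
  obtain bs' X' where bs': "quot_basis S J smul M N bs'"
    and X': "X' \<in> carrier_mat (length bs') (length bs')" "elements_mat X' \<subseteq> S"
    and fX': "\<And>j. j < length bs' \<Longrightarrow> f (bs' ! j) \<sim> comb bs' (\<lambda>i. X' $$ (i, j))"
    and dX': "\<delta>' \<in> S" "\<delta>' - det X' \<in> J"
    using assms(2) unfolding is_quot_det_def comb_def eqv_def by blast
  have sub: "set bs \<subseteq> M" "set bs' \<subseteq> M" using bs bs' by (auto simp: quot_basis_def)
  obtain P where P: "\<And>i j. i < length bs \<Longrightarrow> j < length bs' \<Longrightarrow> P i j \<in> S"
      "\<And>j. j < length bs' \<Longrightarrow> bs' ! j \<sim> comb bs (\<lambda>i. P i j)"
    using quot_basis_expand[OF bs sub(2)] by blast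
  obtain Q where Q: "\<And>i j. i < length bs' \<Longrightarrow> j < length bs \<Longrightarrow> Q i j \<in> S"
      "\<And>j. j < length bs \<Longrightarrow> bs ! j \<sim> comb bs' (\<lambda>i. Q i j)"
    using quot_basis_expand[OF bs' sub(1)] by blast
  define n n' where "n = length bs" and "n' = length bs'"
  define p q where "p = mat n n' (\<lambda>(i, j). \<psi> (P i j))" and "q = mat n' n (\<lambda>(i, j). \<psi> (Q i j))"
  have pq: "p * q = 1\<^sub>m n" and qp: "q * p = 1\<^sub>m n'"
    unfolding p_def q_def n_def n'_def
    using change_of_basis_inverse[OF bs P Q] change_of_basis_inverse[OF bs' Q P] by auto
  have c: "p \<in> carrier_mat n n'" "q \<in> carrier_mat n' n" by (auto simp: p_def q_def)
  \<comment> \<open>Only now is the change of basis a square matrix, so that it has a determinant to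
    cancel.\<close>
  have nn: "n' = n"
    using mult_eq_one_mat_imp_le[OF c pq] mult_eq_one_mat_imp_le[OF c(2,1) qp] by simp
  define x x' where "x = map_mat \<psi> X" and "x' = map_mat \<psi> X'"
  have cx: "x \<in> carrier_mat n n" "x' \<in> carrier_mat n' n'"
    using X X' by (auto simp: x_def x'_def n_def n'_def)
  have XS: "X $$ (i, j) \<in> S" if "i < n" "j < n" for i j
    using X that unfolding elements_mat_def n_def by force
  have XS': "X' $$ (i, j) \<in> S" if "i < n'" "j < n'" for i j
    using X' that unfolding elements_mat_def n'_def by force
  \<comment> \<open>Column j on either side holds the coordinates in \<open>bs\<close> of
    \<open>f (bs' ! j)\<close>: either \<open>f\<close> is applied in \<open>bs'\<close> and the
    result rewritten, or the vector is rewritten first.\<close>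
  have "p * x' = x * p"
  proof (rule eq_matI)
    fix i j assume "i < dim_row (x * p)" "j < dim_col (x * p)"
    then have ij: "i < n" "j < n'" using cx c by auto
    then have ij': "i < length bs" "j < length bs'" by (auto simp: n_def n'_def)
    have "comb bs (\<lambda>i. \<Sum>k<length bs'. X' $$ (k, j) * P i k) \<sim> comb bs' (\<lambda>k. X' $$ (k, j))"
      using P XS' ij by (intro eqv_sym[OF comb_subst]) (auto simp: n'_def)
    also have "comb bs' (\<lambda>k. X' $$ (k, j)) \<sim> f (bs' ! j)"
      using eqv_sym[OF fX'] ij' by blast
    also have "f (bs' ! j) \<sim> f (comb bs (\<lambda>i. P i j))"
      using P sub ij' by (intro f_eqv comb_mem) auto
    also have "f (comb bs (\<lambda>i. P i j)) \<sim> comb bs (\<lambda>i. \<Sum>k<length bs. P k j * X $$ (i, k))"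
      using P fX sub ij' by (intro f_comb) auto
    finally have "\<psi> (\<Sum>k<length bs'. X' $$ (k, j) * P i k) = \<psi> (\<Sum>k<length bs. P k j * X $$ (i, k))"
      using P XS XS' ij'
      by (intro quot_basis_unique[OF bs]) (auto intro!: sum_mem mult_mem simp: n_def n'_def)
    also have "\<psi> (\<Sum>k<length bs'. X' $$ (k, j) * P i k) = (\<Sum>k<n'. \<psi> (P i k) * \<psi> (X' $$ (k, j)))"
      using P XS' ij ij'
      by (subst hom_sum) (auto intro!: mult_mem sum.cong simp: hom_mult mult.commute n_def n'_def)
    also have "\<psi> (\<Sum>k<length bs. P k j * X $$ (i, k)) = (\<Sum>k<n. \<psi> (X $$ (i, k)) * \<psi> (P k j))"
      using P XS ij ij'
      by (subst hom_sum) (auto intro!: mult_mem sum.cong simp: hom_mult mult.commute n_def n'_def)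
    finally show "(p * x') $$ (i, j) = (x * p) $$ (i, j)"
      using ij cx c X X' unfolding x_def x'_def p_def n_def n'_def
      by (simp add: scalar_prod_def atLeast0LessThan)
  qed (use c cx in auto)
  then have "det p * det x' = det x * det p"
    using det_mult[of p n x'] det_mult[of x n p] c cx nn by metis
  moreover have "det p * det q = 1" using det_mult[of p n q] c nn pq by simp
  then have "det p \<noteq> 0" by auto
  ultimately have "det x = det x'" by simp
  moreover have "\<psi> \<delta> = det x" 
    using dX hom_det[OF X] det_mem[OF X] by (simp add: J hom_diff x_def)
  moreover have "\<psi> \<delta>' = det x'" 
    using dX' hom_det[OF X'] det_mem[OF X'] by (simp add: J hom_diff x'_def)
  ultimately show ?thesis by simp
qed

end


section \<open>Euler products of power series\<close>

lemma fps_one_mod_mult: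
  fixes f g :: "'a::field fps"
  assumes "fps_X ^ n dvd f - 1" "fps_X ^ n dvd g - 1"
  shows "fps_X ^ n dvd f * g - 1"
proof -
  have "f * g - 1 = (f - 1) * g + (g - 1)" by (simp add: algebra_simps)
  then show ?thesis using assms by (metis dvd_add dvd_mult2)
qed

lemma fps_one_mod_inverse:
  fixes f :: "'a::field fps"
  assumes "fps_X ^ n dvd f - 1" "fps_nth f 0 \<noteq> 0"
  shows "fps_X ^ n dvd inverse f - 1"
proof -
  have "inverse f - 1 = (f - 1) * (- inverse f)"
    using inverse_mult_eq_1[OF assms(2)] by (simp add: algebra_simps)
  then show ?thesis using assms by (metis dvd_mult2)
qed

lemma fps_one_mod_prod:
  fixes f :: "'p \<Rightarrow> 'a::field fps"
  shows "(\<And>p. p \<in> X \<Longrightarrow> fps_X ^ n dvd f p - 1) \<Longrightarrow> fps_X ^ n dvd prod f X - 1"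
  by (induction X rule: infinite_finite_induct) (auto intro: fps_one_mod_mult)

lemma fps_nth_mult_one_mod:
  fixes f g :: "'a::field fps"
  assumes "fps_X ^ Suc n dvd g - 1"
  shows "fps_nth (f * g) n = fps_nth f n"
proof -
  obtain h where "g - 1 = fps_X ^ Suc n * h" using assms by (elim dvdE)
  then have "f * g = f + fps_X ^ Suc n * (h * f)"
    by (simp add: algebra_simps eq_diff_eq)
  then show ?thesis by (simp add: fps_X_power_mult_nth del: power_Suc)
qed

text \<open>The factor at p is 1 modulo X^(wt p). Hence factors of weight above n do not affect
  coefficient n, and only finitely many others remain.\<close>

lemma euler_product_tendsto:
  fixes P :: "'p \<Rightarrow> 'a::field fps"
  assumes fin: "\<And>n. finite {p \<in> S. wt p \<le> n}"
    and one: "\<And>p. p \<in> S \<Longrightarrow> fps_nth (P p) 0 = 1"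
    and gap: "\<And>p n. p \<in> S \<Longrightarrow> 0 < n \<Longrightarrow> n < wt p \<Longrightarrow> fps_nth (P p) n = 0"
  shows "\<exists>L. ((\<lambda>X. \<Prod>p\<in>X. inverse (P p)) \<longlongrightarrow> L) (finite_subsets_at_top S)"
proof -
  define U where "U n = {p \<in> S. wt p \<le> n}" for n
  \<comment> \<open>The limit is read off diagonally: each coefficient n has its own finite product,
    over the indices of weight at most n.\<close>
  define L where "L = Abs_fps (\<lambda>n. fps_nth (\<Prod>p\<in>U n. inverse (P p)) n)"
  have P1: "fps_X ^ n dvd P p - 1" if "p \<in> S" "n \<le> wt p" for p n
  proof -
    have "fps_nth (P p - 1) i = 0" if "i < n" for i
      using one[OF \<open>p \<in> S\<close>] gap[OF \<open>p \<in> S\<close>, of i] that \<open>n \<le> wt p\<close> by (cases "i = 0") auto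
    then have "P p - 1 = fps_X ^ n * fps_shift n (P p - 1)"
      by (intro fps_ext) (auto simp: fps_X_power_mult_nth)
    then show ?thesis by (metis dvd_triv_left)
  qed
  have "eventually (\<lambda>X. fps_nth (\<Prod>p\<in>X. inverse (P p)) n = fps_nth L n) (finite_subsets_at_top S)" for n
    unfolding eventually_finite_subsets_at_top
  proof (intro exI[of _ "U n"] conjI allI impI)
    fix X assume X: "finite X \<and> U n \<subseteq> X \<and> X \<subseteq> S"
    then have "(\<Prod>p\<in>X. inverse (P p)) = (\<Prod>p\<in>U n. inverse (P p)) * (\<Prod>p\<in>X - U n. inverse (P p))"
      by (metis mult.commute prod.subset_diff)
    moreover have "fps_X ^ Suc n dvd (\<Prod>p\<in>X - U n. inverse (P p)) - 1"
      using X one by (intro fps_one_mod_prod fps_one_mod_inverse P1) (auto simp: U_def)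
    ultimately show "fps_nth (\<Prod>p\<in>X. inverse (P p)) n = fps_nth L n"
      by (simp add: fps_nth_mult_one_mod L_def)
  qed (use fin in \<open>auto simp: U_def\<close>)
  then show ?thesis unfolding tendsto_fps_iff by blast
qed

text \<open>Every sufficiently large finite subset of \<open>S\<close> contains p, so the limit over
  \<open>S\<close> is \<open>inverse (P p)\<close> times the limit over
  \<open>S - {p}\<close>.\<close>

lemma euler_product_remove:
  fixes P :: "'p \<Rightarrow> 'a::field fps"
  assumes conv: "euler_convergent (S - {p}) P" and p: "p \<in> S" and unit: "fps_nth (P p) 0 \<noteq> 0"
  shows "P p * euler_product S P = euler_product (S - {p}) P"
proof -
  obtain L where L: "((\<lambda>X. \<Prod>p\<in>X. inverse (P p)) \<longlongrightarrow> L) (finite_subsets_at_top (S - {p}))"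
    using conv by (auto simp: euler_convergent_def)
  have "((\<lambda>X. \<Prod>p\<in>X. inverse (P p)) \<longlongrightarrow> inverse (P p) * L) (finite_subsets_at_top S)"
    unfolding tendsto_fps_iff
  proof
    fix n
    \<comment> \<open>All coefficients up to n must be stable at once, because the Cauchy product
      with \<open>inverse (P p)\<close> mixes them.\<close>
    have "eventually (\<lambda>X. \<forall>k\<in>{..n}. fps_nth (\<Prod>p\<in>X. inverse (P p)) k = fps_nth L k)
        (finite_subsets_at_top (S - {p}))"
      using L unfolding tendsto_fps_iff by (intro eventually_ball_finite) auto
    then have "\<exists>X0. finite X0 \<and> X0 \<subseteq> S - {p} \<and> (\<forall>X. finite X \<and> X0 \<subseteq> X \<and> X \<subseteq> S - {p} \<longrightarrow>
        (\<forall>k\<in>{..n}. fps_nth (\<Prod>p\<in>X. inverse (P p)) k = fps_nth L k))"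
      unfolding eventually_finite_subsets_at_top .
    then obtain X0 where X0: "finite X0" "X0 \<subseteq> S - {p}" and
      eq: "\<forall>X. finite X \<and> X0 \<subseteq> X \<and> X \<subseteq> S - {p} \<longrightarrow>
        (\<forall>k\<in>{..n}. fps_nth (\<Prod>p\<in>X. inverse (P p)) k = fps_nth L k)"
      by (elim exE conjE)
    show "eventually (\<lambda>X. fps_nth (\<Prod>p\<in>X. inverse (P p)) n = fps_nth (inverse (P p) * L) n)
        (finite_subsets_at_top S)"
      unfolding eventually_finite_subsets_at_top
    proof (intro exI[of _ "insert p X0"] conjI allI impI)
      fix X assume X: "finite X \<and> insert p X0 \<subseteq> X \<and> X \<subseteq> S"
      then have "(\<Prod>p\<in>X. inverse (P p)) = inverse (P p) * (\<Prod>p\<in>X - {p}. inverse (P p))"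
        by (intro prod.remove) auto
      moreover have "\<forall>k\<in>{..n}. fps_nth (\<Prod>p\<in>X - {p}. inverse (P p)) k = fps_nth L k"
        using X X0 by (intro eq[THEN spec, THEN mp]) auto
      ultimately show "fps_nth (\<Prod>p\<in>X. inverse (P p)) n = fps_nth (inverse (P p) * L) n"
        by (simp add: fps_mult_nth)
    qed (use X0 p in auto)
  qed
  then have "euler_product S P = inverse (P p) * L"
    unfolding euler_product_def by (intro tendsto_Lim) auto
  moreover have "euler_product (S - {p}) P = L"
    unfolding euler_product_def using L by (intro tendsto_Lim) auto
  ultimately show ?thesis
    using inverse_mult_eq_1'[OF unit] by (simp flip: mult.assoc)
qed


section \<open>Conjugates of a root of a place\<close>

text \<open>Multiplication by a nonzero x permutes the nonzero elements, so comparing the product of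
  all of them before and after gives the relation.\<close>

lemma power_card_eq_self:
  fixes x :: "'f::{field,finite}"
  shows "x ^ CARD('f) = x"
proof (cases "x = 0")
  case False
  have "(\<Prod>y\<in>- {0}. x * y) = (\<Prod>y\<in>- {0}. y)"
    using False by (intro prod.reindex_bij_witness[of _ "\<lambda>y. y / x" "\<lambda>y. x * y"]) auto
  then have "x ^ card (- {0 :: 'f}) * (\<Prod>y\<in>- {0}. y) = (\<Prod>y\<in>- {0}. y)"
    by (simp add: prod.distrib)
  then have "x ^ card (- {0 :: 'f}) = 1" by simp
  moreover have "CARD('f) = Suc (card (- {0 :: 'f}))"
    by (metis Compl_eq_Diff_UNIV UNIV_I card.remove finite)
  ultimately show ?thesis by simp
qed simp

text \<open>This avoids writing \<open>CARD('f)\<close> as a power of the characteristic. The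
  polynomial (x + 1)^Q - x^Q - 1 with Q = \<open>CARD('f)\<close> has degree below Q, yet all Q
  elements of the field are roots; so its coefficients vanish.\<close>

lemma card_choose_eq_0:
  assumes "0 < k" "k < CARD('f)"
  shows "of_nat (CARD('f) choose k) = (0 :: 'f::{field,finite})"
proof -
  let ?Q = "CARD('f)"
  define p :: "'f poly" where "p = (\<Sum>k\<in>{0<..<?Q}. monom (of_nat (?Q choose k)) k)"
  have "degree p \<le> ?Q - 1"
    unfolding p_def by (intro degree_sum_le) (auto intro: degree_monom_le[THEN le_trans])
  have "poly p x = 0" for x
  proof -
    have "{..?Q} = insert 0 (insert ?Q {0<..<?Q})" by auto
    then have "(x + 1) ^ ?Q = 1 + x ^ ?Q + poly p x"
      using binomial_ring[of x 1 ?Q] by (simp add: p_def poly_sum poly_monom)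
    then show ?thesis by (simp add: power_card_eq_self)
  qed
  then have "{x. poly p x = 0} = UNIV" by auto
  then have "?Q \<le> degree p" if "p \<noteq> 0"
    using card_poly_roots_bound[OF that] by simp
  then have "p = 0"
    using \<open>degree p \<le> ?Q - 1\<close> assms by linarith
  then have "coeff p k = 0" by simp
  then show ?thesis using assms by (simp add: p_def coeff_sum)
qed

text \<open>The vanishing of the binomial coefficients is a divisibility of integers by the
  characteristic, so it passes to every ring of that characteristic.\<close>

lemma frob_add:
  fixes x y :: "'r::comm_ring_1"
  assumes "CHAR('r) = CHAR('f::{field,finite})"
  shows "(x + y) ^ CARD('f) = x ^ CARD('f) + y ^ CARD('f)"
proof -
  let ?Q = "CARD('f)"
  have "of_nat (?Q choose k) = (0 :: 'r)" if "k \<in> {0<..<?Q}" for k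
    using card_choose_eq_0[of k, where 'f = 'f] that assms by (simp add: of_nat_eq_0_iff_char_dvd)
  then have "(\<Sum>k\<in>{0<..<?Q}. of_nat (?Q choose k) * x ^ k * y ^ (?Q - k)) = 0"
    by (intro sum.neutral) auto
  moreover have "{..?Q} = insert 0 (insert ?Q {0<..<?Q})" by auto
  ultimately show ?thesis using binomial_ring[of x y ?Q] by simp
qed

lemma CHAR_poly_eq [simp]: "CHAR('a::comm_ring_1 poly) = CHAR('a)"
  by (rule CHAR_eqI) (auto simp: of_nat_poly of_nat_eq_0_iff_char_dvd)

lemma CHAR_fract_eq [simp]: "CHAR('a::idom fract) = CHAR('a)"
proof (rule CHAR_eqI)
  have of_nat: "of_nat n = to_fract (of_nat n :: 'a)" for n by (induction n) auto
  show "of_nat CHAR('a) = (0 :: 'a fract)" by (simp add: of_nat)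
  show "CHAR('a) dvd n" if "of_nat n = (0 :: 'a fract)" for n
    using that by (simp add: of_nat of_nat_eq_0_iff_char_dvd)
qed

text \<open>Used for the finiteness of the set of places of bounded degree.\<close>

lemma finite_degree_less: "finite {p :: 'f::{zero,finite} poly. degree p < d}"
proof -
  have "{p :: 'f poly. degree p < d} \<subseteq> Poly ` {xs. set xs \<subseteq> UNIV \<and> length xs \<le> d}"
  proof
    fix p :: "'f poly" assume "p \<in> {p. degree p < d}"
    then show "p \<in> Poly ` {xs. set xs \<subseteq> UNIV \<and> length xs \<le> d}"
      by (intro image_eqI[of _ _ "coeffs p"]) (cases "p = 0"; auto simp: length_coeffs_degree)+
  qed
  then show ?thesis by (rule finite_subset) (intro finite_imageI finite_lists_length_le finite)
qed

interpretation to_ac_hom: field_hom to_ac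
  by unfold_locales auto

interpretation to_ac_hom: inj_idom_hom to_ac
  by unfold_locales auto

interpretation to_ac_poly_hom: map_poly_inj_idom_hom to_ac ..

definition eval_at :: "'f::field alg_closure \<Rightarrow> 'f poly \<Rightarrow> 'f alg_closure" where
  "eval_at \<alpha> p = poly (map_poly to_ac p) \<alpha>"

interpretation eval_at_hom: comm_ring_hom "eval_at \<alpha>"
  by unfold_locales (auto simp: eval_at_def hom_distribs)

interpretation eval_at_hom: idom_hom "eval_at \<alpha>" ..

lemma eval_at_pCons: "eval_at \<alpha> (pCons a p) = to_ac a + \<alpha> * eval_at \<alpha> p"
  by (simp add: eval_at_def to_ac_hom.map_poly_pCons_hom)

text \<open>The coefficients lie in F and are fixed by Frobenius, so only the point moves.\<close>

lemma eval_at_power_card: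
  fixes p :: "'f::{field,finite} poly"
  shows "eval_at \<alpha> p ^ (CARD('f) ^ k) = eval_at (\<alpha> ^ (CARD('f) ^ k)) p"
proof (induction k)
  case (Suc k)
  have step: "eval_at \<beta> p ^ CARD('f) = eval_at (\<beta> ^ CARD('f)) p" for \<beta>
    by (induction p)
       (simp_all add: eval_at_pCons frob_add power_mult_distrib power_card_eq_self
         flip: to_ac_power)
  have "eval_at \<alpha> p ^ (CARD('f) ^ Suc k) = (eval_at \<alpha> p ^ (CARD('f) ^ k)) ^ CARD('f)"
    by (simp add: mult.commute flip: power_mult)
  also have "\<dots> = eval_at (\<alpha> ^ (CARD('f) ^ Suc k)) p"
    by (simp add: Suc step mult.commute flip: power_mult)
  finally show ?case .
qed simp

lemma frob_ac_inject:
  fixes x y :: "'f::{field,finite} alg_closure"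
  assumes "x ^ (CARD('f) ^ k) = y ^ (CARD('f) ^ k)"
  shows "x = y"
  using assms
proof (induction k)
  case (Suc k)
  define a b where "a = x ^ (CARD('f) ^ k)" and "b = y ^ (CARD('f) ^ k)"
  have "a ^ CARD('f) = b ^ CARD('f)" 
    using Suc.prems by (simp add: a_def b_def mult.commute flip: power_mult)
  moreover have "a ^ CARD('f) = (a - b) ^ CARD('f) + b ^ CARD('f)"
    using frob_add[of "a - b" b, where 'f = 'f] by simp
  ultimately have "a = b" by simp
  with Suc.IH show ?case by (simp add: a_def b_def)
qed simp

lemma eval_at_const [simp]: "eval_at \<alpha> [:a:] = to_ac a"
  by (simp add: eval_at_pCons)

locale place_root =
  fixes q :: "'f::{field,finite} poly" and \<alpha> :: "'f alg_closure"
  assumes place: "q \<in> places" and root: "eval_at \<alpha> q = 0"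
begin

lemma irreducible_q: "irreducible q" and q_nz: "q \<noteq> 0"
  using place by (auto simp: places_def)

lemma degree_pos: "degree q > 0"
  using irreducible_not_unit[OF irreducible_q] q_nz by (simp add: is_unit_iff_degree)

text \<open>A nonzero polynomial of least degree vanishing at \<alpha> divides all others that
  vanish there, in particular q; irreducibility makes q an associate of it.\<close>

lemma eval_at_eq_0_iff: "eval_at \<alpha> p = 0 \<longleftrightarrow> q dvd p"
proof
  assume "q dvd p"
  then show "eval_at \<alpha> p = 0" using root by (auto simp: eval_at_hom.hom_mult)
next
  assume p: "eval_at \<alpha> p = 0"
  define m where "m = (ARG_MIN degree m. m \<noteq> 0 \<and> eval_at \<alpha> m = 0)"
  have m: "m \<noteq> 0 \<and> eval_at \<alpha> m = 0"
    unfolding m_def by (rule arg_min_natI[of _ q]) (use root q_nz in auto)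
  have min: "degree m \<le> degree r" if "r \<noteq> 0" "eval_at \<alpha> r = 0" for r
    unfolding m_def by (rule arg_min_nat_le) (use that in auto)
  have dvd: "m dvd r" if "eval_at \<alpha> r = 0" for r
  proof -
    have "eval_at \<alpha> (m * (r div m) + r mod m) = eval_at \<alpha> (r mod m)"
      using m by (simp only: eval_at_hom.hom_add eval_at_hom.hom_mult) simp
    then have "eval_at \<alpha> (r mod m) = 0" using that by simp
    then have "r mod m = 0" 
      using min[of "r mod m"] degree_mod_less[of m r] m by force
    then show ?thesis by (simp add: dvd_eq_mod_eq_0)
  qed
  obtain u where u: "q = m * u" using dvd[OF root] by (elim dvdE)
  have "\<not> m dvd 1"
  proof
    assume "m dvd 1"
    then have "degree m = 0" using m by (simp add: is_unit_iff_degree)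
    then obtain c where "m = [:c:]" by (rule degree_eq_zeroE)
    then show False using m by simp
  qed
  then have "u dvd 1" using Factorial_Ring.irreducibleD[OF irreducible_q u] by blast
  then obtain v where v: "1 = u * v" by (elim dvdE)
  have "m = q * v" using u v by (metis mult.assoc mult.right_neutral)
  then have "q dvd m" by simp
  then show "q dvd p" using dvd[OF p] by (rule dvd_trans)
qed

definition conj :: "nat \<Rightarrow> 'f alg_closure" where
  "conj k = \<alpha> ^ (CARD('f) ^ k)"

lemma conj_0 [simp]: "conj 0 = \<alpha>" by (simp add: conj_def)

lemma eval_at_conj: "eval_at (conj k) p = eval_at \<alpha> p ^ (CARD('f) ^ k)"
  by (simp add: conj_def eval_at_power_card)

lemma conj_power: "conj k ^ (CARD('f) ^ i) = conj (k + i)"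
  by (simp add: conj_def power_add flip: power_mult)

lemma conj_root: "eval_at (conj k) q = 0"
  by (simp add: eval_at_conj root)

text \<open>If the m-th Frobenius power fixes \<alpha>, it fixes every polynomial in \<alpha>. With
  Q = \<open>CARD('f)\<close>, these include Q^d distinct values, all roots of X^(Q^m) - X.\<close>

lemma conj_eq_imp_degree_le:
  assumes "0 < m" "conj m = \<alpha>"
  shows "degree q \<le> m"
proof -
  let ?Q = "CARD('f)" and ?d = "degree q"
  \<comment> \<open>Coefficient lists of length d: one for each residue modulo q.\<close>
  define L where "L = {xs :: 'f list. set xs \<subseteq> UNIV \<and> length xs = ?d}"
  define g where "g xs = eval_at \<alpha> (Poly xs)" for xs
  define h :: "'f alg_closure poly" where "h = monom 1 (?Q ^ m) - monom 1 1"
  have Q: "?Q > 1" using card_mono[of UNIV "{0, 1 :: 'f}"] by simp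
  then have Qm: "?Q ^ m > 1" using \<open>0 < m\<close> by (rule one_less_power)
  have "inj_on g L"
  proof
    fix xs ys assume xy: "xs \<in> L" "ys \<in> L" "g xs = g ys"
    then have "q dvd Poly xs - Poly ys"
      unfolding eval_at_eq_0_iff[symmetric] g_def by (simp add: eval_at_hom.hom_minus)
    moreover have "degree (Poly xs - Poly ys) < ?d"
    proof (rule degree_diff_less)
      show "degree (Poly xs) < ?d" "degree (Poly ys) < ?d"
        using xy degree_pos by (auto simp: L_def intro!: degree_lessI simp: nth_default_def)
    qed
    ultimately have "Poly xs = Poly ys"
      using divides_degree[of q "Poly xs - Poly ys"] by auto
    then have "nth_default 0 xs i = nth_default 0 ys i" for i
      by (metis coeff_Poly)
    then have "xs ! i = ys ! i" if "i < ?d" for i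
      using that xy by (metis (mono_tags) L_def mem_Collect_eq nth_default_nth)
    then show "xs = ys" using xy by (auto simp: L_def intro: nth_equalityI)
  qed
  moreover have "g ` L \<subseteq> {x. poly h x = 0}"
  proof safe
    fix xs
    have "g xs ^ (?Q ^ m) = g xs"
      unfolding g_def eval_at_power_card using assms by (simp add: conj_def)
    then show "poly h (g xs) = 0" by (simp add: h_def poly_monom)
  qed
  moreover have "degree h \<le> ?Q ^ m"
    using Qm by (simp add: h_def degree_diff_le degree_monom_eq)
  moreover have "coeff h (?Q ^ m) = 1" using Qm by (simp add: h_def)
  then have "h \<noteq> 0" by auto
  ultimately have "card L \<le> ?Q ^ m"
    using card_poly_roots_bound[of h] poly_roots_finite[of h] 
    by (metis (mono_tags, lifting) card_image card_mono le_trans)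
  then have "?Q ^ ?d \<le> ?Q ^ m" using card_lists_length_eq[of "UNIV :: 'f set" ?d] by (simp add: L_def)
  with Q show ?thesis by (rule power_le_imp_le_exp)
qed

text \<open>Undoing k Frobenius steps in \<open>conj k = conj l\<close> leaves
  \<open>conj (l - k) = \<alpha>\<close> with 0 < l - k < d, which is too small.\<close>

lemma conj_inj: "inj_on conj {..<degree q}"
proof (rule linorder_inj_onI)
  fix k l assume kl: "k < l" "k \<in> {..<degree q}" "l \<in> {..<degree q}"
  show "conj k \<noteq> conj l"
  proof
    assume "conj k = conj l"
    moreover have "conj l = conj (l - k) ^ (CARD('f) ^ k)" "conj k = \<alpha> ^ (CARD('f) ^ k)"
      using kl conj_power[of "l - k" k] by (auto simp: conj_def)
    ultimately have "conj (l - k) = \<alpha>" by (metis frob_ac_inject)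
    then show False using conj_eq_imp_degree_le[of "l - k"] kl by auto
  qed
qed auto

text \<open>Both sides are monic of degree d, so their difference has degree below d; it vanishes at
  d distinct conjugates and is therefore 0.\<close>

lemma map_poly_q: "map_poly to_ac q = (\<Prod>k<degree q. [:- conj k, 1:])"
proof -
  let ?d = "degree q"
  define g where "g = map_poly to_ac q - (\<Prod>k<?d. [:- conj k, 1:])"
  have deg: "degree (\<Prod>k<?d. [:- conj k, 1:]) = ?d"
    by (subst degree_prod_sum_eq) auto
  have "lead_coeff (\<Prod>k<?d. [:- conj k, 1:]) = 1"
    by (simp add: lead_coeff_prod)
  then have "coeff g ?d = 0" using deg place by (simp add: g_def places_def)
  moreover have "degree g \<le> ?d" unfolding g_def using deg by (intro degree_diff_le) auto
  ultimately have deg_g: "degree g < ?d" if "g \<noteq> 0" 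
    using that by (metis le_neq_implies_less leading_coeff_0_iff)
  have "poly g (conj k) = 0" if "k < ?d" for k
    using conj_root[of k] that by (auto simp: g_def eval_at_def poly_prod)
  then have sub: "conj ` {..<?d} \<subseteq> {x. poly g x = 0}" by auto
  have "card (conj ` {..<?d}) \<le> degree g" if "g \<noteq> 0"
    using card_mono[OF poly_roots_finite[OF that] sub] card_poly_roots_bound[OF that] by simp
  moreover have "card (conj ` {..<?d}) = ?d" using card_image[OF conj_inj] by simp
  ultimately have "g = 0" using deg_g by fastforce
  then show ?thesis by (simp add: g_def)
qed

text \<open>The next conjugate is again a root, hence equals some \<open>conj k\<close> with k < d.
  Undoing k Frobenius steps leaves \<open>conj (d - k) = \<alpha>\<close>, which forces k = 0 by the
  degree bound.\<close>

lemma conj_degree: "conj (degree q) = \<alpha>"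
proof -
  have "poly (map_poly to_ac q) (conj (degree q)) = 0"
    using conj_root by (simp add: eval_at_def)
  then obtain k where k: "k < degree q" "conj (degree q) = conj k"
    by (auto simp: map_poly_q poly_prod)
  have "conj (degree q) = conj (degree q - k) ^ (CARD('f) ^ k)" "conj k = \<alpha> ^ (CARD('f) ^ k)"
    using k conj_power[of "degree q - k" k] by (auto simp: conj_def)
  then have *: "conj (degree q - k) = \<alpha>" using k by (metis frob_ac_inject)
  then have "degree q \<le> degree q - k" using k by (intro conj_eq_imp_degree_le) auto
  then have "k = 0" using degree_pos by simp
  with * show ?thesis by simp
qed

lemma conj_mod: "conj (k mod degree q) = conj k"
proof -
  have "conj (j + degree q * n) = conj j" for j n
  proof (induction n)
    case (Suc n)
    have "conj (j + degree q * Suc n) = conj (degree q) ^ (CARD('f) ^ (j + degree q * n))"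
      by (simp add: conj_power add_ac)
    then show ?case using Suc by (simp add: conj_degree) (simp add: conj_def)
  qed simp
  from this[of "k mod degree q" "k div degree q"] show ?thesis by simp
qed

end

lemma place_root_exists:
  assumes "q \<in> places"
  shows "\<exists>\<alpha>. place_root q \<alpha>"
proof -
  have "degree (map_poly to_ac q) > 0"
  proof -
    have "irreducible q" "q \<noteq> 0" using assms by (auto simp: places_def)
    with irreducible_not_unit[of q] show ?thesis by (simp add: is_unit_iff_degree)
  qed
  then obtain \<alpha> where "poly (map_poly to_ac q) \<alpha> = 0"
    using alg_closed_imp_poly_has_root by metis
  then have "place_root q \<alpha>" using assms by unfold_locales (simp_all add: eval_at_def)
  then show ?thesis ..
qed


section \<open>Reduction of the localized coefficient ring\<close>

lemma fract_map_Fract: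
  assumes "inj_idom_hom h" "b \<noteq> 0"
  shows "fract_map h (Fract a b) = Fract (h a) (h b)"
proof -
  interpret inj_idom_hom h by fact
  show ?thesis unfolding fract_map_def
  proof (rule the_equality)
    fix y assume "\<exists>a' b'. b' \<noteq> 0 \<and> Fract a b = Fract a' b' \<and> y = Fract (h a') (h b')"
    then obtain a' b' where *: "b' \<noteq> 0" "a * b' = a' * b" "y = Fract (h a') (h b')"
      using \<open>b \<noteq> 0\<close> by (auto simp: eq_fract)
    have "h a * h b' = h a' * h b" using *(2) by (simp flip: hom_mult)
    then show "y = Fract (h a) (h b)" using * \<open>b \<noteq> 0\<close> by (simp add: eq_fract)
  qed (use \<open>b \<noteq> 0\<close> in blast)
qed

lemma fract_map_to_fract:
  assumes "inj_idom_hom h"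
  shows "fract_map h (to_fract a) = to_fract (h a)"
proof -
  interpret inj_idom_hom h by fact
  show ?thesis using fract_map_Fract[OF assms, of 1 a] by (simp add: to_fract_def)
qed

lemma field_hom_fract_map:
  assumes "inj_idom_hom h"
  shows "field_hom (fract_map h)"
proof -
  interpret inj_idom_hom h by fact
  note F = fract_map_Fract[OF assms]
  show ?thesis
  proof unfold_locales
    show "fract_map h 0 = 0" "fract_map h 1 = 1"
      using fract_map_to_fract[OF assms, of 0] fract_map_to_fract[OF assms, of 1] by simp_all
    fix x y :: "'a fract"
    obtain a b c d where "x = Fract a b" "b \<noteq> 0" "y = Fract c d" "d \<noteq> 0"
      by (metis Fract_cases)
    then show "fract_map h (x + y) = fract_map h x + fract_map h y"
      "fract_map h (x * y) = fract_map h x * fract_map h y"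
      by (simp_all add: F hom_mult hom_add)
  qed
qed

interpretation const_poly_hom: inj_idom_hom "\<lambda>c :: 'a::idom. [:c:]"
  by unfold_locales (auto simp: one_pCons)

interpretation const_poly_poly_hom: map_poly_inj_idom_hom "\<lambda>c :: 'a::idom. [:c:]" ..

interpretation to_fract_poly_hom: map_poly_inj_idom_hom to_fract ..

interpretation emb_AR_hom: inj_idom_hom emb_AR
  by unfold_locales (auto simp: emb_AR_def hom_distribs)

interpretation A_in_AR_hom: inj_idom_hom A_in_AR
  by unfold_locales (auto simp: A_in_AR_def hom_distribs)

lemma map_poly_to_fract_const:
  "map_poly (\<lambda>c. to_fract [:c:]) a = map_poly to_fract (map_poly (\<lambda>c. [:c:]) a)"
  by (intro poly_eqI) (simp add: coeff_map_poly)

lemma inj_idom_hom_to_fract_const: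
  "inj_idom_hom (map_poly (\<lambda>c :: 'f::field. to_fract [:c:]))"
  unfolding map_poly_to_fract_const by unfold_locales (auto simp: hom_distribs)

interpretation emb_Ft_hom: field_hom emb_Ft
  unfolding emb_Ft_def by (rule field_hom_fract_map[OF inj_idom_hom_to_fract_const])

lemma emb_Ft_to_fract: "emb_Ft (to_fract a) = emb_AR (A_in_AR a)"
  unfolding emb_Ft_def fract_map_to_fract[OF inj_idom_hom_to_fract_const]
  by (simp add: emb_AR_def A_in_AR_def map_poly_to_fract_const)

interpretation frob_K_hom: inj_idom_hom "\<lambda>x :: 'f::{field,finite} poly fract. x ^ CARD('f)"
  by unfold_locales (auto simp: frob_add power_mult_distrib power_0_left)

interpretation frob_R_hom: inj_idom_hom "\<lambda>x :: 'f::{field,finite} poly. x ^ CARD('f)"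
  by unfold_locales (auto simp: frob_add power_mult_distrib power_0_left)

interpretation frob_K_poly_hom: map_poly_inj_idom_hom "\<lambda>x :: 'f::{field,finite} poly fract. x ^ CARD('f)" ..

interpretation frob_R_poly_hom: map_poly_inj_idom_hom "\<lambda>x :: 'f::{field,finite} poly. x ^ CARD('f)" ..

interpretation frob_R_poly_poly_hom: map_poly_inj_idom_hom
  "map_poly (\<lambda>x :: 'f::{field,finite} poly. x ^ CARD('f))" ..

interpretation frob_Kt_hom: field_hom frob_Kt
  unfolding frob_Kt_def by (rule field_hom_fract_map) unfold_locales

definition frob_AR :: "'f::{field,finite} poly poly \<Rightarrow> 'f poly poly" where
  "frob_AR = map_poly (\<lambda>c. c ^ CARD('f))"

interpretation frob_AR_hom: inj_idom_hom frob_AR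
  unfolding frob_AR_def by unfold_locales

lemma frob_Kt_to_fract: "frob_Kt (to_fract p) = to_fract (map_poly (\<lambda>c. c ^ CARD('f)) p)"
  for p :: "'f::{field,finite} poly fract poly"
  unfolding frob_Kt_def by (rule fract_map_to_fract) unfold_locales

lemma frob_Kt_emb_AR: "frob_Kt (emb_AR s) = emb_AR (frob_AR s)"
proof -
  have "map_poly (\<lambda>c. c ^ CARD('a)) (map_poly to_fract s) = map_poly to_fract (frob_AR s)"
    by (intro poly_eqI) (simp add: frob_AR_def coeff_map_poly power_0_left to_fract_hom.hom_power)
  then show ?thesis by (simp add: emb_AR_def frob_Kt_to_fract)
qed

lemma subring_hom_polys_over:
  assumes "subring_hom S \<psi>"
  shows "subring_hom (polys_over S) (map_poly \<psi>)"
proof -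
  interpret subring_hom S \<psi> by fact
  have c: "coeff (map_poly \<psi> p) n = \<psi> (coeff p n)" for p n
    by (simp add: coeff_map_poly hom_zero)
  show ?thesis
  proof
    show "1 \<in> polys_over S" by (auto simp: polys_over_def coeff_1 one_mem zero_mem)
    show "map_poly \<psi> 1 = 1" by (simp add: hom_one)
  next
    fix a b assume a: "a \<in> polys_over S" 
    then show "- a \<in> polys_over S" by (auto simp: polys_over_def uminus_mem)
    assume b: "b \<in> polys_over S"
    show "a + b \<in> polys_over S" "map_poly \<psi> (a + b) = map_poly \<psi> a + map_poly \<psi> b"
      using a b by (auto simp: polys_over_def add_mem hom_add c intro!: poly_eqI)
    show "a * b \<in> polys_over S"
      using a b by (auto simp: polys_over_def coeff_mult intro!: sum_mem mult_mem)
    show "map_poly \<psi> (a * b) = map_poly \<psi> a * map_poly \<psi> b"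
    proof (rule poly_eqI)
      fix n
      have "\<psi> (\<Sum>i\<le>n. coeff a i * coeff b (n - i)) = (\<Sum>i\<le>n. \<psi> (coeff a i * coeff b (n - i)))"
        using a b by (intro hom_sum mult_mem) (auto simp: polys_over_def)
      also have "\<dots> = (\<Sum>i\<le>n. \<psi> (coeff a i) * \<psi> (coeff b (n - i)))"
        using a b by (intro sum.cong) (auto simp: polys_over_def hom_mult)
      finally show "coeff (map_poly \<psi> (a * b)) n = coeff (map_poly \<psi> a * map_poly \<psi> b) n"
        by (simp add: c coeff_mult)
    qed
  qed
qed

type_synonym 'f Et = "'f alg_closure poly fract"

interpretation eval_at_poly_hom: map_poly_comm_ring_hom "eval_at \<alpha>" ..

section \<open>Embeddings of the reduced rings given by the conjugates\<close>

context place_root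
begin

text \<open>Its kernel consists of the multiples of q(\<theta>), so it embeds A tensor F_q into
  Fbar[t]. The indices k < d give the d embeddings of F_q.\<close>

definition ev :: "nat \<Rightarrow> 'f poly poly \<Rightarrow> 'f alg_closure poly" where
  "ev k = map_poly (eval_at (conj k))"

sublocale ev_hom: comm_ring_hom "ev k" for k
  unfolding ev_def by unfold_locales

lemma coeff_ev: "coeff (ev k s) n = eval_at (conj k) (coeff s n)"
  by (simp add: ev_def)

lemma eval_at_conj_eq_0_iff: "eval_at (conj k) p = 0 \<longleftrightarrow> q dvd p"
  by (simp add: eval_at_conj eval_at_eq_0_iff)

lemma ev_eq_0_iff: "ev k s = 0 \<longleftrightarrow> [:q:] dvd s"
  by (simp add: poly_eq_iff coeff_ev eval_at_conj_eq_0_iff const_poly_dvd_iff)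

text \<open>Frobenius on the coefficients advances the conjugate and leaves t alone: a semilinear
  map becomes a shift of the index.\<close>

lemma ev_frob: "ev k (frob_AR s) = ev (Suc k) s"
  by (intro poly_eqI)
    (simp add: coeff_ev frob_AR_def coeff_map_poly power_0_left eval_at_hom.hom_power
      eval_at_conj mult.commute flip: power_mult)

lemma ev_degree: "ev (k + degree q) = ev k"
  using conj_mod[of k] conj_mod[of "k + degree q"] by (simp add: ev_def)

lemma ev_A_in_AR: "ev k (A_in_AR a) = map_poly to_ac a"
  by (intro poly_eqI) (simp add: coeff_ev A_in_AR_def)

lemma q_A_nz: "map_poly to_ac q \<noteq> 0"
  using q_nz by simp

text \<open>All \<open>ev k\<close> have the same kernel, so the condition may be tested at any
  single index. The stability under Frobenius in \<open>frob_unit\<close> comes from passing from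
  index 1 to index 0.\<close>

lemma units_at_iff: "s \<in> units_at q \<longleftrightarrow> (\<exists>s' n. ev k s * ev k s' = map_poly to_ac q ^ n)"
proof -
  have "[:q:] dvd s * s' - A_in_AR q ^ n \<longleftrightarrow> ev k s * ev k s' = map_poly to_ac q ^ n" for s' n
    unfolding ev_eq_0_iff[of k, symmetric]
    by (simp add: ev_hom.hom_minus ev_hom.hom_mult ev_hom.hom_power ev_A_in_AR)
  then show ?thesis by (simp add: units_at_def)
qed

lemma ev_unit_nz: "s \<in> units_at q \<Longrightarrow> ev k s \<noteq> 0"
  using q_A_nz by (auto simp: units_at_iff[of _ k])

lemma unit_nz: "s \<in> units_at q \<Longrightarrow> s \<noteq> 0"
  using ev_unit_nz[of s 0] by auto

lemma one_unit: "1 \<in> units_at q"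
  unfolding units_at_iff[of _ 0] by (intro exI[of _ 1] exI[of _ 0]) simp

lemma A_unit: "A_in_AR q \<in> units_at q"
  unfolding units_at_iff[of _ 0] by (intro exI[of _ 1] exI[of _ 1]) (simp add: ev_A_in_AR)

lemma mult_unit:
  assumes "s \<in> units_at q" "s' \<in> units_at q"
  shows "s * s' \<in> units_at q"
proof -
  obtain u n u' n' where "ev 0 s * ev 0 u = map_poly to_ac q ^ n" 
    "ev 0 s' * ev 0 u' = map_poly to_ac q ^ n'"
    using assms units_at_iff[of _ 0] by blast
  then have "ev 0 (s * s') * ev 0 (u * u') = map_poly to_ac q ^ (n + n')"
    by (simp add: ev_hom.hom_mult power_add ac_simps) (metis mult.assoc mult.commute)
  then show ?thesis using units_at_iff[of _ 0] by blast
qed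

lemma power_unit: "s \<in> units_at q \<Longrightarrow> s ^ n \<in> units_at q"
  by (induction n) (auto intro: one_unit mult_unit)

lemma frob_unit:
  assumes "s \<in> units_at q"
  shows "frob_AR s \<in> units_at q"
proof -
  obtain u n where "ev 1 s * ev 1 u = map_poly to_ac q ^ n"
    using assms units_at_iff[of _ 1] by blast
  then have "ev 0 (frob_AR s) * ev 0 (frob_AR u) = map_poly to_ac q ^ n"
    by (simp add: ev_frob)
  then show ?thesis using units_at_iff[of _ 0] by blast
qed

definition t_theta :: "'f poly poly" where "t_theta = [:- [:0, 1:], 1:]"

lemma ev_t_theta: "ev k t_theta = [:- conj k, 1:]"
  by (simp add: ev_def t_theta_def eval_at_hom.map_poly_pCons_hom eval_at_hom.hom_uminus eval_at_pCons)

lemma t_theta_unit: "t_theta \<in> units_at q"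
proof -
  have "map_poly to_ac q = [:- conj 0, 1:] * (\<Prod>k\<in>{..<degree q} - {0}. [:- conj k, 1:])"
    unfolding map_poly_q using degree_pos by (intro prod.remove) auto
  \<comment> \<open>Substituting \<theta> for t in q(t) returns q, so \<theta> is a root of q(t) -
    q(\<theta>) seen as a polynomial in t.\<close>
  have "poly (A_in_AR q) [:0, 1:] = q"
    by (induction q) (auto simp: A_in_AR_def const_poly_poly_hom.map_poly_pCons_hom)
  then have "poly (A_in_AR q - [:q:]) [:0, 1:] = 0" by simp
  then have "t_theta dvd A_in_AR q - [:q:]"
    unfolding t_theta_def poly_eq_0_iff_dvd .
  then obtain u where "A_in_AR q - [:q:] = t_theta * u" by (elim dvdE)
  then have "t_theta * u - A_in_AR q ^ 1 = (A_in_AR q - [:q:]) - A_in_AR q" by simp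
  also have "\<dots> = - [:q:]" by (simp only: diff_diff_eq add.commute[of "[:q:]"] diff_add_cancel) simp
  finally have "t_theta * u - A_in_AR q ^ 1 = - [:q:]" .
  then have "[:q:] dvd t_theta * u - A_in_AR q ^ 1" by simp
  then show ?thesis unfolding units_at_def by blast
qed

text \<open>A fraction is reduced by evaluating numerator and denominator. Inverted elements stay
  nonzero in Fbar(t) by \<open>ev_unit_nz\<close>, and \<open>\<psi>_eq\<close> shows that the value
  does not depend on the presentation.\<close>

definition \<psi> :: "nat \<Rightarrow> 'f Kt \<Rightarrow> 'f Et" where
  "\<psi> k x = (THE y. \<exists>s\<in>units_at q. \<exists>a. emb_AR s * x = emb_AR a \<and>
     y = to_fract (ev k a) / to_fract (ev k s))"

lemma \<psi>_eq:
  assumes "s \<in> units_at q" "emb_AR s * x = emb_AR a"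
  shows "\<psi> k x = to_fract (ev k a) / to_fract (ev k s)"
  unfolding \<psi>_def
proof (rule the_equality)
  fix y assume "\<exists>s\<in>units_at q. \<exists>a. emb_AR s * x = emb_AR a \<and> y = to_fract (ev k a) / to_fract (ev k s)"
  then obtain s' a' where *: "s' \<in> units_at q" "emb_AR s' * x = emb_AR a'"
     "y = to_fract (ev k a') / to_fract (ev k s')" by blast
  have "emb_AR s * emb_AR a' = emb_AR s' * emb_AR a"
    unfolding *(2)[symmetric] assms(2)[symmetric] by simp
  then have "s * a' = s' * a" by (simp flip: emb_AR_hom.hom_mult)
  then have "ev k s * ev k a' = ev k s' * ev k a" by (simp flip: ev_hom.hom_mult)
  then have "to_fract (ev k s) * to_fract (ev k a') = to_fract (ev k s') * to_fract (ev k a)"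
    by (simp flip: to_fract_mult)
  then show "y = to_fract (ev k a) / to_fract (ev k s)"
    using ev_unit_nz[of s k] ev_unit_nz[of s' k] assms * by (simp add: frac_eq_eq mult.commute)
qed (use assms in blast)

lemma loc_ringI: "s \<in> units_at q \<Longrightarrow> emb_AR s * x = emb_AR a \<Longrightarrow> x \<in> loc_ring q"
  unfolding loc_ring_def by blast

lemma loc_ringE:
  assumes "x \<in> loc_ring q"
  obtains s a where "s \<in> units_at q" "emb_AR s * x = emb_AR a"
  using assms unfolding loc_ring_def by blast

lemma emb_AR_mem: "emb_AR a \<in> loc_ring q"
  using loc_ringI[OF one_unit, of "emb_AR a" a] by simp

lemma \<psi>_emb_AR: "\<psi> k (emb_AR a) = to_fract (ev k a)"
  using \<psi>_eq[OF one_unit, of "emb_AR a" a k] by simp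

lemma emb_AR_divide:
  assumes "s \<in> units_at q"
  shows "emb_AR a / emb_AR s \<in> loc_ring q"
    and "\<psi> k (emb_AR a / emb_AR s) = to_fract (ev k a) / to_fract (ev k s)"
proof -
  have "emb_AR s * (emb_AR a / emb_AR s) = emb_AR a" using unit_nz[OF assms] by simp
  with assms show "emb_AR a / emb_AR s \<in> loc_ring q"
    "\<psi> k (emb_AR a / emb_AR s) = to_fract (ev k a) / to_fract (ev k s)"
    by (auto intro: loc_ringI \<psi>_eq)
qed

lemma subring_hom_\<psi>: "subring_hom (loc_ring q) (\<psi> k)"
proof
  show "1 \<in> loc_ring q" "\<psi> k 1 = 1"
    using emb_AR_mem[of 1] \<psi>_emb_AR[of k 1] by simp_all
next
  fix x assume x: "x \<in> loc_ring q"
  then obtain s a where s: "s \<in> units_at q" "emb_AR s * x = emb_AR a" by (rule loc_ringE)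
  have "emb_AR s * (- x) = emb_AR (- a)" using s by (simp add: emb_AR_hom.hom_uminus)
  with s show "- x \<in> loc_ring q" by (auto intro: loc_ringI)
  fix y assume y: "y \<in> loc_ring q"
  then obtain u b where u: "u \<in> units_at q" "emb_AR u * y = emb_AR b" by (rule loc_ringE)
  have su: "s * u \<in> units_at q" using s u by (intro mult_unit)
  have add: "emb_AR (s * u) * (x + y) = emb_AR (a * u + b * s)"
    by (simp add: emb_AR_hom.hom_mult emb_AR_hom.hom_add algebra_simps flip: s(2) u(2))
  have mult: "emb_AR (s * u) * (x * y) = emb_AR (a * b)"
    by (simp add: emb_AR_hom.hom_mult algebra_simps flip: s(2) u(2))
  show "x + y \<in> loc_ring q" "x * y \<in> loc_ring q" using su add mult by (auto intro: loc_ringI)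
  show "\<psi> k (x + y) = \<psi> k x + \<psi> k y" "\<psi> k (x * y) = \<psi> k x * \<psi> k y"
    unfolding \<psi>_eq[OF su add] \<psi>_eq[OF su mult] \<psi>_eq[OF s] \<psi>_eq[OF u]
    using ev_unit_nz[OF s(1), of k] ev_unit_nz[OF u(1), of k]
    by (simp_all add: ev_hom.hom_add ev_hom.hom_mult field_simps)
qed

sublocale loc: subring_hom "loc_ring q" "\<psi> k" for k
  by (rule subring_hom_\<psi>)

text \<open>A fraction reduces to 0 only if its numerator is a multiple of q(\<theta>). Thus the
  localized ring modulo q(\<theta>) is a subring of a field, as \<open>quot_module\<close>
  requires.\<close>

lemma \<psi>_eq_0_iff:
  assumes "x \<in> loc_ring q"
  shows "\<psi> k x = 0 \<longleftrightarrow> x \<in> (*) (emb_AR [:q:]) ` loc_ring q"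
proof
  obtain s a where s: "s \<in> units_at q" "emb_AR s * x = emb_AR a" using assms by (rule loc_ringE)
  assume "\<psi> k x = 0"
  then have "ev k a = 0" using \<psi>_eq[OF s, of k] ev_unit_nz[OF s(1), of k] by simp
  then obtain b where b: "a = [:q:] * b" unfolding ev_eq_0_iff by (elim dvdE)
  have "x = emb_AR [:q:] * (emb_AR b / emb_AR s)"
    using s unit_nz[OF s(1)] unfolding b emb_AR_hom.hom_mult by (simp add: field_simps)
  then show "x \<in> (*) (emb_AR [:q:]) ` loc_ring q" using emb_AR_divide(1)[OF s(1)] by blast
next
  assume "x \<in> (*) (emb_AR [:q:]) ` loc_ring q"
  then obtain y where y: "x = emb_AR [:q:] * y" "y \<in> loc_ring q" by blast
  have "ev k [:q:] = 0" by (simp add: ev_eq_0_iff)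
  then show "\<psi> k x = 0" using y by (simp add: loc.hom_mult emb_AR_mem \<psi>_emb_AR)
qed

lemma frob_Kt_loc:
  assumes "x \<in> loc_ring q"
  shows "frob_Kt x \<in> loc_ring q" and "\<psi> k (frob_Kt x) = \<psi> (Suc k) x"
proof -
  obtain s a where s: "s \<in> units_at q" "emb_AR s * x = emb_AR a" using assms by (rule loc_ringE)
  have "emb_AR (frob_AR s) * frob_Kt x = emb_AR (frob_AR a)"
    using arg_cong[OF s(2), of frob_Kt] by (simp add: frob_Kt_hom.hom_mult frob_Kt_emb_AR)
  then show "frob_Kt x \<in> loc_ring q" "\<psi> k (frob_Kt x) = \<psi> (Suc k) x"
    using frob_unit[OF s(1)] \<psi>_eq[OF s, of "Suc k"] 
    by (auto intro: loc_ringI simp: \<psi>_eq ev_frob)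
qed

lemma frob_Kt_funpow_loc:
  assumes "x \<in> loc_ring q"
  shows "(frob_Kt ^^ n) x \<in> loc_ring q \<and> \<psi> k ((frob_Kt ^^ n) x) = \<psi> (k + n) x"
  using assms by (induction n arbitrary: k) (auto simp: frob_Kt_loc)

text \<open>The d-fold Frobenius is therefore invisible after reduction: this is why \<tau>^d
  becomes linear there.\<close>

lemma \<psi>_degree: "\<psi> (k + degree q) = \<psi> k"
  by (intro ext) (simp add: \<psi>_def ev_degree)

definition A_to_E :: "'f poly \<Rightarrow> 'f Et" where
  "A_to_E a = to_fract (map_poly to_ac a)"

lemma emb_Ft_loc:
  assumes "to_fract (q ^ n) * x = to_fract a"
  shows "emb_Ft x \<in> loc_ring q" and "\<psi> k (emb_Ft x) = A_to_E a / A_to_E (q ^ n)"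
proof -
  have u: "A_in_AR (q ^ n) \<in> units_at q" by (simp add: A_in_AR_hom.hom_power power_unit A_unit)
  have eq: "emb_AR (A_in_AR (q ^ n)) * emb_Ft x = emb_AR (A_in_AR a)"
    unfolding emb_Ft_to_fract[symmetric] using assms by (metis emb_Ft_hom.hom_mult)
  show "emb_Ft x \<in> loc_ring q" "\<psi> k (emb_Ft x) = A_to_E a / A_to_E (q ^ n)"
    using loc_ringI[OF u eq] \<psi>_eq[OF u eq, of k] by (simp_all add: ev_A_in_AR A_to_E_def)
qed

end


section \<open>The dual motive\<close>

text \<open>The value at n is forced by the equation with index n - r, whose leading coefficient can
  be inverted. The case r = 0 is sent to the first branch so that the recursion terminates.\<close>

function recurrence_solution ::
  "nat \<Rightarrow> (nat \<Rightarrow> nat \<Rightarrow> 'a::field) \<Rightarrow> 'a \<Rightarrow> (nat \<Rightarrow> 'a) \<Rightarrow> nat \<Rightarrow> 'a" where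
  "recurrence_solution r c t w n = (if n < r \<or> r = 0 then w n else
     (t * recurrence_solution r c t w (n - r)
       - (\<Sum>j\<in>{..<r}. c (n - r) j * recurrence_solution r c t w (n - r + j))) / c (n - r) r)"
  by auto
termination by (relation "measure (\<lambda>(_, _, _, _, n). n)") auto

declare recurrence_solution.simps [simp del]

text \<open>Together with \<open>recurrence_unique\<close> this says that the values at \<tau>^0,
  ..., \<tau>^(r-1) of a homomorphism from the motive to K(t) can be prescribed freely and determine
  it. It stands in for the fact that these powers form a basis of the motive.\<close>

lemma recurrence_exists:
  fixes c :: "nat \<Rightarrow> nat \<Rightarrow> 'a::field"
  assumes "r > 0" "\<And>i. c i r \<noteq> 0"
  shows "\<exists>s. (\<forall>j<r. s j = w j) \<and> (\<forall>i. t * s i = (\<Sum>j\<le>r. c i j * s (i + j)))"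
proof (intro exI conjI allI impI)
  let ?s = "recurrence_solution r c t w"
  show "?s j = w j" if "j < r" for j
    using that by (simp add: recurrence_solution.simps)
  show "t * ?s i = (\<Sum>j\<le>r. c i j * ?s (i + j))" for i
  proof -
    have "?s (i + r) = (t * ?s i - (\<Sum>j<r. c i j * ?s (i + j))) / c i r"
      using assms(1) by (subst recurrence_solution.simps) simp
    then show ?thesis
      using assms(2)[of i] by (simp add: lessThan_Suc_atMost[symmetric])
  qed
qed

lemma recurrence_unique:
  fixes c :: "nat \<Rightarrow> nat \<Rightarrow> 'a::field"
  assumes c: "\<And>i. c i r \<noteq> 0" and r: "r > 0"
    and s: "\<And>i. t * s i = (\<Sum>j\<le>r. c i j * s (i + j))"
    and u: "\<And>i. t * u i = (\<Sum>j\<le>r. c i j * u (i + j))"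
    and init: "\<And>j. j < r \<Longrightarrow> s j = u j"
  shows "s n = u n"
proof (induction n rule: less_induct)
  case (less n)
  show ?case
  proof (cases "n < r")
    case False
    define i where "i = n - r"
    have n: "n = i + r" using False by (simp add: i_def)
    have "(\<Sum>j<r. c i j * s (i + j)) = (\<Sum>j<r. c i j * u (i + j))"
      using less n by (intro sum.cong) auto
    moreover have "s i = u i" using less n r by simp
    moreover have "c i r * s n = t * s i - (\<Sum>j<r. c i j * s (i + j))"
      "c i r * u n = t * u i - (\<Sum>j<r. c i j * u (i + j))"
      unfolding s[of i] u[of i] n by (simp_all add: lessThan_Suc_atMost[symmetric])
    ultimately have "c i r * s n = c i r * u n" by simp
    then show ?thesis using c[of i] by simp
  qed (use init in auto)
qed

lemma frob_K_add_power:
  fixes x y :: "'f::{field,finite} poly fract"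
  shows "(x + y) ^ (CARD('f) ^ n) = x ^ (CARD('f) ^ n) + y ^ (CARD('f) ^ n)"
proof (induction n)
  case (Suc n)
  have "(x + y) ^ (CARD('f) ^ Suc n) = ((x + y) ^ (CARD('f) ^ n)) ^ CARD('f)"
    by (simp add: mult.commute flip: power_mult)
  also have "\<dots> = x ^ (CARD('f) ^ Suc n) + y ^ (CARD('f) ^ Suc n)"
    by (simp add: Suc frob_add mult.commute flip: power_mult)
  finally show ?case .
qed simp

definition kc :: "'f::field poly fract \<Rightarrow> 'f Kt" where
  "kc c = to_fract [:c:]"

interpretation kc_hom: field_hom kc
  by unfold_locales (auto simp: kc_def simp flip: to_fract_add to_fract_mult one_pCons)

definition t_Kt :: "'f::field Kt" where
  "t_Kt = to_fract [:0, 1:]"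

lemma kc_to_fract: "kc (to_fract a) = emb_AR [:a:]"
  by (simp add: kc_def emb_AR_def to_fract_hom.map_poly_pCons_hom)

lemma frob_Kt_kc: "frob_Kt (kc c) = kc (c ^ CARD('f))" for c :: "'f::{field,finite} poly fract"
  by (simp add: kc_def frob_Kt_to_fract frob_K_hom.map_poly_pCons_hom)

lemma frob_Kt_t: "frob_Kt t_Kt = t_Kt"
  by (simp add: t_Kt_def frob_Kt_to_fract frob_K_hom.map_poly_pCons_hom)

lemma to_fract_as_sum:
  assumes "degree P \<le> N"
  shows "to_fract P = (\<Sum>k\<le>N. kc (coeff P k) * t_Kt ^ k)"
proof -
  have "to_fract P = to_fract (\<Sum>k\<le>N. monom (coeff P k) k)"
    using poly_as_sum_of_monoms'[OF assms] by simp
  also have "\<dots> = (\<Sum>k\<le>N. to_fract ([:coeff P k:] * [:0, 1:] ^ k))"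
    by (simp add: monom_altdef)
  finally show ?thesis
    by (simp only: to_fract_mult to_fract_hom.hom_power kc_def t_Kt_def)
qed

text \<open>A \<open>K\<close>-linear functional on \<open>K{\<tau>}\<close> is stored as its sequence of values on the powers of \<open>\<tau>\<close>.\<close>

definition functional :: "(nat \<Rightarrow> 'f::field Kt) \<Rightarrow> 'f poly fract poly \<Rightarrow> 'f Kt" where
  "functional s x = (\<Sum>n\<le>degree x. kc (coeff x n) * s n)"

lemma functional_bound:
  assumes "degree x \<le> N"
  shows "functional s x = (\<Sum>n\<le>N. kc (coeff x n) * s n)"
  unfolding functional_def using assms
  by (intro sum.mono_neutral_left) (auto simp: coeff_eq_0)

lemma functional_add: "functional s (x + y) = functional s x + functional s y"
proof -
  define N where "N = max (degree x) (degree y)"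
  have "degree (x + y) \<le> N" "degree x \<le> N" "degree y \<le> N"
    by (auto simp: N_def intro: degree_add_le)
  then show ?thesis
    by (simp add: functional_bound[of _ N] kc_hom.hom_add distrib_right sum.distrib)
qed

lemma functional_zero [simp]: "functional s 0 = 0"
  by (simp add: functional_def)

lemma functional_smult: "functional s (Polynomial.smult c x) = kc c * functional s x"
  using functional_bound[of "Polynomial.smult c x" "degree x" s]
  by (simp add: functional_def kc_hom.hom_mult sum_distrib_left mult.assoc degree_smult_le)

lemma functional_sum: "functional s (sum f X) = (\<Sum>i\<in>X. functional s (f i))"
  by (induction X rule: infinite_finite_induct) (auto simp: functional_add)

lemma functional_monom [simp]: "functional s (monom c n) = kc c * s n"
proof -
  have "functional s (monom c n) = (\<Sum>m\<le>n. if m = n then kc c * s n else 0)"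
    unfolding functional_bound[OF degree_monom_le] by (rule sum.cong[OF refl]) auto
  then show ?thesis by simp
qed

text \<open>The transpose of right multiplication by \<open>a\<close>.\<close>

definition shift_act :: "'f::{field,finite} poly fract poly \<Rightarrow> (nat \<Rightarrow> 'f Kt) \<Rightarrow> nat \<Rightarrow> 'f Kt" where
  "shift_act a s i = (\<Sum>j\<le>degree a. kc (coeff a j ^ (CARD('f) ^ i)) * s (i + j))"

lemma shift_act_bound:
  fixes a :: "'f::{field,finite} poly fract poly"
  assumes "degree a \<le> N"
  shows "shift_act a s i = (\<Sum>j\<le>N. kc (coeff a j ^ (CARD('f) ^ i)) * s (i + j))"
  unfolding shift_act_def using assms
  by (intro sum.mono_neutral_left) (auto simp: coeff_eq_0 power_0_left)

lemma shift_act_add: "shift_act (a + b) s i = shift_act a s i + shift_act b s i"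
proof -
  define N where "N = max (degree a) (degree b)"
  have "degree (a + b) \<le> N" "degree a \<le> N" "degree b \<le> N"
    by (auto simp: N_def intro: degree_add_le)
  then show ?thesis
    by (simp add: shift_act_bound[of _ N] frob_K_add_power kc_hom.hom_add distrib_right sum.distrib)
qed

lemma shift_act_zero [simp]: "shift_act 0 s i = 0"
  by (simp add: shift_act_def power_0_left)

lemma shift_act_sum: "shift_act (sum f X) s i = (\<Sum>k\<in>X. shift_act (f k) s i)"
  by (induction X rule: infinite_finite_induct) (auto simp: shift_act_add)

lemma shift_act_monom: "shift_act (monom c n) s i = kc (c ^ (CARD('f) ^ i)) * s (i + n)"
  for c :: "'f::{field,finite} poly fract"
proof -
  have "shift_act (monom c n) s i = (\<Sum>m\<le>n. if m = n then kc (c ^ (CARD('f) ^ i)) * s (i + n) else 0)"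
    unfolding shift_act_bound[OF degree_monom_le]
    by (rule sum.cong[OF refl]) (auto simp: power_0_left)
  then show ?thesis by simp
qed

lemma functional_skew_mult:
  "functional s (skew_mult CARD('f) x a) = functional (shift_act a s) x"
  for x :: "'f::{field,finite} poly fract poly"
  unfolding skew_mult_def functional_sum functional_monom functional_def[of _ x] shift_act_def
  by (intro sum.cong refl) (simp add: kc_hom.hom_mult sum_distrib_left mult.assoc)

text \<open>Right multiplications compose in reverse order and transposition reverses once more, so
  the order of the factors is kept.\<close>

lemma shift_act_skew_mult:
  "shift_act (skew_mult CARD('f) a b) s i = shift_act a (shift_act b s) i"
  for a :: "'f::{field,finite} poly fract poly"
  unfolding skew_mult_def shift_act_sum shift_act_monom shift_act_def[of a] shift_act_def[of b]
  by (intro sum.cong refl)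
    (simp add: kc_hom.hom_mult sum_distrib_left mult.assoc power_mult_distrib power_add add.assoc
      mult.commute[of "CARD('f) ^ i"] flip: power_mult)

lemma skew_mult_to_fract:
  "map_poly to_fract (skew_mult n a b) = skew_mult n (map_poly to_fract a) (map_poly to_fract b)"
  by (simp add: skew_mult_def to_fract_poly_hom.hom_sum to_fract_hom.hom_power)

lemma skew_mult_one_right: "skew_mult n x 1 = x"
  using poly_as_sum_of_monoms[of x] by (simp add: skew_mult_def)

lemma skew_mult_monom_left:
  "skew_mult n (monom 1 i) b = (\<Sum>j\<le>degree b. monom (coeff b j ^ (n ^ i)) (i + j))"
  for b :: "'c::comm_ring_1 poly"
proof -
  have "skew_mult n (monom 1 i) b = (\<Sum>k\<le>i. if k = i then (\<Sum>j\<le>degree b. monom (coeff b j ^ (n ^ i)) (i + j)) else 0)"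
    unfolding skew_mult_def degree_monom_eq[OF one_neq_zero] by (rule sum.cong[OF refl]) auto
  then show ?thesis by simp
qed

lemma sum_fun_apply: "(sum f X) x = (\<Sum>i\<in>X. f i x)" for f :: "'i \<Rightarrow> 'm \<Rightarrow> 'z::comm_monoid_add"
  by (induction X rule: infinite_finite_induct) auto

locale drinfeld =
  fixes \<phi> :: "'f::{field,finite} poly \<Rightarrow> 'f poly poly"
  assumes model: "drinfeld_model \<phi>"
begin

definition r where "r = drinfeld_rank \<phi>"
definition g where "g i = drinfeld_coeff \<phi> i"
definition gK where "gK i = to_fract (g i)"
definition \<phi>K where "\<phi>K k = map_poly to_fract (\<phi> (var ^ k))"

lemma r_pos: "r > 0"
  using model by (simp add: drinfeld_model_def drinfeld_rank_def r_def)

lemma g_0: "g 0 = [:0, 1:]"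
  using model by (simp add: drinfeld_model_def drinfeld_coeff_def g_def Defs.var_def)

lemma gK_r: "gK r \<noteq> 0"
proof -
  have "\<phi> var \<noteq> 0" using r_pos by (auto simp: r_def drinfeld_rank_def)
  then show ?thesis by (simp add: gK_def g_def drinfeld_coeff_def r_def drinfeld_rank_def)
qed

lemma \<phi>K_0: "\<phi>K 0 = 1"
proof -
  have "\<phi> [:1:] = [:[:1:]:]" using model unfolding drinfeld_model_def by blast
  then have "\<phi> 1 = 1" by simp
  then show ?thesis by (simp add: \<phi>K_def)
qed

lemma \<phi>K_Suc: "\<phi>K (Suc k) = skew_mult CARD('f) (\<phi>K k) (\<phi>K 1)"
proof -
  have "\<phi> (var ^ k * var) = skew_mult CARD('f) (\<phi> (var ^ k)) (\<phi> var)"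
    using model unfolding drinfeld_model_def by blast
  then show ?thesis by (simp add: \<phi>K_def skew_mult_to_fract power_Suc2 del: power_Suc)
qed

lemma degree_\<phi>K: "degree (\<phi>K 1) = r"
  by (simp add: \<phi>K_def r_def drinfeld_rank_def)

lemma coeff_\<phi>K: "coeff (\<phi>K 1) j = gK j"
  by (simp add: \<phi>K_def gK_def g_def drinfeld_coeff_def)

text \<open>The condition that the functional turns the action of t into multiplication by t: with Q
  = \<open>CARD('f)\<close>, the image of \<tau>^i under t is the sum over j of g_j^(Q^i)
  \<tau>^(i+j).\<close>

definition dual_seq :: "(nat \<Rightarrow> 'f Kt) \<Rightarrow> bool" where
  "dual_seq s \<longleftrightarrow> (\<forall>i. t_Kt * s i = (\<Sum>j\<le>r. kc (gK j ^ (CARD('f) ^ i)) * s (i + j)))"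

lemma dual_seq_iff: "dual_seq s \<longleftrightarrow> (\<forall>i. shift_act (\<phi>K 1) s i = t_Kt * s i)"
  unfolding dual_seq_def shift_act_def degree_\<phi>K coeff_\<phi>K by auto

text \<open>A dual sequence is an eigenvector, with eigenvalue t, of the transpose of right
  multiplication by the image of t; the image of t^k acts as the k-th power of this
  transpose.\<close>

lemma shift_act_\<phi>K:
  assumes "dual_seq s"
  shows "shift_act (\<phi>K k) s i = t_Kt ^ k * s i"
proof (induction k arbitrary: i)
  case 0
  then show ?case by (simp add: \<phi>K_0 shift_act_def)
next
  case (Suc k)
  have "shift_act (\<phi>K 1) s = (\<lambda>i. t_Kt * s i)"
    using assms unfolding dual_seq_iff by blast
  then have "shift_act (\<phi>K (Suc k)) s i = shift_act (\<phi>K k) (\<lambda>i. t_Kt * s i) i"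
    unfolding \<phi>K_Suc shift_act_skew_mult by simp
  also have "\<dots> = t_Kt * shift_act (\<phi>K k) s i"
    by (simp add: shift_act_def sum_distrib_left mult.left_commute)
  finally show ?case by (simp add: Suc)
qed

lemma motive_act_eq: "motive_act \<phi> P x =
    (\<Sum>k\<le>degree P. Polynomial.smult (coeff P k) (skew_mult CARD('f) x (\<phi>K k)))"
  by (simp add: motive_act_def \<phi>K_def)

lemma functional_in_dual:
  assumes "dual_seq s"
  shows "functional s \<in> motive_dual \<phi>"
proof -
  have "functional s (motive_act \<phi> P x) = to_fract P * functional s x" for P x
  proof -
    have "functional s (skew_mult CARD('f) x (\<phi>K k)) = t_Kt ^ k * functional s x" for k
      unfolding functional_skew_mult functional_def[of _ x] shift_act_\<phi>K[OF assms]
      by (simp add: sum_distrib_left mult.left_commute)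
    then show ?thesis
      unfolding motive_act_eq functional_sum functional_smult
      by (simp add: to_fract_as_sum[OF order_refl] sum_distrib_right mult.assoc)
  qed
  then show ?thesis by (simp add: motive_dual_def functional_add)
qed

lemma dual_smult:
  assumes "h \<in> motive_dual \<phi>"
  shows "h (Polynomial.smult c x) = kc c * h x"
proof -
  have "motive_act \<phi> [:c:] x = Polynomial.smult c x"
    by (simp add: motive_act_eq \<phi>K_0 skew_mult_one_right)
  moreover have "h (motive_act \<phi> [:c:] x) = to_fract [:c:] * h x"
    using assms by (simp add: motive_dual_def)
  ultimately show ?thesis by (simp add: kc_def)
qed

lemma dual_add: "h \<in> motive_dual \<phi> \<Longrightarrow> h (x + y) = h x + h y"
  by (simp add: motive_dual_def)

lemma dual_sum:
  assumes "h \<in> motive_dual \<phi>"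
  shows "h (sum f X) = (\<Sum>i\<in>X. h (f i))"
proof -
  have "h 0 = 0" using dual_add[OF assms, of 0 0] by (metis add.right_neutral add_left_cancel)
  then show ?thesis
    by (induction X rule: infinite_finite_induct) (auto simp: dual_add[OF assms])
qed

lemma dual_eq_functional:
  assumes "h \<in> motive_dual \<phi>"
  shows "h = functional (\<lambda>n. h (monom 1 n))"
proof
  fix x
  have "h x = h (\<Sum>n\<le>degree x. Polynomial.smult (coeff x n) (monom 1 n))"
    by (simp add: smult_monom poly_as_sum_of_monoms)
  also have "\<dots> = functional (\<lambda>n. h (monom 1 n)) x"
    by (simp only: dual_sum[OF assms] dual_smult[OF assms] functional_def)
  finally show "h x = functional (\<lambda>n. h (monom 1 n)) x" .
qed

text \<open>Evaluate h on the action of t on \<tau>^i. With \<open>functional_in_dual\<close>, the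
  homomorphisms to K(t) are exactly the dual sequences.\<close>

lemma dual_seq_of_dual:
  assumes "h \<in> motive_dual \<phi>"
  shows "dual_seq (\<lambda>n. h (monom 1 n))"
  unfolding dual_seq_def
proof
  fix i
  have "motive_act \<phi> [:0, 1:] (monom 1 i) = skew_mult CARD('f) (monom 1 i) (\<phi>K 1)"
    by (simp add: motive_act_eq)
  also have "\<dots> = (\<Sum>j\<le>r. Polynomial.smult (gK j ^ (CARD('f) ^ i)) (monom 1 (i + j)))"
    by (simp add: skew_mult_monom_left degree_\<phi>K coeff_\<phi>K smult_monom del: One_nat_def)
  finally have "h (\<Sum>j\<le>r. Polynomial.smult (gK j ^ (CARD('f) ^ i)) (monom 1 (i + j))) = t_Kt * h (monom 1 i)"
    using assms unfolding motive_dual_def t_Kt_def by (metis (mono_tags, lifting) mem_Collect_eq)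
  then show "t_Kt * h (monom 1 i) = (\<Sum>j\<le>r. kc (gK j ^ (CARD('f) ^ i)) * h (monom 1 (i + j)))"
    by (simp only: dual_sum[OF assms] dual_smult[OF assms])
qed

lemma kc_gK_nz: "kc (gK r ^ (CARD('f) ^ i)) \<noteq> 0"
  using gK_r by simp

lemma dual_eqI:
  assumes "h \<in> motive_dual \<phi>" "h' \<in> motive_dual \<phi>" "\<And>j. j < r \<Longrightarrow> h (monom 1 j) = h' (monom 1 j)"
  shows "h = h'"
proof -
  have "h (monom 1 n) = h' (monom 1 n)" for n
  proof (rule recurrence_unique[where r = r and t = t_Kt and c = "\<lambda>i j. kc (gK j ^ (CARD('f) ^ i))"
        and s = "\<lambda>n. h (monom 1 n)" and u = "\<lambda>n. h' (monom 1 n)"])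
    show "t_Kt * h (monom 1 i) = (\<Sum>j\<le>r. kc (gK j ^ (CARD('f) ^ i)) * h (monom 1 (i + j)))" for i
      using dual_seq_of_dual[OF assms(1)] unfolding dual_seq_def by (rule spec)
    show "t_Kt * h' (monom 1 i) = (\<Sum>j\<le>r. kc (gK j ^ (CARD('f) ^ i)) * h' (monom 1 (i + j)))" for i
      using dual_seq_of_dual[OF assms(2)] unfolding dual_seq_def by (rule spec)
    show "kc (gK r ^ (CARD('f) ^ i)) \<noteq> 0" for i by (rule kc_gK_nz)
  qed (fact r_pos, fact assms(3))
  then have "functional (\<lambda>n. h (monom 1 n)) = functional (\<lambda>n. h' (monom 1 n))" by simp
  then show ?thesis
    unfolding dual_eq_functional[OF assms(1), symmetric] dual_eq_functional[OF assms(2), symmetric] .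
qed

lemma dual_exists: "\<exists>h\<in>motive_dual \<phi>. \<forall>j<r. h (monom 1 j) = w j"
proof -
  obtain s where s: "\<forall>j<r. s j = w j" "dual_seq s"
    using recurrence_exists[of r "\<lambda>i j. kc (gK j ^ (CARD('f) ^ i))" w t_Kt, OF r_pos kc_gK_nz]
    unfolding dual_seq_def by (elim exE conjE)
  from s(1) show ?thesis by (intro bexI[OF _ functional_in_dual[OF s(2)]]) simp
qed

lemma dual_basis:
  assumes "i < r"
  shows "dual_basis \<phi> i \<in> motive_dual \<phi>"
    and "j < r \<Longrightarrow> dual_basis \<phi> i (monom 1 j) = (if i = j then 1 else 0)"
proof -
  let ?P = "\<lambda>h. h \<in> motive_dual \<phi> \<and> (\<forall>j<drinfeld_rank \<phi>. h (monom 1 j) = (if i = j then 1 else 0))"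
  obtain h where h: "h \<in> motive_dual \<phi>" "\<forall>j<r. h (monom 1 j) = (if i = j then 1 else 0)"
    using dual_exists[of "\<lambda>j. if i = j then 1 else 0"] by (elim bexE)
  have "?P (dual_basis \<phi> i)"
    unfolding dual_basis_def
  proof (rule theI[of ?P h])
    show "?P h" using h unfolding r_def by blast
    show "h' = h" if "?P h'" for h'
    proof (rule dual_eqI)
      show "h' (monom 1 j) = h (monom 1 j)" if "j < r" for j
        using h(2) \<open>?P h'\<close> that unfolding r_def by simp
    qed (use that h in blast)+
  qed
  then show "dual_basis \<phi> i \<in> motive_dual \<phi>"
    "j < r \<Longrightarrow> dual_basis \<phi> i (monom 1 j) = (if i = j then 1 else 0)"
    unfolding r_def by blast+
qed

lemma dual_zero: "0 \<in> motive_dual \<phi>"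
  by (simp add: motive_dual_def)

lemma dual_plus: "h \<in> motive_dual \<phi> \<Longrightarrow> h' \<in> motive_dual \<phi> \<Longrightarrow> h + h' \<in> motive_dual \<phi>"
  by (simp add: motive_dual_def algebra_simps)

lemma dual_fun_smul: "h \<in> motive_dual \<phi> \<Longrightarrow> fun_smul c h \<in> motive_dual \<phi>"
  by (simp add: motive_dual_def fun_smul_def algebra_simps)

lemma dual_sum_mem: "(\<And>i. i \<in> X \<Longrightarrow> f i \<in> motive_dual \<phi>) \<Longrightarrow> sum f X \<in> motive_dual \<phi>"
  by (induction X rule: infinite_finite_induct) (auto intro: dual_plus dual_zero)

lemma dual_comb:
  shows "(\<Sum>i<r. fun_smul (c i) (dual_basis \<phi> i)) \<in> motive_dual \<phi>"
    and "j < r \<Longrightarrow> (\<Sum>i<r. fun_smul (c i) (dual_basis \<phi> i)) (monom 1 j) = c j"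
proof -
  show "(\<Sum>i<r. fun_smul (c i) (dual_basis \<phi> i)) \<in> motive_dual \<phi>"
    by (intro dual_sum_mem dual_fun_smul dual_basis) auto
  assume "j < r"
  then have "(\<Sum>i<r. fun_smul (c i) (dual_basis \<phi> i)) (monom 1 j) = (\<Sum>i<r. if i = j then c j else 0)"
    unfolding sum_fun_apply by (intro sum.cong) (auto simp: fun_smul_def dual_basis)
  with \<open>j < r\<close> show "(\<Sum>i<r. fun_smul (c i) (dual_basis \<phi> i)) (monom 1 j) = c j" by simp
qed

lemma dual_expand:
  assumes "h \<in> motive_dual \<phi>"
  shows "h = (\<Sum>i<r. fun_smul (h (monom 1 i)) (dual_basis \<phi> i))"
  by (rule dual_eqI[OF assms dual_comb(1)]) (rule dual_comb(2)[symmetric])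

text \<open>The coordinates of h in the dual basis are its values at the powers of \<tau>, so
  integrality is tested on these values.\<close>

lemma anderson_model_iff:
  "h \<in> anderson_model \<phi> \<longleftrightarrow> h \<in> motive_dual \<phi> \<and> (\<forall>j<r. h (monom 1 j) \<in> range emb_AR)"
proof
  assume "h \<in> anderson_model \<phi>"
  then obtain c where "h = (\<Sum>i<r. fun_smul (emb_AR (c i)) (dual_basis \<phi> i))"
    by (auto simp: anderson_model_def r_def)
  then show "h \<in> motive_dual \<phi> \<and> (\<forall>j<r. h (monom 1 j) \<in> range emb_AR)"
    by (auto simp: dual_comb)
next
  assume h: "h \<in> motive_dual \<phi> \<and> (\<forall>j<r. h (monom 1 j) \<in> range emb_AR)"
  then have "\<forall>j. \<exists>c. j < r \<longrightarrow> h (monom 1 j) = emb_AR c" by auto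
  then obtain c where "\<And>j. j < r \<Longrightarrow> h (monom 1 j) = emb_AR (c j)" by metis
  then have "h = (\<Sum>i<r. fun_smul (emb_AR (c i)) (dual_basis \<phi> i))"
    by (subst dual_expand[OF conjunct1[OF h]]) (intro sum.cong; simp)
  then show "h \<in> anderson_model \<phi>" by (auto simp: anderson_model_def r_def)
qed

section \<open>The semilinear map on the dual motive\<close>

definition t_theta_Kt :: "'f Kt" where "t_theta_Kt = t_Kt - kc (gK 0)"

lemma t_theta_Kt_nz: "t_theta_Kt \<noteq> 0"
proof -
  have "t_theta_Kt = to_fract [:- gK 0, 1:]"
    unfolding t_theta_Kt_def t_Kt_def kc_def by (subst to_fract_diff[symmetric]) simp
  then show ?thesis by simp
qed

text \<open>The value at \<open>\<tau>\<^sup>0\<close> is forced by the recurrence at index \<open>0\<close>: this is where \<open>t - \<theta>\<close> is inverted.\<close>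

definition tau_seq :: "(nat \<Rightarrow> 'f Kt) \<Rightarrow> nat \<Rightarrow> 'f Kt" where
  "tau_seq s n = (case n of 0 \<Rightarrow> (\<Sum>j<r. kc (gK (Suc j)) * frob_Kt (s j)) / t_theta_Kt
     | Suc m \<Rightarrow> frob_Kt (s m))"

text \<open>At a positive index the recurrence is the Frobenius image of the one for s at the
  preceding index; at index 0 it holds by the choice of the first value.\<close>

lemma dual_seq_tau_seq:
  assumes "dual_seq s"
  shows "dual_seq (tau_seq s)"
  unfolding dual_seq_def
proof
  fix i
  show "t_Kt * tau_seq s i = (\<Sum>j\<le>r. kc (gK j ^ (CARD('f) ^ i)) * tau_seq s (i + j))"
  proof (cases i)
    case 0
    have "(\<Sum>j\<le>r. kc (gK j) * tau_seq s j) =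
        kc (gK 0) * tau_seq s 0 + (\<Sum>j<r. kc (gK (Suc j)) * frob_Kt (s j))"
      by (simp add: sum.atMost_shift tau_seq_def)
    also have "(\<Sum>j<r. kc (gK (Suc j)) * frob_Kt (s j)) = t_theta_Kt * tau_seq s 0"
      using t_theta_Kt_nz by (simp add: tau_seq_def)
    finally show ?thesis using 0 by (simp add: t_theta_Kt_def algebra_simps)
  next
    case (Suc n)
    have "t_Kt * frob_Kt (s n) = frob_Kt (\<Sum>j\<le>r. kc (gK j ^ (CARD('f) ^ n)) * s (n + j))"
      using assms unfolding dual_seq_def by (metis frob_Kt_hom.hom_mult frob_Kt_t)
    also have "\<dots> = (\<Sum>j\<le>r. kc (gK j ^ (CARD('f) ^ Suc n)) * frob_Kt (s (n + j)))"
      by (simp add: frob_Kt_hom.hom_sum frob_Kt_hom.hom_mult frob_Kt_kc mult.commute[of "CARD('f)"] flip: power_mult)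
    finally show ?thesis using Suc by (simp add: tau_seq_def)
  qed
qed

text \<open>For uniqueness, compatibility with \<open>motive_tau\<close> fixes the values at
  positive powers of \<tau>; the recurrence at index 0 then fixes the remaining one, as t - \<theta>
  is nonzero.\<close>

lemma dual_tau_eq:
  assumes h: "h \<in> motive_dual \<phi>"
  shows "dual_tau \<phi> h = functional (tau_seq (\<lambda>n. h (monom 1 n)))"
  unfolding dual_tau_def
proof (rule the_equality)
  let ?s = "\<lambda>n. h (monom 1 n)"
  note s = dual_seq_of_dual[OF h]
  have "functional (tau_seq ?s) (motive_tau x) = frob_Kt (h x)" for x
  proof -
    have "functional (tau_seq ?s) (motive_tau x) = (\<Sum>j\<le>degree x. kc (coeff x j ^ CARD('f)) * frob_Kt (?s j))"
      by (simp add: motive_tau_def skew_mult_monom_left functional_sum tau_seq_def)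
    also have "\<dots> = frob_Kt (functional ?s x)"
      by (simp add: functional_def frob_Kt_hom.hom_sum frob_Kt_hom.hom_mult frob_Kt_kc)
    also have "functional ?s x = h x" using dual_eq_functional[OF h] by metis
    finally show ?thesis .
  qed
  then show "functional (tau_seq ?s) \<in> motive_dual \<phi> \<and>
      (\<forall>x. functional (tau_seq ?s) (motive_tau x) = frob_Kt (h x))"
    using functional_in_dual[OF dual_seq_tau_seq[OF s]] by blast
  fix k assume k: "k \<in> motive_dual \<phi> \<and> (\<forall>x. k (motive_tau x) = frob_Kt (h x))"
  note u = dual_seq_of_dual[OF conjunct1[OF k]]
  have Suc: "k (monom 1 (Suc n)) = frob_Kt (?s n)" for n
  proof -
    have "motive_tau (monom 1 n) = (monom 1 (Suc n) :: 'f poly fract poly)"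
    proof -
      have "motive_tau (monom 1 n :: 'f poly fract poly) = (\<Sum>j\<le>n. if j = n then monom 1 (Suc n) else 0)"
        unfolding motive_tau_def skew_mult_monom_left degree_monom_eq[OF one_neq_zero]
        by (rule sum.cong[OF refl]) (auto simp: power_0_left)
      then show ?thesis by simp
    qed
    then show ?thesis using k by metis
  qed
  have "t_Kt * k (monom 1 0) = (\<Sum>j\<le>r. kc (gK j) * k (monom 1 j))"
    using u[unfolded dual_seq_def, rule_format, of 0] by simp
  also have "\<dots> = kc (gK 0) * k (monom 1 0) + (\<Sum>j<r. kc (gK (Suc j)) * frob_Kt (?s j))"
    by (simp add: sum.atMost_shift Suc)
  finally have "t_theta_Kt * k (monom 1 0) = (\<Sum>j<r. kc (gK (Suc j)) * frob_Kt (?s j))"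
    by (simp add: t_theta_Kt_def algebra_simps)
  then have "k (monom 1 0) = tau_seq ?s 0"
    using t_theta_Kt_nz by (simp add: tau_seq_def field_simps)
  then have "k (monom 1 n) = tau_seq ?s n" for n
    by (cases n) (simp_all add: Suc tau_seq_def)
  then have "functional (\<lambda>n. k (monom 1 n)) = functional (tau_seq ?s)" by simp
  then show "k = functional (tau_seq ?s)"
    unfolding dual_eq_functional[OF conjunct1[OF k], symmetric] .
qed

lemma dual_tau_mem: "h \<in> motive_dual \<phi> \<Longrightarrow> dual_tau \<phi> h \<in> motive_dual \<phi>"
  using dual_tau_eq functional_in_dual dual_seq_tau_seq dual_seq_of_dual by simp

text \<open>Column j of the matrix says that the j-th dual basis vector goes to the next one plus
  g_(j+1) / (t - \<theta>) times the one of index 0, with no next one for j = r - 1.\<close>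

lemma dual_tau_monom:
  assumes "h \<in> motive_dual \<phi>" "i < r"
  shows "dual_tau \<phi> h (monom 1 i) = (\<Sum>j<r.
    companion r (\<lambda>j. kc (gK (Suc j)) / t_theta_Kt) $$ (i, j) * frob_Kt (h (monom 1 j)))"
proof -
  have "(\<Sum>j<r. companion r (\<lambda>j. kc (gK (Suc j)) / t_theta_Kt) $$ (i, j) * frob_Kt (h (monom 1 j)))
    = (if i = 0 then (\<Sum>j<r. kc (gK (Suc j)) * frob_Kt (h (monom 1 j))) / t_theta_Kt
       else frob_Kt (h (monom 1 (i - 1))))"
  proof (cases i)
    case 0
    then show ?thesis using assms(2)
      by (simp add: companion_def sum_divide_distrib)
  next
    case (Suc i')
    have "(\<Sum>j<r. companion r (\<lambda>j. kc (gK (Suc j)) / t_theta_Kt) $$ (i, j) * frob_Kt (h (monom 1 j)))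
      = (\<Sum>j<r. if j = i' then frob_Kt (h (monom 1 i')) else 0)"
      using Suc assms(2) by (intro sum.cong) (auto simp: companion_def)
    then show ?thesis using Suc assms(2) by simp
  qed
  moreover have "dual_tau \<phi> h (monom 1 i) = tau_seq (\<lambda>n. h (monom 1 n)) i"
    by (simp only: dual_tau_eq[OF assms(1)] functional_monom kc_hom.hom_one mult_1_left)
  ultimately show ?thesis by (cases i) (simp_all add: tau_seq_def)
qed

end


section \<open>The order of a Drinfeld model over a residue field\<close>

lemma mult_diag_mat_index:
  fixes A :: "'a::comm_ring_1 mat"
  assumes "A \<in> carrier_mat n n" "i < n" "j < n"
  shows "(A * mat n n (\<lambda>(i, j). if i = j then s i else 0)) $$ (i, j) = A $$ (i, j) * s j"
    and "(mat n n (\<lambda>(i, j). if i = j then s i else 0) * A) $$ (i, j) = s i * A $$ (i, j)"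
proof -
  have "(A * mat n n (\<lambda>(i, j). if i = j then s i else 0)) $$ (i, j)
      = (\<Sum>k<n. A $$ (i, k) * (if k = j then s k else 0))"
    using assms by (simp add: scalar_prod_def atLeast0LessThan)
  also have "\<dots> = (\<Sum>k<n. if k = j then A $$ (i, j) * s j else 0)"
    by (rule sum.cong) auto
  finally show "(A * mat n n (\<lambda>(i, j). if i = j then s i else 0)) $$ (i, j) = A $$ (i, j) * s j"
    using assms by simp
  have "(mat n n (\<lambda>(i, j). if i = j then s i else 0) * A) $$ (i, j)
      = (\<Sum>k<n. (if i = k then s i else 0) * A $$ (k, j))"
    using assms by (simp add: scalar_prod_def atLeast0LessThan)
  also have "\<dots> = (\<Sum>k<n. if k = i then s i * A $$ (i, j) else 0)"
    by (rule sum.cong) auto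
  finally show "(mat n n (\<lambda>(i, j). if i = j then s i else 0) * A) $$ (i, j) = s i * A $$ (i, j)"
    using assms by simp
qed

lemma det_diag_mat: "det (mat n n (\<lambda>(i, j). if i = j then s i else 0)) = (\<Prod>i<n. s i)"
  for s :: "nat \<Rightarrow> 'a::comm_ring_1"
proof -
  let ?D = "mat n n (\<lambda>(i, j). if i = j then s i else 0)"
  have "det ?D = prod_list (diag_mat ?D)"
    by (rule det_upper_triangular[of _ n]) auto
  also have "diag_mat ?D = map s [0..<n]"
    by (simp add: diag_mat_def)
  also have "prod_list \<dots> = (\<Prod>i<n. s i)"
    by (simp add: prod.distinct_set_conv_list[symmetric] atLeast0LessThan)
  finally show ?thesis .
qed

text \<open>Conjugation by the diagonal matrix with entries T^r, ..., T replaces the powers T^(i+1)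
  in the first row by one scalar T for the whole companion matrix. The same diagonal matrix serves
  every k, so the product is conjugated as a whole.\<close>

lemma det_companion_prod_scale:
  fixes h :: "nat \<Rightarrow> nat \<Rightarrow> 'a::idom"
  assumes "T \<noteq> 0"
  shows "det (1\<^sub>m r - mat_prod r (\<lambda>k. companion r (\<lambda>i. h k i * T ^ Suc i)) ks)
    = det (1\<^sub>m r - T ^ length ks \<cdot>\<^sub>m mat_prod r (\<lambda>k. companion r (h k)) ks)"
proof -
  define S where "S = mat r r (\<lambda>(i, j). if i = j then T ^ (r - i) else 0)"
  define M where "M = (\<lambda>k. companion r (\<lambda>i. h k i * T ^ Suc i))"
  define C where "C = (\<lambda>k. companion r (h k))"
  have S: "S \<in> carrier_mat r r" by (simp add: S_def)
  have M: "M k \<in> carrier_mat r r" and C: "C k \<in> carrier_mat r r" for k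
    by (simp_all add: M_def C_def)
  have PM: "mat_prod r M ks \<in> carrier_mat r r" and PC: "mat_prod r C ks \<in> carrier_mat r r" for ks
    by (simp_all add: mat_prod_carrier M C)
  have MS: "M k * S = S * (T \<cdot>\<^sub>m C k)" for k
  proof (rule eq_matI)
    fix i j assume "i < dim_row (S * (T \<cdot>\<^sub>m C k))" "j < dim_col (S * (T \<cdot>\<^sub>m C k))"
    then have ij: "i < r" "j < r" using S C[of k] by auto
    have "(M k * S) $$ (i, j) = M k $$ (i, j) * T ^ (r - j)"
      unfolding S_def using ij by (subst mult_diag_mat_index(1)[OF M]) auto
    also have "\<dots> = T ^ (r - i) * (T \<cdot>\<^sub>m C k) $$ (i, j)"
    proof (cases i)
      case 0
      have "Suc j + (r - j) = Suc r" using ij by simp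
      then have "T ^ Suc j * T ^ (r - j) = T ^ Suc r" by (simp only: power_add[symmetric])
      then show ?thesis using 0 ij by (auto simp: M_def C_def companion_def)
    next
      case (Suc i')
      then have "r - i' = Suc (r - i)" using ij by simp
      then show ?thesis using Suc ij by (auto simp: M_def C_def companion_def)
    qed
    also have "\<dots> = (S * (T \<cdot>\<^sub>m C k)) $$ (i, j)"
      unfolding S_def using ij by (subst mult_diag_mat_index(2)) (auto simp: smult_carrier_mat C)
    finally show "(M k * S) $$ (i, j) = (S * (T \<cdot>\<^sub>m C k)) $$ (i, j)" .
  qed (use S in \<open>simp_all add: M_def C_def\<close>)
  have "mat_prod r M ks * S = S * (T ^ length ks \<cdot>\<^sub>m mat_prod r C ks)"
  proof (induction ks)
    case Nil
    have "(1 :: 'a) \<cdot>\<^sub>m 1\<^sub>m r = 1\<^sub>m r" by (rule eq_matI) auto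
    then show ?case using S by simp
  next
    case (Cons k ks)
    have "mat_prod r M (k # ks) * S = M k * (mat_prod r M ks * S)"
      using assoc_mult_mat[OF M PM S] by simp
    also have "\<dots> = (M k * S) * (T ^ length ks \<cdot>\<^sub>m mat_prod r C ks)"
      unfolding Cons by (rule assoc_mult_mat[OF M S smult_carrier_mat[OF PC], symmetric])
    also have "\<dots> = S * ((T \<cdot>\<^sub>m C k) * (T ^ length ks \<cdot>\<^sub>m mat_prod r C ks))"
      unfolding MS by (rule assoc_mult_mat[OF S smult_carrier_mat[OF C] smult_carrier_mat[OF PC]])
    also have "(T \<cdot>\<^sub>m C k) * (T ^ length ks \<cdot>\<^sub>m mat_prod r C ks)
        = T ^ length (k # ks) \<cdot>\<^sub>m mat_prod r C (k # ks)"
    proof -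
      have "(T \<cdot>\<^sub>m C k) * (T ^ length ks \<cdot>\<^sub>m mat_prod r C ks)
          = T \<cdot>\<^sub>m (T ^ length ks \<cdot>\<^sub>m (C k * mat_prod r C ks))"
        by (simp add: mult_smult_assoc_mat[OF C smult_carrier_mat[OF PC]] mult_smult_distrib[OF C PC])
      also have "\<dots> = T ^ length (k # ks) \<cdot>\<^sub>m mat_prod r C (k # ks)"
        by (rule eq_matI) (auto simp: mult.assoc)
      finally show ?thesis .
    qed
    finally show ?case .
  qed
  then have "(1\<^sub>m r - mat_prod r M ks) * S = S * (1\<^sub>m r - T ^ length ks \<cdot>\<^sub>m mat_prod r C ks)"
    using S minus_mult_distrib_mat[OF one_carrier_mat PM S, of ks]
      mult_minus_distrib_mat[OF S one_carrier_mat smult_carrier_mat[OF PC], of "T ^ length ks" ks]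
    by simp
  then have "det (1\<^sub>m r - mat_prod r M ks) * det S = det S * det (1\<^sub>m r - T ^ length ks \<cdot>\<^sub>m mat_prod r C ks)"
    using det_mult[OF minus_carrier_mat[OF PM] S] det_mult[OF S minus_carrier_mat[OF smult_carrier_mat[OF PC]]]
    by metis
  moreover have "det S \<noteq> 0" unfolding S_def det_diag_mat using assms by simp
  ultimately have "det (1\<^sub>m r - mat_prod r M ks) = det (1\<^sub>m r - T ^ length ks \<cdot>\<^sub>m mat_prod r C ks)"
    by simp
  then show ?thesis unfolding M_def C_def .
qed

text \<open>A kernel vector would be the coefficient vector of a nonzero polynomial of degree below
  n with n distinct roots.\<close>

lemma det_vandermonde_nz:
  fixes x :: "nat \<Rightarrow> 'a::idom"
  assumes "inj_on x {..<n}"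
  shows "det (mat n n (\<lambda>(k, i). x k ^ i)) \<noteq> 0"
proof
  assume "det (mat n n (\<lambda>(k, i). x k ^ i)) = 0"
  then obtain v where v: "v \<in> carrier_vec n" "v \<noteq> 0\<^sub>v n" "mat n n (\<lambda>(k, i). x k ^ i) *\<^sub>v v = 0\<^sub>v n"
    using det_0_iff_vec_prod_zero[of "mat n n (\<lambda>(k, i). x k ^ i)" n] by auto
  define p where "p = (\<Sum>i<n. monom (v $ i) i)"
  have coeff_p: "coeff p i = v $ i" if "i < n" for i
    using that by (simp add: p_def coeff_sum)
  have root: "poly p (x k) = 0" if "k < n" for k
  proof -
    have "poly p (x k) = (mat n n (\<lambda>(k, i). x k ^ i) *\<^sub>v v) $ k"
      using that v(1) by (simp add: p_def poly_sum poly_monom scalar_prod_def atLeast0LessThan mult.commute)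
    then show ?thesis using v(3) that by simp
  qed
  have "p = 0"
  proof (rule ccontr)
    assume p: "p \<noteq> 0"
    have "x ` {..<n} \<subseteq> {z. poly p z = 0}" using root by auto
    then have "card (x ` {..<n}) \<le> degree p"
      using card_mono[OF poly_roots_finite[OF p], of "x ` {..<n}"] card_poly_roots_bound[OF p] by simp
    moreover have "degree p < n"
    proof (cases n)
      case 0
      with p show ?thesis by (simp add: p_def)
    next
      case (Suc m)
      have "degree p \<le> m"
        unfolding p_def Suc by (intro degree_sum_le) (auto intro: degree_monom_le[THEN le_trans])
      then show ?thesis using Suc by simp
    qed
    ultimately show False using card_image[OF assms] by simp
  qed
  then have "v = 0\<^sub>v n" using v(1) coeff_p by (intro eq_vecI) auto
  with v(2) show False by contradiction
qed

lemma comm_ring_hom_funpow: "comm_ring_hom h \<Longrightarrow> comm_ring_hom (h ^^ n)"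
  for h :: "'a::comm_ring_1 \<Rightarrow> 'a"
proof (induction n)
  case 0
  show ?case by unfold_locales auto
next
  case (Suc n)
  interpret h: comm_ring_hom h by fact
  interpret hn: comm_ring_hom "h ^^ n" by (rule Suc.IH) fact
  show ?case by unfold_locales (auto simp: h.hom_add h.hom_mult hn.hom_add hn.hom_mult)
qed

interpretation frob_RtT_hom: comm_ring_hom frob_RtT
  unfolding frob_RtT_def by unfold_locales

interpretation frob_RtT_funpow_hom: comm_ring_hom "frob_RtT ^^ n"
  by (rule comm_ring_hom_funpow) unfold_locales

definition A_poly :: "'f::field poly poly \<Rightarrow> 'f poly poly poly" where
  "A_poly = map_poly A_in_AR"

lemma A_poly_eq: "map_poly (map_poly (\<lambda>a. [:a:])) = A_poly"
  unfolding A_poly_def A_in_AR_def[abs_def] by simp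

interpretation A_poly_hom: comm_ring_hom A_poly
proof -
  interpret map_poly_inj_idom_hom A_in_AR ..
  show "comm_ring_hom A_poly" unfolding A_poly_def by unfold_locales
qed

lemma frob_RtT_A_poly: "frob_RtT (A_poly c) = A_poly c"
  by (intro poly_eqI)
    (simp add: frob_RtT_def A_poly_def coeff_map_poly A_in_AR_def power_0_left
      poly_const_pow power_card_eq_self)

lemma frob_RtT_funpow_A_poly: "(frob_RtT ^^ n) (A_poly c) = A_poly c"
  by (induction n) (simp_all add: frob_RtT_A_poly)

section \<open>The order in terms of evaluations at the conjugates\<close>

locale drinfeld_place = place_root q \<alpha> + drinfeld \<phi>
  for q :: "'f::{field,finite} poly" and \<alpha> and \<phi> :: "'f poly \<Rightarrow> 'f poly poly"
begin

definition d where "d = degree q"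

lemma d_pos: "d > 0" by (simp add: d_def degree_pos)

definition kE :: "'f alg_closure \<Rightarrow> 'f Et" where "kE c = to_fract [:c:]"

sublocale kE_hom: inj_idom_hom kE
  by unfold_locales (auto simp: kE_def simp flip: to_fract_add to_fract_mult one_pCons)

definition \<theta>E :: "nat \<Rightarrow> 'f Et" where "\<theta>E k = to_fract [:- conj k, 1:]"

lemma \<theta>E_nz: "\<theta>E k \<noteq> 0" by (simp add: \<theta>E_def)

text \<open>The reduction at index k of the entry g_(i+1) / (t - \<theta>) of the matrix of
  \<tau>.\<close>

definition hE :: "nat \<Rightarrow> nat \<Rightarrow> 'f Et" where
  "hE k i = kE (eval_at (conj k) (g (Suc i))) / \<theta>E k"

text \<open>The common image in E[T] of the two local factors.\<close>

definition frob_det :: "'f Et poly" where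
  "frob_det = det (1\<^sub>m r - monom 1 d \<cdot>\<^sub>m mat_prod r (\<lambda>k. companion r (\<lambda>i. [:hE k i:])) [0..<d])"

text \<open>\<open>H k m\<close> is the unknown x_k of the cyclic system attached to m.\<close>

definition H :: "nat \<Rightarrow> 'f poly poly poly \<Rightarrow> 'f Et poly" where
  "H k = map_poly (\<lambda>s. to_fract (ev k s))"

sublocale ev_fract_hom: comm_ring_hom "\<lambda>s. to_fract (ev k s)" for k
  by unfold_locales (auto simp: ev_hom.hom_add ev_hom.hom_mult)

sublocale ev_fract_poly_hom: map_poly_comm_ring_hom "\<lambda>s. to_fract (ev k s)" for k ..

sublocale H_hom: comm_ring_hom "H k" for k
  unfolding H_def by unfold_locales

lemma coeff_H: "coeff (H k m) n = to_fract (ev k (coeff m n))"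
  by (simp add: H_def)

lemma H_A_poly: "H k (A_poly c) = map_poly A_to_E c"
  by (intro poly_eqI) (simp add: coeff_H A_poly_def coeff_map_poly ev_A_in_AR A_to_E_def)

lemma H_frob: "H k (frob_RtT m) = H (Suc k) m"
proof (rule poly_eqI)
  fix n
  have "coeff (frob_RtT m) n = frob_AR (coeff m n)"
    by (simp add: frob_RtT_def frob_AR_def coeff_map_poly)
  then show "coeff (H k (frob_RtT m)) n = coeff (H (Suc k) m) n"
    by (simp add: coeff_H ev_frob)
qed

lemma H_frob_funpow: "H k ((frob_RtT ^^ i) m) = H (k + i) m"
  by (induction i arbitrary: k) (simp_all add: H_frob)

lemma H_const: "H k [:[:c:]:] = [:kE (eval_at (conj k) c):]"
  by (intro poly_eqI) (auto simp: coeff_H kE_def ev_def eval_at_hom.map_poly_pCons_hom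
      coeff_pCons split: nat.splits)

lemma H_monom_const: "H k (monom [:c:] i) = monom (kE (eval_at (conj k) c)) i"
  by (intro poly_eqI) (auto simp: coeff_H kE_def ev_def eval_at_hom.map_poly_pCons_hom)

lemma H_var: "H k [:Defs.var:] = [:to_fract [:0, 1:]:]"
  by (intro poly_eqI) (auto simp: coeff_H ev_def Defs.var_def eval_at_hom.map_poly_pCons_hom
      coeff_pCons split: nat.splits)

lemma H_t_minus_phi:
  "H k (t_minus_phi \<phi> m) = [:to_fract [:0, 1:]:] * H k m
     - (\<Sum>i\<le>r. monom (kE (eval_at (conj k) (g i))) i * H (k + i) m)"
  unfolding t_minus_phi_def r_def[symmetric] g_def[symmetric] H_hom.hom_minus H_hom.hom_mult
    H_hom.hom_sum H_var H_monom_const H_frob_funpow ..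

definition N :: "'f poly poly poly set" where "N = {m. [:[:q:]:] dvd m}"

lemma N_iff: "m \<in> N \<longleftrightarrow> (\<forall>n l. q dvd coeff (coeff m n) l)"
  by (simp add: N_def const_poly_dvd_iff)

lemma H_N: "m \<in> N \<Longrightarrow> H k m = 0"
proof -
  assume "m \<in> N"
  then obtain u where "m = [:[:q:]:] * u" unfolding N_def by blast
  moreover have "H k [:[:q:]:] = 0" by (simp add: H_const conj_root)
  ultimately show ?thesis by (simp only: H_hom.hom_mult) simp
qed

definition \<theta>_pow :: "nat \<Rightarrow> 'f poly poly poly" where "\<theta>_pow i = [:[:monom 1 i:]:]"

lemma H_\<theta>_pow: "H k (\<theta>_pow i) = [:kE (conj k ^ i):]"
proof -
  have "eval_at (conj k) (monom 1 i) = conj k ^ i"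
    by (simp add: monom_altdef eval_at_hom.hom_power eval_at_pCons)
  then show ?thesis by (simp add: \<theta>_pow_def H_const)
qed

lemma coeff_\<theta>_comb:
  "coeff (coeff (\<Sum>i<d. A_poly (c i) * \<theta>_pow i) n) l = (\<Sum>i<d. monom (coeff (coeff (c i) n) l) i)"
proof -
  have "coeff (coeff (A_poly (c i) * \<theta>_pow i) n) l = monom (coeff (coeff (c i) n) l) i" for i
  proof -
    have "A_poly (c i) * \<theta>_pow i = Polynomial.smult [:monom 1 i:] (A_poly (c i))"
      by (simp add: \<theta>_pow_def mult.commute)
    then show ?thesis
      by (simp add: A_poly_def coeff_map_poly A_in_AR_def monom_altdef mult.commute)
  qed
  then show ?thesis by (simp add: coeff_sum)
qed

definition \<theta>_basis where "\<theta>_basis = map \<theta>_pow [0..<d]"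

lemma length_\<theta>_basis [simp]: "length \<theta>_basis = d"
  by (simp add: \<theta>_basis_def)

lemma nth_\<theta>_basis [simp]: "i < d \<Longrightarrow> \<theta>_basis ! i = \<theta>_pow i"
  by (simp add: \<theta>_basis_def)

text \<open>Division by q with remainder in every coefficient shows that 1, \<theta>, ...,
  \<theta>^(d-1) span; a combination of them that is divisible by q vanishes because its degree is
  below d.\<close>

lemma quot_basis_\<theta>: "quot_basis UNIV {0} (\<lambda>c m. A_poly c * m) UNIV N \<theta>_basis"
  unfolding quot_basis_def
proof (intro conjI ballI allI impI)
  fix m :: "'f poly poly poly"
  define c where "c i = map_poly (map_poly (\<lambda>a. coeff (a mod q) i)) m" for i
  have "m - (\<Sum>i<d. A_poly (c i) * \<theta>_pow i) \<in> N"
    unfolding N_iff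
  proof (intro allI)
    fix n l
    define a where "a = coeff (coeff m n) l"
    have "degree (a mod q) \<le> d - 1"
      using degree_mod_less[of q a] q_nz d_pos by (auto simp: d_def)
    from poly_as_sum_of_monoms'[OF this]
    have "(\<Sum>i<d. monom (coeff (a mod q) i) i) = a mod q"
      using d_pos by (simp add: lessThan_Suc_atMost[symmetric])
    then have "coeff (coeff (m - (\<Sum>i<d. A_poly (c i) * \<theta>_pow i)) n) l = a - a mod q"
      by (simp add: coeff_\<theta>_comb c_def coeff_map_poly a_def)
    then show "q dvd coeff (coeff (m - (\<Sum>i<d. A_poly (c i) * \<theta>_pow i)) n) l"
      by (simp add: dvd_minus_mod)
  qed
  then show "\<exists>c. (\<forall>i<length \<theta>_basis. c i \<in> UNIV) \<and>
      m - (\<Sum>i<length \<theta>_basis. A_poly (c i) * \<theta>_basis ! i) \<in> N"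
    by (intro exI[of _ c]) simp
next
  fix c i assume c: "(\<forall>i<length \<theta>_basis. c i \<in> UNIV) \<and>
    (\<Sum>i<length \<theta>_basis. A_poly (c i) * \<theta>_basis ! i) \<in> N" and i: "i < length \<theta>_basis"
  have "coeff (coeff (c i) n) l = 0" for n l
  proof -
    define a where "a = (\<Sum>i<d. monom (coeff (coeff (c i) n) l) i)"
    have "q dvd a" using c unfolding N_iff by (simp add: coeff_\<theta>_comb a_def)
    moreover have "degree a \<le> d - 1"
      unfolding a_def using d_pos by (intro degree_sum_le) (auto intro: degree_monom_le[THEN le_trans])
    then have "degree a < degree q" using d_pos by (simp add: d_def)
    ultimately have "a = 0" using divides_degree[of q a] by auto
    then have "coeff a i = 0" by simp
    then show ?thesis using i by (simp add: a_def coeff_sum)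
  qed
  then show "c i \<in> {0}" by (auto intro!: poly_eqI)
qed simp

text \<open>The scalars A[T] already form a domain, so the reduction is the identity. The map is
  linear over them because Frobenius fixes A[T].\<close>

lemma quot_module_drinfeld:
  "quot_module UNIV id {0} (\<lambda>c m. A_poly c * m) UNIV N (t_minus_phi \<phi>)"
proof -
  have N_dvd: "frob_RtT m \<in> N" if "m \<in> N" for m
  proof -
    have "coeff (coeff (frob_RtT m) n) l = coeff (coeff m n) l ^ CARD('f)" for n l
      by (simp add: frob_RtT_def coeff_map_poly power_0_left)
    then show ?thesis using that by (auto simp: N_iff intro: dvd_trans[OF _ dvd_power])
  qed
  have N_funpow: "(frob_RtT ^^ i) m \<in> N" if "m \<in> N" for i m
    using that by (induction i) (auto intro: N_dvd)
  have t_N: "t_minus_phi \<phi> m \<in> N" if "m \<in> N" for m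
    unfolding t_minus_phi_def N_def mem_Collect_eq
    using that N_funpow[OF that] unfolding N_def mem_Collect_eq
    by (intro dvd_diff dvd_sum dvd_mult) auto
  have add: "t_minus_phi \<phi> (x + y) = t_minus_phi \<phi> x + t_minus_phi \<phi> y" for x y
    by (simp add: t_minus_phi_def frob_RtT_funpow_hom.hom_add distrib_left sum.distrib)
  have smul: "t_minus_phi \<phi> (A_poly c * m) = A_poly c * t_minus_phi \<phi> m" for c m
    by (simp add: t_minus_phi_def frob_RtT_funpow_hom.hom_mult frob_RtT_funpow_A_poly
        right_diff_distrib sum_distrib_left mult.left_commute)
  show ?thesis
  proof unfold_locales
    show "t_minus_phi \<phi> (A_poly c * x) - A_poly c * t_minus_phi \<phi> x \<in> N" for c x
      by (simp add: smul N_def)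
    show "t_minus_phi \<phi> x \<in> N" if "x \<in> N" for x by (rule t_N[OF that])
  qed (auto simp: N_def A_poly_hom.hom_add A_poly_hom.hom_mult algebra_simps add intro: dvd_diff)
qed

lemma drinfeld_order_matrix:
  obtains X where "X \<in> carrier_mat d d" "drinfeld_order \<phi> q = det X"
    "\<And>j. j < d \<Longrightarrow> t_minus_phi \<phi> (\<theta>_pow j) - (\<Sum>i<d. A_poly (X $$ (i, j)) * \<theta>_pow i) \<in> N"
proof -
  interpret quot_module UNIV id "{0}" "\<lambda>c m. A_poly c * m" UNIV N "t_minus_phi \<phi>"
    by (rule quot_module_drinfeld)
  have "\<forall>j. \<exists>c. t_minus_phi \<phi> (\<theta>_pow j) - (\<Sum>i<d. A_poly (c i) * \<theta>_pow i) \<in> N"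
    using quot_basis_\<theta> unfolding quot_basis_def by simp
  then obtain c where c: "\<And>j. t_minus_phi \<phi> (\<theta>_pow j) - (\<Sum>i<d. A_poly (c j i) * \<theta>_pow i) \<in> N"
    by metis
  define X where "X = mat d d (\<lambda>(i, j). c j i)"
  have X: "t_minus_phi \<phi> (\<theta>_pow j) - (\<Sum>i<d. A_poly (X $$ (i, j)) * \<theta>_pow i) \<in> N" if "j < d" for j
    using c[of j] that by (simp add: X_def)
  have det: "is_quot_det UNIV {0} (\<lambda>c m. A_poly c * m) UNIV N (t_minus_phi \<phi>) (det X)"
    unfolding is_quot_det_def using quot_basis_\<theta> X
    by (intro conjI exI[of _ \<theta>_basis] exI[of _ X]) (auto simp: X_def)
  have "drinfeld_order \<phi> q = det X"
    unfolding drinfeld_order_def A_poly_eq N_def[symmetric]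
  proof (rule the_equality)
    show "\<delta> = det X" if "is_quot_det UNIV {0} (\<lambda>c m. A_poly c * m) UNIV N (t_minus_phi \<phi>) \<delta>" for \<delta>
      using quot_det_unique[OF that det] by simp
  qed (rule det)
  then show ?thesis using X by (intro that[of X]) (auto simp: X_def)
qed

lemma A_to_E_q: "A_to_E q = (\<Prod>k<d. \<theta>E k)"
  by (simp add: A_to_E_def map_poly_q \<theta>E_def d_def to_fract_hom.hom_prod)

sublocale A_to_E_hom: inj_idom_hom A_to_E
  by unfold_locales (auto simp: A_to_E_def hom_distribs)

sublocale A_to_E_poly_hom: map_poly_inj_idom_hom A_to_E ..

lemma drinfeld_order_eq:
  "map_poly A_to_E (drinfeld_order \<phi> q) = [:A_to_E q:] * frob_det"
proof -
  obtain X where X: "X \<in> carrier_mat d d" and ord: "drinfeld_order \<phi> q = det X"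
    and rel: "\<And>j. j < d \<Longrightarrow> t_minus_phi \<phi> (\<theta>_pow j) - (\<Sum>i<d. A_poly (X $$ (i, j)) * \<theta>_pow i) \<in> N"
    by (rule drinfeld_order_matrix) blast
  \<comment> \<open>\<open>V\<close> evaluates at the conjugates, \<open>D\<close> holds the pivots
    t - \<alpha>_k, whose product is q(t), and \<open>Y\<close> is what remains of the cyclic matrix
    when row k is divided by its pivot.\<close>
  define V where "V = mat d d (\<lambda>(k, i). [:kE (conj k ^ i):])"
  define Y where "Y = mat d d (\<lambda>(k, l). (if k = l then 1 else 0)
             - (\<Sum>i<r. if (k + i + 1) mod d = l then monom (hE k i) (Suc i) else 0))"
  define D where "D = mat d d (\<lambda>(k, l). if k = l then [:\<theta>E k:] else 0)"
  define X' where "X' = map_mat (map_poly A_to_E) X"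
  have V: "V \<in> carrier_mat d d" and Y: "Y \<in> carrier_mat d d" and D: "D \<in> carrier_mat d d"
    and X': "X' \<in> carrier_mat d d" using X by (simp_all add: V_def Y_def D_def X'_def)
  \<comment> \<open>Entry (k, j) on both sides is the k-th evaluation of \<open>t_minus_phi\<close>
    applied to \<theta>^j.\<close>
  have "V * X' = D * Y * V"
  proof (rule eq_matI)
    fix k j assume "k < dim_row (D * Y * V)" "j < dim_col (D * Y * V)"
    then have kj: "k < d" "j < d" by (auto simp: D_def V_def)
    have "H k (t_minus_phi \<phi> (\<theta>_pow j)) = H k (\<Sum>i<d. A_poly (X $$ (i, j)) * \<theta>_pow i)"
      using H_N[OF rel[OF kj(2)], of k] by (simp add: H_hom.hom_minus)
    also have "\<dots> = (\<Sum>i<d. [:kE (conj k ^ i):] * map_poly A_to_E (X $$ (i, j)))"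
      by (simp add: H_hom.hom_sum H_hom.hom_mult H_A_poly H_\<theta>_pow mult.commute)
    also have "\<dots> = (V * X') $$ (k, j)"
      using kj X by (simp add: V_def X'_def scalar_prod_def atLeast0LessThan)
    finally have VX: "(V * X') $$ (k, j) = H k (t_minus_phi \<phi> (\<theta>_pow j))" ..
    \<comment> \<open>Conjugates have period d in their index, so the wrapped column index in
      \<open>Y\<close> names the right unknown.\<close>
    have mod: "kE (conj ((k + i + 1) mod d) ^ j) = kE (conj (k + i + 1) ^ j)" for i
      by (simp add: conj_mod d_def)
    have "(Y * V) $$ (k, j) = (\<Sum>l<d. Y $$ (k, l) * [:kE (conj l ^ j):])"
      using kj by (simp add: V_def Y_def scalar_prod_def atLeast0LessThan)
    also have "\<dots> = (\<Sum>l<d. (if l = k then [:kE (conj k ^ j):] else 0) -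
        (\<Sum>i<r. if l = (k + i + 1) mod d then monom (hE k i) (Suc i) * [:kE (conj l ^ j):] else 0))"
    proof (rule sum.cong[OF refl])
      fix l assume l: "l \<in> {..<d}"
      let ?c = "\<lambda>l. [:kE (conj l ^ j):]"
      have "Y $$ (k, l) = (if k = l then 1 else 0)
          - (\<Sum>i<r. if (k + i + 1) mod d = l then monom (hE k i) (Suc i) else 0)"
        using kj l by (simp add: Y_def)
      then show "Y $$ (k, l) * ?c l = (if l = k then ?c k else 0) -
          (\<Sum>i<r. if l = (k + i + 1) mod d then monom (hE k i) (Suc i) * ?c l else 0)"
        by (simp only: left_diff_distrib sum_distrib_right)
          (intro arg_cong2[where f = "(-)"] sum.cong; auto)
    qed
    also have "\<dots> = [:kE (conj k ^ j):] - (\<Sum>i<r. \<Sum>l<d. 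
        if l = (k + i + 1) mod d then monom (hE k i) (Suc i) * [:kE (conj l ^ j):] else 0)"
      using kj unfolding sum_subtractf by (subst sum.swap) simp
    also have "\<dots> = [:kE (conj k ^ j):] - (\<Sum>i<r. monom (hE k i) (Suc i) * [:kE (conj (k + i + 1) ^ j):])"
      using d_pos by (simp add: mod[simplified])
    finally have YV: "(Y * V) $$ (k, j) = \<dots>" .
    have "(D * Y * V) $$ (k, j) = [:\<theta>E k:] * (Y * V) $$ (k, j)"
      unfolding assoc_mult_mat[OF D Y V] unfolding D_def
      using mult_carrier_mat[OF Y V] kj by (intro mult_diag_mat_index(2)) auto
    also have "\<dots> = [:\<theta>E k:] * [:kE (conj k ^ j):] - (\<Sum>i<r. ([:\<theta>E k:] * monom (hE k i) (Suc i)) * [:kE (conj (k + i + 1) ^ j):])"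
      unfolding YV by (simp only: right_diff_distrib sum_distrib_left mult.assoc)
    also have "(\<Sum>i<r. ([:\<theta>E k:] * monom (hE k i) (Suc i)) * [:kE (conj (k + i + 1) ^ j):])
      = (\<Sum>i<r. monom (kE (eval_at (conj k) (g (Suc i)))) (Suc i) * [:kE (conj (k + i + 1) ^ j):])"
      using \<theta>E_nz by (simp add: hE_def smult_monom)
    \<comment> \<open>The pivot splits into t and the term i = 0 of the sum, since g_0 is
      \<theta>.\<close>
    also have "[:\<theta>E k:] = [:to_fract [:0, 1:]:] - [:kE (conj k):]"
      by (simp add: \<theta>E_def kE_def flip: to_fract_diff)
    also have "\<dots> * [:kE (conj k ^ j):] - (\<Sum>i<r. monom (kE (eval_at (conj k) (g (Suc i)))) (Suc i)
          * [:kE (conj (k + i + 1) ^ j):]) = H k (t_minus_phi \<phi> (\<theta>_pow j))"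
      unfolding H_t_minus_phi H_\<theta>_pow sum.atMost_shift g_0
      by (simp add: left_diff_distrib right_diff_distrib monom_0 eval_at_pCons)
    finally show "(V * X') $$ (k, j) = (D * Y * V) $$ (k, j)" using VX by simp
  qed (simp_all add: V_def X'_def D_def carrier_matD[OF X])
  then have "det V * det X' = det (D * Y) * det V"
    using det_mult[OF V X'] det_mult[OF mult_carrier_mat[OF D Y] V] by metis
  \<comment> \<open>The matrix comes from Fbar, where the conjugates are distinct; its determinant
    is nonzero there and stays so in E[T].\<close>
  moreover have "det V \<noteq> 0"
  proof -
    interpret const_kE: inj_idom_hom "\<lambda>c. [:kE c:]"
      by unfold_locales (auto simp: kE_hom.hom_add kE_hom.hom_mult)
    have "V = map_mat (\<lambda>c. [:kE c:]) (mat d d (\<lambda>(k, i). conj k ^ i))"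
      by (rule eq_matI) (auto simp: V_def)
    then have "det V = [:kE (det (mat d d (\<lambda>(k, i). conj k ^ i))):]"
      by (simp add: const_kE.hom_det)
    then show ?thesis using det_vandermonde_nz[OF conj_inj] by (simp add: d_def)
  qed
  ultimately have "det X' = det D * det Y"
    using det_mult[OF D Y] by simp
  moreover have "det D = [:A_to_E q:]"
    unfolding D_def det_diag_mat A_to_E_q by (simp add: hom_distribs)
  moreover have "det Y = frob_det"
  proof -
    have "det Y = det (1\<^sub>m r - mat_prod r (\<lambda>k. companion r (\<lambda>i. monom (hE k i) (Suc i))) [0..<d])"
      unfolding Y_def by (rule det_cyclic_recurrence[OF d_pos r_pos])
    \<comment> \<open>Written with powers of T so that \<open>det_companion_prod_scale\<close>
      applies.\<close>
    also have "(\<lambda>k. companion r (\<lambda>i. monom (hE k i) (Suc i))) = (\<lambda>k. companion r (\<lambda>i. [:hE k i:] * monom 1 1 ^ Suc i))"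
      by (simp only: x_pow_n) (simp add: smult_monom)
    also have "det (1\<^sub>m r - mat_prod r \<dots> [0..<d]) = frob_det"
      by (subst det_companion_prod_scale) (simp_all add: frob_det_def x_pow_n del: One_nat_def)
    finally show ?thesis .
  qed
  moreover have "det X' = map_poly A_to_E (drinfeld_order \<phi> q)"
    unfolding X'_def ord by (rule A_to_E_poly_hom.hom_det)
  ultimately show ?thesis by simp
qed

end


section \<open>The reduction of the Anderson model\<close>

lemma mat_prod_snoc:
  assumes "\<And>k. M k \<in> carrier_mat r r"
  shows "mat_prod r M (ks @ [k]) = mat_prod r M ks * M k"
proof (induction ks)
  case (Cons l ks)
  then show ?case
    using assoc_mult_mat[OF assms mat_prod_carrier[OF assms] assms] by simp
qed (use assms[of k] in simp)

lemma map_mat_mat_prod: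
  assumes "comm_ring_hom h" "\<And>k. M k \<in> carrier_mat r r"
  shows "map_mat h (mat_prod r M ks) = mat_prod r (\<lambda>k. map_mat h (M k)) ks"
proof -
  interpret h: comm_ring_hom h by fact
  show ?thesis
  proof (induction ks)
    case Nil
    show ?case by (rule eq_matI) auto
  next
    case (Cons k ks)
    then show ?case using h.mat_hom_mult[OF assms(2) mat_prod_carrier[OF assms(2)]] by simp
  qed
qed

lemma monom_times_const: "monom 1 n * [:c:] = monom c n" for c :: "'a::comm_semiring_1"
  by (simp add: mult_monom flip: monom_0)

text \<open>Membership and image are proved in one induction: multiplicativity of
  \<open>\<psi>\<close> is available only for entries already known to lie in
  \<open>S\<close>.\<close>

lemma (in subring_hom) mat_prod_hom:
  assumes M: "\<And>k. M k \<in> carrier_mat r r" and mem: "\<And>k i j. i < r \<Longrightarrow> j < r \<Longrightarrow> M k $$ (i, j) \<in> S"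
  shows "(\<forall>i<r. \<forall>j<r. mat_prod r M ks $$ (i, j) \<in> S) \<and>
    map_mat \<psi> (mat_prod r M ks) = mat_prod r (\<lambda>k. map_mat \<psi> (M k)) ks"
proof (induction ks)
  case Nil
  have "map_mat \<psi> (1\<^sub>m r) = 1\<^sub>m r"
    by (rule eq_matI) (auto simp: hom_one hom_zero)
  then show ?case by (auto simp: one_mem zero_mem)
next
  case (Cons k ks)
  let ?P = "mat_prod r M ks"
  have P: "?P \<in> carrier_mat r r" by (rule mat_prod_carrier[OF M])
  have entry: "(M k * ?P) $$ (i, j) = (\<Sum>l<r. M k $$ (i, l) * ?P $$ (l, j))" if "i < r" "j < r" for i j
    using that M[of k] P by (simp add: scalar_prod_def atLeast0LessThan)
  have "map_mat \<psi> (M k * ?P) = map_mat \<psi> (M k) * map_mat \<psi> ?P"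
  proof (rule eq_matI)
    fix i j assume "i < dim_row (map_mat \<psi> (M k) * map_mat \<psi> ?P)" "j < dim_col (map_mat \<psi> (M k) * map_mat \<psi> ?P)"
    then have ij: "i < r" "j < r" using M[of k] P by auto
    have "\<psi> ((M k * ?P) $$ (i, j)) = (\<Sum>l<r. \<psi> (M k $$ (i, l) * ?P $$ (l, j)))"
      unfolding entry[OF ij] using Cons ij mem by (intro hom_sum mult_mem) auto
    also have "\<dots> = (\<Sum>l<r. \<psi> (M k $$ (i, l)) * \<psi> (?P $$ (l, j)))"
      using Cons ij mem by (intro sum.cong refl hom_mult) auto
    also have "\<dots> = (map_mat \<psi> (M k) * map_mat \<psi> ?P) $$ (i, j)"
      using ij M[of k] P by (simp add: scalar_prod_def atLeast0LessThan)
    finally show "map_mat \<psi> (M k * ?P) $$ (i, j) = (map_mat \<psi> (M k) * map_mat \<psi> ?P) $$ (i, j)"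
      using ij M[of k] P by simp
  qed (use M[of k] P in auto)
  moreover have "(M k * ?P) $$ (i, j) \<in> S" if "i < r" "j < r" for i j
    unfolding entry[OF that] using Cons that mem by (intro sum_mem mult_mem) auto
  ultimately show ?case using Cons by simp
qed

text \<open>A bound n replaces the degree of v, since evaluating functionals may lower the
  degree.\<close>

lemma poly_mult_as_sum:
  assumes "degree v \<le> n"
  shows "p * v = (\<Sum>i\<le>degree p. \<Sum>j\<le>n. monom (coeff p i * coeff v j) (i + j))"
proof -
  have "p * v = (\<Sum>i\<le>degree p. monom (coeff p i) i) * (\<Sum>j\<le>n. monom (coeff v j) j)"
    using poly_as_sum_of_monoms'[OF assms] by (simp add: poly_as_sum_of_monoms)
  then show ?thesis by (simp add: sum_product mult_monom)
qed

text \<open>Evaluation turns polynomials with functionals as coefficients into polynomials over a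
  field, where \<open>poly_smul\<close> is a product; module identities are then checked
  pointwise.\<close>

definition eval_coeffs :: "'m \<Rightarrow> ('m \<Rightarrow> 'f::field Kt) poly \<Rightarrow> 'f Kt poly" where
  "eval_coeffs x = map_poly (\<lambda>h. h x)"

lemma coeff_eval_coeffs [simp]: "coeff (eval_coeffs x v) n = coeff v n x"
  by (simp add: eval_coeffs_def coeff_map_poly)

lemma eval_coeffs_add: "eval_coeffs x (v + w) = eval_coeffs x v + eval_coeffs x w"
  by (intro poly_eqI) simp

lemma eval_coeffs_diff: "eval_coeffs x (v - w) = eval_coeffs x v - eval_coeffs x w"
  by (intro poly_eqI) (simp add: fun_diff_def)

lemma eval_coeffs_eqI: "(\<And>x. eval_coeffs x v = eval_coeffs x w) \<Longrightarrow> v = w"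
  by (intro poly_eqI ext) (metis coeff_eval_coeffs)

lemma eval_coeffs_poly_smul: "eval_coeffs x (poly_smul fun_smul p v) = p * eval_coeffs x v"
proof (rule poly_eqI)
  fix n
  have deg: "degree (eval_coeffs x v) \<le> degree v"
    by (simp add: eval_coeffs_def degree_map_poly_le)
  show "coeff (eval_coeffs x (poly_smul fun_smul p v)) n = coeff (p * eval_coeffs x v) n"
    unfolding poly_mult_as_sum[OF deg] poly_smul_def
    by (auto simp: coeff_sum sum_fun_apply fun_smul_def intro!: sum.cong)
qed

lemma (in drinfeld) coeff_poly_smul_dual:
  assumes "\<And>n. coeff v n \<in> motive_dual \<phi>"
  shows "coeff (poly_smul fun_smul p v) n \<in> motive_dual \<phi>"
  unfolding poly_smul_def coeff_sum coeff_monom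
  using assms by (intro dual_sum_mem) (auto intro: dual_fun_smul dual_zero)

interpretation frob_Kt_funpow_hom: comm_ring_hom "frob_Kt ^^ n"
  by (rule comm_ring_hom_funpow) unfold_locales

section \<open>The matrix of the d-th power of \<tau>\<close>

context drinfeld_place
begin

abbreviation co where "co j \<equiv> eval_coeffs (monom 1 j :: 'f poly fract poly)"

definition tau_mat :: "nat \<Rightarrow> 'f Kt mat" where
  "tau_mat n = companion r (\<lambda>i. (frob_Kt ^^ n) (kc (gK (Suc i)) / t_theta_Kt))"

lemma tau_mat_carrier: "tau_mat n \<in> carrier_mat r r"
  by (simp add: tau_mat_def)

lemma frob_tau_mat: "i < r \<Longrightarrow> j < r \<Longrightarrow> (frob_Kt ^^ n) (tau_mat 0 $$ (i, j)) = tau_mat n $$ (i, j)"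
  by (auto simp: tau_mat_def companion_def frob_Kt_funpow_hom.hom_one frob_Kt_funpow_hom.hom_zero)

text \<open>Iterating a semilinear map multiplies the successive Frobenius twists of its matrix,
  with twists increasing from left to right.\<close>

lemma dual_tau_funpow:
  assumes "h \<in> motive_dual \<phi>"
  shows "(dual_tau \<phi> ^^ n) h \<in> motive_dual \<phi>"
    and "i < r \<Longrightarrow> (dual_tau \<phi> ^^ n) h (monom 1 i) =
      (\<Sum>j<r. mat_prod r tau_mat [0..<n] $$ (i, j) * (frob_Kt ^^ n) (h (monom 1 j)))"
proof -
  show "(dual_tau \<phi> ^^ n) h \<in> motive_dual \<phi>"
    using assms by (induction n) (auto intro: dual_tau_mem)
  show "i < r \<Longrightarrow> (dual_tau \<phi> ^^ n) h (monom 1 i) =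
      (\<Sum>j<r. mat_prod r tau_mat [0..<n] $$ (i, j) * (frob_Kt ^^ n) (h (monom 1 j)))"
    using assms
  proof (induction n arbitrary: h)
    case 0
    have "(\<Sum>j<r. 1\<^sub>m r $$ (i, j) * h (monom 1 j)) = (\<Sum>j<r. if j = i then h (monom 1 i) else 0)"
      using 0 by (intro sum.cong) auto
    then show ?case using 0 by simp
  next
    case (Suc n)
    let ?P = "mat_prod r tau_mat [0..<n]"
    have P: "?P \<in> carrier_mat r r" by (rule mat_prod_carrier[OF tau_mat_carrier])
    have tau: "dual_tau \<phi> h (monom 1 j) = (\<Sum>l<r. tau_mat 0 $$ (j, l) * frob_Kt (h (monom 1 l)))"
      if "j < r" for j
      using dual_tau_monom[OF Suc.prems(2) that] by (simp add: tau_mat_def)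
    \<comment> \<open>Peeling off the innermost application twists its matrix n times and puts it
      last in the product.\<close>
    have "(dual_tau \<phi> ^^ Suc n) h (monom 1 i) = (dual_tau \<phi> ^^ n) (dual_tau \<phi> h) (monom 1 i)"
      by (simp add: funpow_swap1)
    also have "\<dots> = (\<Sum>j<r. ?P $$ (i, j) * (frob_Kt ^^ n) (dual_tau \<phi> h (monom 1 j)))"
      using Suc by (intro Suc.IH dual_tau_mem)
    also have "\<dots> = (\<Sum>j<r. \<Sum>l<r. (?P $$ (i, j) * tau_mat n $$ (j, l)) * (frob_Kt ^^ Suc n) (h (monom 1 l)))"
      by (intro sum.cong refl) (simp add: tau frob_Kt_funpow_hom.hom_sum frob_Kt_funpow_hom.hom_mult
          frob_tau_mat funpow_swap1 sum_distrib_left mult.assoc)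
    also have "\<dots> = (\<Sum>l<r. (\<Sum>j<r. ?P $$ (i, j) * tau_mat n $$ (j, l)) * (frob_Kt ^^ Suc n) (h (monom 1 l)))"
      unfolding sum_distrib_right by (rule sum.swap)
    also have "\<dots> = (\<Sum>l<r. mat_prod r tau_mat [0..<Suc n] $$ (i, l) * (frob_Kt ^^ Suc n) (h (monom 1 l)))"
      using Suc.prems(1) tau_mat_carrier[of n] P
      by (intro sum.cong refl) (simp add: mat_prod_snoc[OF tau_mat_carrier] scalar_prod_def atLeast0LessThan)
    finally show ?case .
  qed
qed

lemma t_theta_Kt_eq: "t_theta_Kt = emb_AR t_theta"
proof -
  have "t_theta_Kt = to_fract [:- gK 0, 1:]"
    unfolding t_theta_Kt_def t_Kt_def kc_def by (subst to_fract_diff[symmetric]) simp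
  then show ?thesis
    by (simp add: t_theta_def emb_AR_def gK_def g_0 to_fract_hom.map_poly_pCons_hom flip: to_fract_uminus)
qed

text \<open>Twisting n times and reducing at index 0 amounts to reducing at index n, so the twisted
  matrices reduce to the companion matrices of the cyclic system.\<close>

lemma tau_mat_entry:
  shows "(frob_Kt ^^ n) (kc (gK (Suc i)) / t_theta_Kt) \<in> loc_ring q"
    and "\<psi> 0 ((frob_Kt ^^ n) (kc (gK (Suc i)) / t_theta_Kt)) = hE n i"
proof -
  have x: "kc (gK (Suc i)) / t_theta_Kt = emb_AR [:g (Suc i):] / emb_AR t_theta"
    by (simp add: gK_def kc_to_fract t_theta_Kt_eq)
  note mem = emb_AR_divide[OF t_theta_unit, where a = "[:g (Suc i):]"]
  have "ev n [:g (Suc i):] = [:eval_at (conj n) (g (Suc i)):]"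
    by (simp add: ev_def eval_at_hom.map_poly_pCons_hom)
  then show "(frob_Kt ^^ n) (kc (gK (Suc i)) / t_theta_Kt) \<in> loc_ring q"
    "\<psi> 0 ((frob_Kt ^^ n) (kc (gK (Suc i)) / t_theta_Kt)) = hE n i"
    unfolding x using frob_Kt_funpow_loc[OF mem(1), of n 0] mem(2)[of n]
    by (simp_all add: hE_def kE_def \<theta>E_def ev_t_theta)
qed

lemma tau_mat_mem: "i < r \<Longrightarrow> j < r \<Longrightarrow> tau_mat n $$ (i, j) \<in> loc_ring q"
  using tau_mat_entry(1)[of n j] by (auto simp: tau_mat_def companion_def loc.one_mem loc.zero_mem)

lemma \<psi>_tau_mat: "map_mat (\<psi> 0) (tau_mat n) = companion r (hE n)"
  by (rule eq_matI) (auto simp: tau_mat_def companion_def tau_mat_entry(2) loc.hom_one loc.hom_zero)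

definition tau_power_mat :: "'f Kt mat" where "tau_power_mat = mat_prod r tau_mat [0..<d]"
definition frob_mat :: "'f Et mat" where "frob_mat = mat_prod r (\<lambda>k. companion r (hE k)) [0..<d]"

lemma tau_power_mat_carrier: "tau_power_mat \<in> carrier_mat r r" and frob_mat_carrier: "frob_mat \<in> carrier_mat r r"
  unfolding tau_power_mat_def frob_mat_def by (intro mat_prod_carrier tau_mat_carrier companion_carrier)+

lemma tau_power_mat_mem: "i < r \<Longrightarrow> j < r \<Longrightarrow> tau_power_mat $$ (i, j) \<in> loc_ring q"
  and \<psi>_tau_power_mat: "i < r \<Longrightarrow> j < r \<Longrightarrow> \<psi> 0 (tau_power_mat $$ (i, j)) = frob_mat $$ (i, j)"
proof -
  have *: "(\<forall>i<r. \<forall>j<r. tau_power_mat $$ (i, j) \<in> loc_ring q) \<and> map_mat (\<psi> 0) tau_power_mat = frob_mat"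
    unfolding tau_power_mat_def frob_mat_def \<psi>_tau_mat[symmetric] by (intro loc.mat_prod_hom tau_mat_carrier tau_mat_mem)
  then show "i < r \<Longrightarrow> j < r \<Longrightarrow> tau_power_mat $$ (i, j) \<in> loc_ring q" by blast
  assume ij: "i < r" "j < r"
  then have "\<psi> 0 (tau_power_mat $$ (i, j)) = map_mat (\<psi> 0) tau_power_mat $$ (i, j)" using tau_power_mat_carrier by simp
  then show "\<psi> 0 (tau_power_mat $$ (i, j)) = frob_mat $$ (i, j)" using * by simp
qed

lemma frob_det_eq: "frob_det = det (1\<^sub>m r - monom 1 d \<cdot>\<^sub>m map_mat (\<lambda>c. [:c:]) frob_mat)"
proof -
  have c: "comm_ring_hom (\<lambda>c :: 'f Et. [:c:])" by unfold_locales
  have "map_mat (\<lambda>c. [:c:]) (companion r (hE k)) = companion r (\<lambda>i. [:hE k i:])" for k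
    by (rule eq_matI) (auto simp: companion_def)
  then show ?thesis
    by (simp add: frob_det_def frob_mat_def map_mat_mat_prod[OF c])
qed

text \<open>\<open>frob_det\<close> arises from a determinant in T by substituting T^d for T, and at
  T = 0 the matrix is the identity.\<close>

lemma coeff_frob_det:
  shows "coeff frob_det 0 = 1" and "0 < n \<Longrightarrow> n < d \<Longrightarrow> coeff frob_det n = 0"
proof -
  define B where "B = 1\<^sub>m r - monom 1 1 \<cdot>\<^sub>m map_mat (\<lambda>c. [:c:]) frob_mat"
  have "map_mat (\<lambda>p. p \<circ>\<^sub>p monom 1 d) B = 1\<^sub>m r - monom 1 d \<cdot>\<^sub>m map_mat (\<lambda>c. [:c:]) frob_mat"
    using frob_mat_carrier
    by (intro eq_matI) (auto simp: B_def pcompose_diff pcompose_mult pcompose_smult pcompose_pCons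
        pcompose_1 monom_altdef smult_monom)
  then have eq: "frob_det = det B \<circ>\<^sub>p monom 1 d"
    unfolding frob_det_eq using comm_ring_hom.hom_det[OF pcompose_hom.comm_ring_hom_axioms] by metis
  have "map_mat (\<lambda>p. poly p 0) B = 1\<^sub>m r"
    using frob_mat_carrier by (intro eq_matI) (auto simp: B_def poly_monom)
  then have 0: "poly (det B) 0 = 1"
    using comm_ring_hom.hom_det[OF poly_hom.comm_ring_hom_axioms, of 0 B] by simp
  obtain c u where cu: "det B = pCons c u" by (cases "det B")
  then have "c = 1" using 0 by simp
  then have fd: "frob_det = 1 + monom 1 d * (u \<circ>\<^sub>p monom 1 d)"
    by (simp add: eq cu pcompose_pCons)
  show "coeff frob_det 0 = 1"
    using d_pos by (simp add: fd coeff_monom_mult)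
  show "coeff frob_det n = 0" if "0 < n" "n < d"
    using that by (simp add: fd coeff_monom_mult)
qed

section \<open>The localized model and its reduction\<close>

abbreviation L where "L \<equiv> loc_model fun_smul (anderson_model \<phi>) q"

lemma prod_unit: "(\<And>i. i \<in> I \<Longrightarrow> s i \<in> units_at q) \<Longrightarrow> prod s I \<in> units_at q"
  by (induction I rule: infinite_finite_induct) (auto intro: one_unit mult_unit)

text \<open>The r coordinates have a common denominator: the product of their separate ones.\<close>

lemma loc_model_iff: "h \<in> L \<longleftrightarrow> h \<in> motive_dual \<phi> \<and> (\<forall>j<r. h (monom 1 j) \<in> loc_ring q)"
proof
  assume "h \<in> L"
  then obtain s where s: "s \<in> units_at q" "fun_smul (emb_AR s) h \<in> motive_dual \<phi>"
    "\<And>j. j < r \<Longrightarrow> emb_AR s * h (monom 1 j) \<in> range emb_AR"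
    by (auto simp: loc_model_def anderson_model_iff fun_smul_def)
  have "h = fun_smul (inverse (emb_AR s)) (fun_smul (emb_AR s) h)"
    using unit_nz[OF s(1)] by (simp add: fun_smul_def fun_eq_iff)
  then have "h \<in> motive_dual \<phi>" using dual_fun_smul[OF s(2)] by metis
  with s show "h \<in> motive_dual \<phi> \<and> (\<forall>j<r. h (monom 1 j) \<in> loc_ring q)"
    unfolding loc_ring_def by blast
next
  assume h: "h \<in> motive_dual \<phi> \<and> (\<forall>j<r. h (monom 1 j) \<in> loc_ring q)"
  have "\<exists>s a. s \<in> units_at q \<and> emb_AR s * h (monom 1 j) = emb_AR a" if "j < r" for j
    using loc_ringE[of "h (monom 1 j)"] h that by metis
  then obtain s a where sa: "\<And>j. j < r \<Longrightarrow> s j \<in> units_at q \<and> emb_AR (s j) * h (monom 1 j) = emb_AR (a j)"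
    by metis
  define S where "S = (\<Prod>j<r. s j)"
  have "emb_AR S * h (monom 1 j) \<in> range emb_AR" if "j < r" for j
  proof -
    have "S = s j * (\<Prod>k\<in>{..<r} - {j}. s k)"
      unfolding S_def using that by (intro prod.remove) auto
    then have "emb_AR S * h (monom 1 j) = emb_AR (\<Prod>k\<in>{..<r} - {j}. s k) * (emb_AR (s j) * h (monom 1 j))"
      by (simp add: emb_AR_hom.hom_mult)
    also have "\<dots> = emb_AR ((\<Prod>k\<in>{..<r} - {j}. s k) * a j)"
      using sa that by (simp add: emb_AR_hom.hom_mult)
    finally show ?thesis by blast
  qed
  then have "fun_smul (emb_AR S) h \<in> anderson_model \<phi>"
    using h by (simp add: anderson_model_iff dual_fun_smul) (simp add: fun_smul_def)
  moreover have "S \<in> units_at q" unfolding S_def using sa by (intro prod_unit) auto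
  ultimately show "h \<in> L" by (auto simp: loc_model_def)
qed

lemma dual_minus: "h \<in> motive_dual \<phi> \<Longrightarrow> h' \<in> motive_dual \<phi> \<Longrightarrow> h - h' \<in> motive_dual \<phi>"
  by (simp add: motive_dual_def algebra_simps fun_diff_def)

text \<open>Dividing a functional by q(\<theta>) stays in the dual and divides each coordinate, so
  divisibility is a condition on coordinates, given by the kernel of
  \<open>\<psi> 0\<close>.\<close>

lemma q_L_iff:
  assumes "h \<in> L"
  shows "h \<in> fun_smul (emb_AR [:q:]) ` L \<longleftrightarrow> (\<forall>j<r. \<psi> 0 (h (monom 1 j)) = 0)"
proof
  assume "h \<in> fun_smul (emb_AR [:q:]) ` L"
  then obtain h' where "h = fun_smul (emb_AR [:q:]) h'" "h' \<in> L" by blast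
  then show "\<forall>j<r. \<psi> 0 (h (monom 1 j)) = 0"
    using assms by (auto simp: loc_model_iff \<psi>_eq_0_iff fun_smul_def)
next
  assume 0: "\<forall>j<r. \<psi> 0 (h (monom 1 j)) = 0"
  define h' where "h' = fun_smul (inverse (emb_AR [:q:])) h"
  have nz: "emb_AR [:q:] \<noteq> 0" using q_nz by simp
  have "h' (monom 1 j) \<in> loc_ring q" if "j < r" for j
  proof -
    have "h (monom 1 j) \<in> (*) (emb_AR [:q:]) ` loc_ring q"
      using 0 that assms \<psi>_eq_0_iff[of "h (monom 1 j)" 0] by (simp add: loc_model_iff)
    then obtain y where "h (monom 1 j) = emb_AR [:q:] * y" "y \<in> loc_ring q" by blast
    then show ?thesis using nz by (simp add: h'_def fun_smul_def flip: mult.assoc)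
  qed
  then have "h' \<in> L" using assms by (simp add: loc_model_iff h'_def dual_fun_smul)
  moreover have "h = fun_smul (emb_AR [:q:]) h'" using nz by (simp add: h'_def fun_smul_def fun_eq_iff flip: mult.assoc)
  ultimately show "h \<in> fun_smul (emb_AR [:q:]) ` L" by blast
qed

lemma q_L_sub: "fun_smul (emb_AR [:q:]) ` L \<subseteq> L"
  by (auto simp: loc_model_iff dual_fun_smul) (auto simp: fun_smul_def intro: loc.mult_mem emb_AR_mem)

definition S where "S = polys_over (loc_ring q)"
definition J where "J = polys_over ((*) (emb_AR [:q:]) ` loc_ring q)"
definition loc_polys where "loc_polys = polys_over L"
definition q_loc_polys where "q_loc_polys = polys_over (fun_smul (emb_AR [:q:]) ` L)"
definition \<Psi> :: "'f Kt poly \<Rightarrow> 'f Et poly" where "\<Psi> = map_poly (\<psi> 0)"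
definition one_minus_tau where "one_minus_tau v = v - poly_smul fun_smul (monom 1 d) (map_poly (dual_tau \<phi> ^^ d) v)"

lemma coeff_\<Psi> [simp]: "coeff (\<Psi> p) n = \<psi> 0 (coeff p n)"
  by (simp add: \<Psi>_def coeff_map_poly loc.hom_zero)

sublocale S: subring_hom S \<Psi>
  unfolding S_def \<Psi>_def by (rule subring_hom_polys_over[OF subring_hom_\<psi>])

lemma J_eq: "J = {a \<in> S. \<Psi> a = 0}"
proof -
  have "x \<in> (*) (emb_AR [:q:]) ` loc_ring q \<longleftrightarrow> x \<in> loc_ring q \<and> \<psi> 0 x = 0" for x
    using \<psi>_eq_0_iff[of x 0] by (auto intro: loc.mult_mem emb_AR_mem)
  then show ?thesis by (auto simp: J_def S_def polys_over_def poly_eq_iff)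
qed

lemma loc_polys_iff: "v \<in> loc_polys \<longleftrightarrow> (\<forall>n. coeff v n \<in> motive_dual \<phi>) \<and> (\<forall>j<r. co j v \<in> S)"
  by (auto simp: loc_polys_def S_def polys_over_def loc_model_iff)

lemma co_mem: "v \<in> loc_polys \<Longrightarrow> j < r \<Longrightarrow> co j v \<in> S"
  by (simp add: loc_polys_iff)

lemma q_loc_polys_iff: "v \<in> q_loc_polys \<longleftrightarrow> v \<in> loc_polys \<and> (\<forall>j<r. \<Psi> (co j v) = 0)"
proof -
  have "h \<in> fun_smul (emb_AR [:q:]) ` L \<longleftrightarrow> h \<in> L \<and> (\<forall>j<r. \<psi> 0 (h (monom 1 j)) = 0)" for h
    using q_L_iff[of h] q_L_sub by blast
  then show ?thesis by (auto simp: q_loc_polys_def loc_polys_def polys_over_def poly_eq_iff)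
qed

lemma poly_smul_loc_polys: "p \<in> S \<Longrightarrow> v \<in> loc_polys \<Longrightarrow> poly_smul fun_smul p v \<in> loc_polys"
  by (auto simp: loc_polys_iff eval_coeffs_poly_smul intro: coeff_poly_smul_dual S.mult_mem)

lemma diff_loc_polys: "v \<in> loc_polys \<Longrightarrow> w \<in> loc_polys \<Longrightarrow> v - w \<in> loc_polys"
  by (auto simp: loc_polys_iff eval_coeffs_diff intro: dual_minus S.diff_mem)

lemma add_loc_polys: "v \<in> loc_polys \<Longrightarrow> w \<in> loc_polys \<Longrightarrow> v + w \<in> loc_polys"
  by (auto simp: loc_polys_iff eval_coeffs_add intro: dual_plus S.add_mem)

lemma monom_S: "c \<in> loc_ring q \<Longrightarrow> monom c n \<in> S"
  by (auto simp: S_def polys_over_def loc.zero_mem)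

lemma \<Psi>_monom: "\<Psi> (monom c n) = monom (\<psi> 0 c) n"
  by (intro poly_eqI) (simp add: loc.hom_zero)

lemma dual_tau_funpow_add:
  assumes "h \<in> motive_dual \<phi>" "h' \<in> motive_dual \<phi>"
  shows "(dual_tau \<phi> ^^ n) (h + h') = (dual_tau \<phi> ^^ n) h + (dual_tau \<phi> ^^ n) h'"
  using assms
  by (intro dual_eqI) (simp_all add: dual_tau_funpow dual_plus frob_Kt_funpow_hom.hom_add
      distrib_left sum.distrib)

text \<open>Needed because \<open>map_poly\<close> acts on all coefficients only if the map fixes
  0.\<close>

lemma dual_tau_funpow_zero: "(dual_tau \<phi> ^^ n) 0 = 0"
  using dual_tau_funpow_add[OF dual_zero dual_zero, of n] by simp

lemma coeff_map_tau: "coeff (map_poly (dual_tau \<phi> ^^ n) v) m = (dual_tau \<phi> ^^ n) (coeff v m)"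
  by (simp add: coeff_map_poly dual_tau_funpow_zero)

text \<open>In coordinates \<tau>^d is a matrix applied to the d-fold Frobenius of the coordinates,
  and the reduction at index 0 does not see that Frobenius.\<close>

lemma tau_coord:
  assumes "h \<in> L" "j < r"
  shows "(dual_tau \<phi> ^^ d) h (monom 1 j) \<in> loc_ring q"
    and "\<psi> 0 ((dual_tau \<phi> ^^ d) h (monom 1 j)) = (\<Sum>l<r. frob_mat $$ (j, l) * \<psi> 0 (h (monom 1 l)))"
proof -
  have h: "h \<in> motive_dual \<phi>" "\<And>l. l < r \<Longrightarrow> h (monom 1 l) \<in> loc_ring q"
    using assms by (auto simp: loc_model_iff)
  have F: "(frob_Kt ^^ d) (h (monom 1 l)) \<in> loc_ring q"
    "\<psi> 0 ((frob_Kt ^^ d) (h (monom 1 l))) = \<psi> 0 (h (monom 1 l))" if "l < r" for l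
    using frob_Kt_funpow_loc[OF h(2)[OF that], of d 0] \<psi>_degree[of 0] by (simp_all add: d_def)
  have eq: "(dual_tau \<phi> ^^ d) h (monom 1 j) = (\<Sum>l<r. tau_power_mat $$ (j, l) * (frob_Kt ^^ d) (h (monom 1 l)))"
    using dual_tau_funpow(2)[OF h(1) assms(2), of d] by (simp add: tau_power_mat_def)
  show "(dual_tau \<phi> ^^ d) h (monom 1 j) \<in> loc_ring q"
    unfolding eq using F tau_power_mat_mem assms by (intro loc.sum_mem loc.mult_mem) auto
  have "\<psi> 0 ((dual_tau \<phi> ^^ d) h (monom 1 j)) = (\<Sum>l<r. \<psi> 0 (tau_power_mat $$ (j, l) * (frob_Kt ^^ d) (h (monom 1 l))))"
    unfolding eq using F tau_power_mat_mem assms by (intro loc.hom_sum loc.mult_mem) auto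
  also have "\<dots> = (\<Sum>l<r. frob_mat $$ (j, l) * \<psi> 0 (h (monom 1 l)))"
    using F tau_power_mat_mem \<psi>_tau_power_mat assms by (intro sum.cong refl) (simp add: loc.hom_mult)
  finally show "\<psi> 0 ((dual_tau \<phi> ^^ d) h (monom 1 j)) = (\<Sum>l<r. frob_mat $$ (j, l) * \<psi> 0 (h (monom 1 l)))" .
qed

lemma map_tau_loc_polys:
  assumes "v \<in> loc_polys"
  shows "map_poly (dual_tau \<phi> ^^ d) v \<in> loc_polys"
    and "j < r \<Longrightarrow> \<Psi> (co j (map_poly (dual_tau \<phi> ^^ d) v)) = (\<Sum>l<r. [:frob_mat $$ (j, l):] * \<Psi> (co l v))"
proof -
  have L: "coeff v n \<in> L" for n using assms by (simp add: loc_polys_def polys_over_def)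
  show "map_poly (dual_tau \<phi> ^^ d) v \<in> loc_polys"
    using L tau_coord(1)[OF L] dual_tau_funpow(1)
    by (auto simp: loc_polys_def polys_over_def coeff_map_tau loc_model_iff)
  show "j < r \<Longrightarrow> \<Psi> (co j (map_poly (dual_tau \<phi> ^^ d) v)) = (\<Sum>l<r. [:frob_mat $$ (j, l):] * \<Psi> (co l v))"
    by (intro poly_eqI) (simp add: coeff_map_tau tau_coord(2)[OF L] coeff_sum)
qed

lemma one_minus_tau_loc_polys:
  assumes "v \<in> loc_polys"
  shows "one_minus_tau v \<in> loc_polys"
    and "j < r \<Longrightarrow> \<Psi> (co j (one_minus_tau v)) = \<Psi> (co j v) - monom 1 d * (\<Sum>l<r. [:frob_mat $$ (j, l):] * \<Psi> (co l v))"
proof -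
  have T: "monom 1 d \<in> S" by (rule monom_S[OF loc.one_mem])
  note tau = map_tau_loc_polys[OF assms]
  have smul: "poly_smul fun_smul (monom 1 d) (map_poly (dual_tau \<phi> ^^ d) v) \<in> loc_polys"
    using T tau(1) by (rule poly_smul_loc_polys)
  show "one_minus_tau v \<in> loc_polys" unfolding one_minus_tau_def using assms smul by (rule diff_loc_polys)
  assume j: "j < r"
  have S: "co j v \<in> S" "co j (map_poly (dual_tau \<phi> ^^ d) v) \<in> S"
    using assms tau(1) j by (auto simp: loc_polys_iff)
  then show "\<Psi> (co j (one_minus_tau v)) = \<Psi> (co j v) - monom 1 d * (\<Sum>l<r. [:frob_mat $$ (j, l):] * \<Psi> (co l v))"
    unfolding one_minus_tau_def eval_coeffs_diff eval_coeffs_poly_smul tau(2)[OF j, symmetric]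
    using T by (simp add: S.hom_diff S.hom_mult S.mult_mem \<Psi>_monom loc.hom_one)
qed

lemma one_minus_tau_add:
  assumes "v \<in> loc_polys" "w \<in> loc_polys"
  shows "one_minus_tau (v + w) = one_minus_tau v + one_minus_tau w"
proof -
  have "map_poly (dual_tau \<phi> ^^ d) (v + w) = map_poly (dual_tau \<phi> ^^ d) v + map_poly (dual_tau \<phi> ^^ d) w"
    using assms by (intro poly_eqI) (simp add: coeff_map_tau dual_tau_funpow_add loc_polys_iff)
  then show ?thesis
    by (intro eval_coeffs_eqI)
      (simp add: one_minus_tau_def eval_coeffs_diff eval_coeffs_add eval_coeffs_poly_smul algebra_simps)
qed

lemma \<Psi>_co_smul:
  assumes "p \<in> S" "v \<in> loc_polys" "j < r"
  shows "\<Psi> (co j (poly_smul fun_smul p v)) = \<Psi> p * \<Psi> (co j v)"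
  using assms by (simp add: eval_coeffs_poly_smul S.hom_mult loc_polys_iff)

lemma quot_module_model: "quot_module S \<Psi> J (poly_smul fun_smul) loc_polys q_loc_polys one_minus_tau"
proof unfold_locales
  show "J = {a \<in> S. \<Psi> a = 0}" by (rule J_eq)
  show zero: "0 \<in> loc_polys" by (auto simp: loc_polys_iff dual_zero eval_coeffs_def S.zero_mem)
  show "x + y \<in> loc_polys" if "x \<in> loc_polys" "y \<in> loc_polys" for x y using that by (rule add_loc_polys)
  show "poly_smul fun_smul c x \<in> loc_polys" if "c \<in> S" "x \<in> loc_polys" for c x using that by (rule poly_smul_loc_polys)
  show "0 \<in> q_loc_polys" using zero by (simp add: q_loc_polys_iff eval_coeffs_def S.hom_zero)
  show "x - y \<in> q_loc_polys" if "x \<in> q_loc_polys" "y \<in> q_loc_polys" for x y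
    using that by (auto simp: q_loc_polys_iff diff_loc_polys eval_coeffs_diff S.hom_diff co_mem)
  show "poly_smul fun_smul c x \<in> q_loc_polys" if "c \<in> S" "x \<in> q_loc_polys" for c x
    using that by (auto simp: q_loc_polys_iff poly_smul_loc_polys \<Psi>_co_smul)
  show "poly_smul fun_smul (c + e) x = poly_smul fun_smul c x + poly_smul fun_smul e x" for c e x
    by (intro eval_coeffs_eqI) (simp add: eval_coeffs_poly_smul eval_coeffs_add algebra_simps)
  show "poly_smul fun_smul c (x + y) = poly_smul fun_smul c x + poly_smul fun_smul c y" for c x y
    by (intro eval_coeffs_eqI) (simp add: eval_coeffs_poly_smul eval_coeffs_add algebra_simps)
  show "poly_smul fun_smul (c * e) x = poly_smul fun_smul c (poly_smul fun_smul e x)" for c e x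
    by (intro eval_coeffs_eqI) (simp add: eval_coeffs_poly_smul mult.assoc)
  show "poly_smul fun_smul 1 x = x" for x
    by (intro eval_coeffs_eqI) (simp add: eval_coeffs_poly_smul)
  show "one_minus_tau (x + y) = one_minus_tau x + one_minus_tau y" if "x \<in> loc_polys" "y \<in> loc_polys" for x y using that by (rule one_minus_tau_add)
  show ffm: "one_minus_tau x \<in> loc_polys" if "x \<in> loc_polys" for x using that by (rule one_minus_tau_loc_polys)
  show "one_minus_tau x \<in> q_loc_polys" if "x \<in> q_loc_polys" for x
    using that by (auto simp: q_loc_polys_iff one_minus_tau_loc_polys)
  show "one_minus_tau (poly_smul fun_smul c x) - poly_smul fun_smul c (one_minus_tau x) \<in> q_loc_polys" if "c \<in> S" "x \<in> loc_polys" for c x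
    unfolding q_loc_polys_iff
  proof (intro conjI allI impI)
    show "one_minus_tau (poly_smul fun_smul c x) - poly_smul fun_smul c (one_minus_tau x) \<in> loc_polys"
      using that by (intro diff_loc_polys ffm poly_smul_loc_polys)
    fix j assume j: "j < r"
    \<comment> \<open>After reduction \<tau>^d is the plain matrix \<open>frob_mat\<close>, which
      commutes with the scalar \<open>\<Psi> c\<close>.\<close>
    have "\<Psi> (co j (one_minus_tau (poly_smul fun_smul c x))) = \<Psi> (co j (poly_smul fun_smul c (one_minus_tau x)))"
      using that j ffm by (simp add: one_minus_tau_loc_polys(2) poly_smul_loc_polys \<Psi>_co_smul right_diff_distrib
          sum_distrib_left mult.left_commute del: mult_pCons_left)
    moreover have "co j (one_minus_tau (poly_smul fun_smul c x)) \<in> S" "co j (poly_smul fun_smul c (one_minus_tau x)) \<in> S"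
      using that j ffm[OF poly_smul_loc_polys[OF that]] poly_smul_loc_polys[OF that(1) ffm[OF that(2)]]
      by (auto simp: loc_polys_iff)
    ultimately show "\<Psi> (co j (one_minus_tau (poly_smul fun_smul c x) - poly_smul fun_smul c (one_minus_tau x))) = 0"
      by (simp add: eval_coeffs_diff S.hom_diff)
  qed
qed

sublocale model: quot_module S \<Psi> J "poly_smul fun_smul" loc_polys q_loc_polys one_minus_tau
  by (rule quot_module_model)

section \<open>The determinant computed in the dual basis\<close>

definition u_basis where "u_basis = map (\<lambda>i. [:dual_basis \<phi> i:]) [0..<r]"

lemma length_u_basis [simp]: "length u_basis = r"
  by (simp add: u_basis_def)

lemma nth_u_basis: "i < r \<Longrightarrow> u_basis ! i = [:dual_basis \<phi> i:]"
  by (simp add: u_basis_def)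

lemma co_dual_basis: "i < r \<Longrightarrow> j < r \<Longrightarrow> co j [:dual_basis \<phi> i:] = (if i = j then 1 else 0)"
  by (intro poly_eqI) (auto simp: coeff_pCons dual_basis coeff_1 split: nat.splits)

lemma dual_basis_loc_polys: "i < r \<Longrightarrow> [:dual_basis \<phi> i:] \<in> loc_polys"
  by (auto simp: loc_polys_iff co_dual_basis S.one_mem S.zero_mem coeff_pCons dual_basis dual_zero split: nat.splits)

lemma co_sum: "co j (sum f I) = (\<Sum>i\<in>I. co j (f i))"
proof (induction I rule: infinite_finite_induct)
  case (insert i I)
  then show ?case by (simp add: eval_coeffs_add)
qed (simp_all add: eval_coeffs_def)

lemma co_comb:
  assumes "j < r"
  shows "co j (\<Sum>i<r. poly_smul fun_smul (c i) (u_basis ! i)) = c j"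
proof -
  have "co j (\<Sum>i<r. poly_smul fun_smul (c i) (u_basis ! i)) = (\<Sum>i<r. if i = j then c j else 0)"
    unfolding co_sum using assms by (intro sum.cong) (auto simp: eval_coeffs_poly_smul co_dual_basis nth_u_basis)
  then show ?thesis using assms by simp
qed

lemma comb_loc_polys:
  assumes "\<And>i. i < r \<Longrightarrow> c i \<in> S"
  shows "(\<Sum>i<r. poly_smul fun_smul (c i) (u_basis ! i)) \<in> loc_polys"
  using assms by (intro model.M_sum poly_smul_loc_polys) (auto simp: dual_basis_loc_polys nth_u_basis)

lemma quot_basis_u: "quot_basis S J (poly_smul fun_smul) loc_polys q_loc_polys u_basis"
  unfolding quot_basis_def length_u_basis
proof (intro conjI ballI allI impI)
  show "set u_basis \<subseteq> loc_polys" by (auto simp: u_basis_def dual_basis_loc_polys)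
next
  fix m assume m: "m \<in> loc_polys"
  then have S: "\<And>i. i < r \<Longrightarrow> co i m \<in> S" by (simp add: loc_polys_iff)
  have "m - (\<Sum>i<r. poly_smul fun_smul (co i m) (u_basis ! i)) \<in> q_loc_polys"
    unfolding q_loc_polys_iff using m S
    by (auto intro!: diff_loc_polys comb_loc_polys simp: eval_coeffs_diff co_comb S.hom_zero)
  with S show "\<exists>c. (\<forall>i<r. c i \<in> S) \<and> m - (\<Sum>i<r. poly_smul fun_smul (c i) (u_basis ! i)) \<in> q_loc_polys"
    by (intro exI[of _ "\<lambda>i. co i m"]) auto
next
  fix c i assume c: "(\<forall>i<r. c i \<in> S) \<and> (\<Sum>i<r. poly_smul fun_smul (c i) (u_basis ! i)) \<in> q_loc_polys" and i: "i < r"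
  then have "\<Psi> (co i (\<Sum>i<r. poly_smul fun_smul (c i) (u_basis ! i))) = 0"
    unfolding q_loc_polys_iff by blast
  then have "\<Psi> (c i) = 0" unfolding co_comb[OF i] .
  then show "c i \<in> J" using c i by (simp add: J_eq)
qed

text \<open>A lift of the reduced matrix of 1 - T^d \<tau>^d: \<open>is_quot_det\<close> asks for
  entries in \<open>S\<close>, before reduction.\<close>

definition model_mat :: "'f Kt poly mat" where
  "model_mat = 1\<^sub>m r - monom 1 d \<cdot>\<^sub>m map_mat (\<lambda>c. [:c:]) tau_power_mat"

lemma model_mat_carrier: "model_mat \<in> carrier_mat r r"
  using tau_power_mat_carrier by (simp add: model_mat_def minus_carrier_mat)

lemma model_mat_entry: "i < r \<Longrightarrow> j < r \<Longrightarrow> model_mat $$ (i, j) = (if i = j then 1 else 0) - monom (tau_power_mat $$ (i, j)) d"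
  using tau_power_mat_carrier by (simp add: model_mat_def monom_times_const del: mult_pCons_right)

lemma model_mat_mem: "i < r \<Longrightarrow> j < r \<Longrightarrow> model_mat $$ (i, j) \<in> S"
  unfolding model_mat_entry by (intro S.diff_mem monom_S tau_power_mat_mem) (simp_all add: S.one_mem S.zero_mem)

lemma \<Psi>_model_mat: "i < r \<Longrightarrow> j < r \<Longrightarrow> \<Psi> (model_mat $$ (i, j)) = (if i = j then 1 else 0) - monom (frob_mat $$ (i, j)) d"
  by (simp add: model_mat_entry S.hom_diff S.one_mem S.zero_mem monom_S tau_power_mat_mem S.hom_one S.hom_zero \<Psi>_monom \<psi>_tau_power_mat)

lemma elements_model_mat: "elements_mat model_mat \<subseteq> S"
  using model_mat_mem model_mat_carrier by (auto simp: elements_mat_def)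

lemma \<Psi>_det_model_mat: "\<Psi> (det model_mat) = frob_det"
proof -
  have "map_mat \<Psi> model_mat = 1\<^sub>m r - monom 1 d \<cdot>\<^sub>m map_mat (\<lambda>c. [:c:]) frob_mat"
    using model_mat_carrier frob_mat_carrier by (intro eq_matI) (auto simp: \<Psi>_model_mat monom_times_const simp del: mult_pCons_right)
  then show ?thesis using S.hom_det[OF model_mat_carrier elements_model_mat] by (simp add: frob_det_eq)
qed

lemma one_minus_tau_u_basis:
  assumes j: "j < r"
  shows "one_minus_tau (u_basis ! j) - (\<Sum>i<r. poly_smul fun_smul (model_mat $$ (i, j)) (u_basis ! i)) \<in> q_loc_polys"
proof -
  have one_minus_tau: "one_minus_tau (u_basis ! j) \<in> loc_polys" using j by (simp add: one_minus_tau_loc_polys dual_basis_loc_polys nth_u_basis)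
  have X: "\<And>i. i < r \<Longrightarrow> model_mat $$ (i, j) \<in> S" using j by (simp add: model_mat_mem)
  have "\<Psi> (co i (one_minus_tau (u_basis ! j))) = \<Psi> (model_mat $$ (i, j))" if i: "i < r" for i
  proof -
    have "(\<Sum>l<r. [:frob_mat $$ (i, l):] * \<Psi> (co l (u_basis ! j))) = (\<Sum>l<r. if l = j then [:frob_mat $$ (i, j):] else 0)"
      using j by (intro sum.cong) (auto simp: co_dual_basis S.hom_one S.hom_zero nth_u_basis)
    then have "(\<Sum>l<r. [:frob_mat $$ (i, l):] * \<Psi> (co l (u_basis ! j))) = [:frob_mat $$ (i, j):]"
      using j by simp
    then have "\<Psi> (co i (one_minus_tau (u_basis ! j))) = \<Psi> (co i (u_basis ! j)) - monom 1 d * [:frob_mat $$ (i, j):]"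
      using i j by (simp add: one_minus_tau_loc_polys(2) dual_basis_loc_polys nth_u_basis del: mult_pCons_right)
    then show ?thesis
      using i j
      by (auto simp: co_dual_basis S.hom_one S.hom_zero \<Psi>_model_mat nth_u_basis monom_times_const
          simp del: mult_pCons_right)
  qed
  then show ?thesis
    using one_minus_tau X by (auto simp: q_loc_polys_iff eval_coeffs_diff co_comb S.hom_diff co_mem
        intro!: diff_loc_polys comb_loc_polys)
qed

lemma is_model_det_iff_quot:
  "is_model_det fun_smul (dual_tau \<phi>) (anderson_model \<phi>) q \<delta> \<longleftrightarrow>
    is_quot_det S J (poly_smul fun_smul) loc_polys q_loc_polys one_minus_tau \<delta>"
  by (simp add: is_model_det_def S_def J_def loc_polys_def q_loc_polys_def one_minus_tau_def[abs_def] d_def)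

text \<open>As \<open>J\<close> is the kernel of \<open>\<Psi>\<close>, a determinant modulo
  \<open>J\<close> is known by its image. The dual basis gives the value, and
  \<open>quot_det_unique\<close> frees it from the choice of basis.\<close>

lemma is_model_det_iff:
  assumes "\<delta> \<in> S"
  shows "is_model_det fun_smul (dual_tau \<phi>) (anderson_model \<phi>) q \<delta> \<longleftrightarrow> \<Psi> \<delta> = frob_det"
proof -
  have intro: "is_quot_det S J (poly_smul fun_smul) loc_polys q_loc_polys one_minus_tau \<delta>" if "\<delta> \<in> S" "\<Psi> \<delta> = frob_det" for \<delta>
    unfolding is_quot_det_def using that quot_basis_u model_mat_carrier elements_model_mat one_minus_tau_u_basis
      S.det_mem[OF model_mat_carrier elements_model_mat]
    by (intro conjI exI[of _ u_basis] exI[of _ model_mat]) (auto simp: J_eq S.hom_diff \<Psi>_det_model_mat S.diff_mem)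
  have "is_quot_det S J (poly_smul fun_smul) loc_polys q_loc_polys one_minus_tau (det model_mat)"
    by (intro intro S.det_mem[OF model_mat_carrier elements_model_mat] \<Psi>_det_model_mat)
  then show ?thesis
    unfolding is_model_det_iff_quot
    using model.quot_det_unique \<Psi>_det_model_mat intro[OF assms] by metis
qed

end


section \<open>Comparison of the local factors\<close>

context drinfeld_place
begin

text \<open>The ring A[1/q] inside F(t).\<close>

definition A_q :: "'f poly fract set" where
  "A_q = {x. \<exists>n. to_fract (q ^ n) * x \<in> range to_fract}"

lemma A_qE:
  assumes "x \<in> A_q"
  obtains n a where "to_fract (q ^ n) * x = to_fract a"
  using assms by (auto simp: A_q_def)

lemma coeff_emb_Ft: "coeff (map_poly emb_Ft P) n = emb_Ft (coeff P n)"
  by (simp add: coeff_map_poly)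

lemma map_emb_Ft_mem: "P \<in> polys_over A_q \<Longrightarrow> map_poly emb_Ft P \<in> S"
  unfolding S_def polys_over_def using emb_Ft_loc(1) by (force simp: coeff_emb_Ft elim: A_qE)

text \<open>Elements of A[1/q] involve t only, so evaluating \<theta> at a conjugate identifies no
  two of them.\<close>

lemma emb_Ft_inj:
  assumes "x \<in> A_q" "y \<in> A_q" "\<psi> 0 (emb_Ft x) = \<psi> 0 (emb_Ft y)"
  shows "x = y"
proof -
  obtain n a where x: "to_fract (q ^ n) * x = to_fract a" using assms(1) by (rule A_qE)
  obtain m b where y: "to_fract (q ^ m) * y = to_fract b" using assms(2) by (rule A_qE)
  have nz: "A_to_E (q ^ k) \<noteq> 0" for k using q_nz by simp
  have "A_to_E a / A_to_E (q ^ n) = A_to_E b / A_to_E (q ^ m)"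
    using assms(3) emb_Ft_loc(2)[OF x, of 0] emb_Ft_loc(2)[OF y, of 0] by simp
  then have "A_to_E a * A_to_E (q ^ m) = A_to_E b * A_to_E (q ^ n)"
    by (rule frac_eq_eq[OF nz nz, THEN iffD1])
  then have "A_to_E (a * q ^ m) = A_to_E (b * q ^ n)" by (simp only: A_to_E_hom.hom_mult)
  then have "a * q ^ m = b * q ^ n" by (simp only: A_to_E_hom.eq_iff)
  then have "to_fract a * to_fract (q ^ m) = to_fract b * to_fract (q ^ n)"
    by (simp only: to_fract_mult[symmetric])
  then have "to_fract (q ^ n) * to_fract (q ^ m) * x = to_fract (q ^ n) * to_fract (q ^ m) * y"
    unfolding x[symmetric] y[symmetric] by (simp only: mult.assoc mult.commute mult.left_commute)
  moreover have "to_fract (q ^ n) * to_fract (q ^ m) \<noteq> 0" using q_nz by simp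
  ultimately show ?thesis by (metis mult_left_cancel)
qed

lemma map_emb_Ft_inj:
  assumes "P \<in> polys_over A_q" "P' \<in> polys_over A_q" "\<Psi> (map_poly emb_Ft P) = \<Psi> (map_poly emb_Ft P')"
  shows "P = P'"
proof (rule poly_eqI)
  fix n
  have "\<psi> 0 (emb_Ft (coeff P n)) = \<psi> 0 (emb_Ft (coeff P' n))"
    using arg_cong[OF assms(3), of "\<lambda>p. coeff p n"] by (simp add: coeff_emb_Ft)
  then show "coeff P n = coeff P' n"
    using assms(1,2) by (intro emb_Ft_inj) (auto simp: polys_over_def)
qed

lemma coeff_drinfeld_P: "to_fract q * coeff (drinfeld_P \<phi> q) n = to_fract (coeff (drinfeld_order \<phi> q) n)"
  using q_nz by (simp add: drinfeld_P_def coeff_map_poly flip: mult.assoc)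

lemma coeff_drinfeld_order: "A_to_E (coeff (drinfeld_order \<phi> q) n) = A_to_E q * coeff frob_det n"
  using arg_cong[OF drinfeld_order_eq, of "\<lambda>p. coeff p n"] by simp

lemma drinfeld_P_mem: "drinfeld_P \<phi> q \<in> polys_over A_q"
  unfolding polys_over_def A_q_def
  using coeff_drinfeld_P by (auto intro!: exI[of _ 1] simp del: to_fract_mult)

lemma \<Psi>_drinfeld_P: "\<Psi> (map_poly emb_Ft (drinfeld_P \<phi> q)) = frob_det"
proof (rule poly_eqI)
  fix n
  have "to_fract (q ^ 1) * coeff (drinfeld_P \<phi> q) n = to_fract (coeff (drinfeld_order \<phi> q) n)"
    using coeff_drinfeld_P by simp
  from emb_Ft_loc(2)[OF this, of 0]
  show "coeff (\<Psi> (map_poly emb_Ft (drinfeld_P \<phi> q))) n = coeff frob_det n"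
    using q_nz by (simp add: coeff_emb_Ft coeff_drinfeld_order)
qed

text \<open>The Drinfeld factor is itself the witness: one power of q clears its denominators and
  its image is \<open>frob_det\<close>. Uniqueness is the injectivity of reduction on
  A[1/q, T].\<close>

lemma model_P_eq_drinfeld_P:
  "model_P fun_smul (dual_tau \<phi>) (anderson_model \<phi>) q = drinfeld_P \<phi> q"
  unfolding model_P_def A_q_def[symmetric]
proof (rule the_equality)
  show "drinfeld_P \<phi> q \<in> polys_over A_q \<and>
    is_model_det fun_smul (dual_tau \<phi>) (anderson_model \<phi>) q (map_poly emb_Ft (drinfeld_P \<phi> q))"
    by (simp add: drinfeld_P_mem is_model_det_iff map_emb_Ft_mem \<Psi>_drinfeld_P)
  fix P assume P: "P \<in> polys_over A_q \<and>
    is_model_det fun_smul (dual_tau \<phi>) (anderson_model \<phi>) q (map_poly emb_Ft P)"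
  then have "\<Psi> (map_poly emb_Ft P) = frob_det"
    using is_model_det_iff[OF map_emb_Ft_mem, of P] by blast
  with P show "P = drinfeld_P \<phi> q"
    by (intro map_emb_Ft_inj) (simp_all add: drinfeld_P_mem \<Psi>_drinfeld_P)
qed

lemma drinfeld_P_constant_term: "coeff (drinfeld_P \<phi> q) 0 = 1"
proof -
  have "A_to_E (coeff (drinfeld_order \<phi> q) 0) = A_to_E q"
    by (simp add: coeff_drinfeld_order coeff_frob_det(1))
  then have "coeff (drinfeld_order \<phi> q) 0 = q" by (simp only: A_to_E_hom.eq_iff)
  then show ?thesis using coeff_drinfeld_P[of 0] q_nz by simp
qed

text \<open>Provides the assumption \<open>gap\<close> of \<open>euler_product_tendsto\<close> with
  the degree of a place as its weight.\<close>

lemma drinfeld_P_gap: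
  assumes "0 < n" "n < degree q"
  shows "coeff (drinfeld_P \<phi> q) n = 0"
proof -
  have "A_to_E (coeff (drinfeld_order \<phi> q) n) = 0"
    using assms by (simp add: coeff_drinfeld_order coeff_frob_det(2) d_def)
  then have "coeff (drinfeld_order \<phi> q) n = 0" by simp
  then show ?thesis using coeff_drinfeld_P[of n] q_nz by simp
qed

end

theorem theoremA11:
  fixes \<phi> :: "'f::{field,finite} poly \<Rightarrow> 'f poly poly"
  assumes "drinfeld_model \<phi>"
  shows
    "(euler_convergent places (\<lambda>q. fps_of_poly (drinfeld_P \<phi> q)) \<and>
      euler_convergent places
        (\<lambda>q. fps_of_poly (model_P fun_smul (dual_tau \<phi>) (anderson_model \<phi>) q)) \<and>
      drinfeld_L \<phi> = model_L fun_smul (dual_tau \<phi>) (anderson_model \<phi>)) \<and>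
     (\<forall>p\<in>places.
        euler_convergent (places - {p})
          (\<lambda>q. fps_of_poly (model_P fun_smul (dual_tau \<phi>) (anderson_model \<phi>) q)) \<and>
        drinfeld_L_without \<phi> p =
          model_L_without fun_smul (dual_tau \<phi>) (anderson_model \<phi>) p)"
proof -
  let ?D = "\<lambda>q. fps_of_poly (drinfeld_P \<phi> q)"
  let ?M = "\<lambda>q. fps_of_poly (model_P fun_smul (dual_tau \<phi>) (anderson_model \<phi>) q)"
  have local: "\<exists>\<alpha>. drinfeld_place q \<alpha> \<phi>" if "q \<in> places" for q
    using place_root_exists[OF that] assms
    by (auto simp: drinfeld_place_def drinfeld_def)
  have eq: "?M q = ?D q" if "q \<in> places" for q
    using local[OF that] drinfeld_place.model_P_eq_drinfeld_P by force
  have one: "fps_nth (?D q) 0 = 1" if "q \<in> places" for q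
    using local[OF that] drinfeld_place.drinfeld_P_constant_term by force
  have gap: "fps_nth (?D q) n = 0" if "q \<in> places" "0 < n" "n < degree q" for q n
    using local[OF that(1)] drinfeld_place.drinfeld_P_gap that by force
  have conv: "euler_convergent S ?D" if "S \<subseteq> places" for S
    unfolding euler_convergent_def
  proof (rule euler_product_tendsto[where wt = degree])
    show "finite {p \<in> S. degree p \<le> n}" for n
      by (rule finite_subset[OF _ finite_degree_less[of "Suc n"]]) auto
  qed (use that one gap in auto)
  have prod_eq: "(\<lambda>X. \<Prod>p\<in>X. inverse (?M p)) X = (\<lambda>X. \<Prod>p\<in>X. inverse (?D p)) X"
    if "X \<subseteq> places" for X
    using that by (intro prod.cong) (auto simp: eq)
  \<comment> \<open>The factors are known to agree at places only, so the partial products are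
    compared along the filter and not as functions.\<close>
  have ev: "eventually (\<lambda>X. (\<Prod>p\<in>X. inverse (?M p)) = (\<Prod>p\<in>X. inverse (?D p))) (finite_subsets_at_top S)"
    if "S \<subseteq> places" for S
    using that prod_eq by (intro eventually_finite_subsets_at_top_weakI) blast
  have conv_eq: "((\<lambda>X. \<Prod>p\<in>X. inverse (?M p)) \<longlongrightarrow> L) (finite_subsets_at_top S) \<longleftrightarrow>
      ((\<lambda>X. \<Prod>p\<in>X. inverse (?D p)) \<longlongrightarrow> L) (finite_subsets_at_top S)"
    if "S \<subseteq> places" for S L
    by (rule tendsto_cong[OF ev[OF that]])
  have M_conv: "euler_convergent S ?M" if "S \<subseteq> places" for S
    using conv[OF that] unfolding euler_convergent_def conv_eq[OF that] .
  have M_prod: "euler_product S ?M = euler_product S ?D" if "S \<subseteq> places" for S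
  proof -
    obtain L where L: "((\<lambda>X. \<Prod>p\<in>X. inverse (?D p)) \<longlongrightarrow> L) (finite_subsets_at_top S)"
      using conv[OF \<open>S \<subseteq> places\<close>] by (auto simp: euler_convergent_def)
    from L have "((\<lambda>X. \<Prod>p\<in>X. inverse (?M p)) \<longlongrightarrow> L) (finite_subsets_at_top S)"
      by (simp only: conv_eq[OF \<open>S \<subseteq> places\<close>])
    with L show ?thesis
      unfolding euler_product_def by (simp only: tendsto_Lim finite_subsets_at_top_neq_bot not_False_eq_True)
  qed
  \<comment> \<open>One L_p is defined by multiplying the full product by a factor, the other by
    leaving that factor out; this equation reconciles them.\<close>
  have "?D p * euler_product places ?D = euler_product (places - {p}) ?D" if "p \<in> places" for p
    using that one[OF that] by (intro euler_product_remove conv) auto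
  then show ?thesis
    by (auto simp: conv M_conv M_prod drinfeld_L_def model_L_def drinfeld_L_without_def model_L_without_def)
qed

end
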